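(* As $n\to\infty$, $$d_{1,2;3}^{[0]}(n)-d_{2,1;3}^{[0]}(n)=\begin{cases}\dfrac{e^{\pi\sqrt{n/3}}}{n}\left(\dfrac1{24}+O\!\left(n^{-1/4}\right)\right)&\text{if }n\equiv0\pmod 3,\\[2mm]\dfrac{e^{\pi\sqrt{n/3}}}{n}\left(\dfrac16+O\!\left(n^{-1/4}\right)\right)&\text{if }n\equiv1\pmod 3,\\[2mm]\dfrac{e^{\pi\sqrt{n/3}}}{n}\left(-\dfrac1{12}+O\!\left(n^{-1/4}\right)\right)&\text{if }n\equiv2\pmod 3.\end{cases}$$
   Context: $d_{1,2;3}^{[0]}(n)$ (respectively $d_{2,1;3}^{[0]}(n)$) denotes the number of partitions of $n$ into distinct (positive) parts having strictly more parts congruent to $1$ modulo $3$ than parts congruent to $2$ modulo $3$ (respectively strictly more parts congruent to $2$ modulo $3$ than parts congruent to $1$ modulo $3$). *)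

theory Defs
  imports Complex_Main "HOL-Library.Landau_Symbols" "HOL-Number_Theory.Cong"
begin

(* A partition into distinct parts is determined by its set of parts, so it is
   represented as a finite set of positive natural numbers. *)
definition distinct_partitions :: "nat \<Rightarrow> nat set set" where
  "distinct_partitions n = {P. finite P \<and> 0 \<notin> P \<and> \<Sum>P = n}"

definition num_parts_cong :: "nat \<Rightarrow> nat \<Rightarrow> nat set \<Rightarrow> nat" where
  "num_parts_cong a m P = card {x \<in> P. [x = a] (mod m)}"

(* d_{a,b;m}^{[0]}(n) in the usual notation *)
definition d0 :: "nat \<Rightarrow> nat \<Rightarrow> nat \<Rightarrow> nat \<Rightarrow> nat" where
  "d0 a b m n =
     card {P \<in> distinct_partitions n. num_parts_cong a m P > num_parts_cong b m P}"

end

theory Submission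
  imports Defs "HOL-Complex_Analysis.Complex_Analysis" "HOL-Probability.Probability"
    "HOL-Real_Asymp.Real_Asymp"
begin

text \<open>By the Jacobi triple product, the partitions into distinct parts with exactly \<open>k\<close> more parts
  \<open>1 mod 3\<close> than parts \<open>2 mod 3\<close> have generating function \<open>q^(k(3k-1)/2) P(q^3)\<close>, where
  \<open>P(q) = (-q;q)/(q;q)\<close> is the generating function of overpartitions. The difference to be
  estimated is therefore an alternating sum of overpartition numbers along quadratic sequences.
  Gauss' identity \<open>P(q) theta4(q) = 1\<close>, the modular transformation of \<open>theta4\<close> and the circle method
  give \<open>p(m) = F(m) (1 + O(m^(-1/2)))\<close> with \<open>F(m) = exp(pi sqrt m)/(8 m)\<close>. Comparing each difference
  \<open>F(m - j(9j-a)/2) - F(m - j(9j+a)/2)\<close> with \<open>a/9\<close> times the difference of \<open>F\<close> over the larger interval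
  from \<open>9j(j-1)/2\<close> to \<open>9j(j+1)/2\<close>, the alternating sum telescopes to \<open>a/9 F(m)\<close>; only the about
  \<open>m^(1/4)\<close> terms with \<open>j\<close> of that order matter, whence the error \<open>O(m^(-1/4))\<close>.\<close>

section \<open>Fourier series of a Gaussian and the theta transformation\<close>

text \<open>The cancellation dictates the precision. About m^(1/4) terms matter, each known up to a
  relative error m^(-1/2), and only this product keeps the total at m^(-1/4); a bare p(m) ~ F(m)
  would say nothing about the sum. The coefficients arise as follows. For n = 3m + r only k
  congruent to n modulo 3 occurs. If r = 0, the terms k = 3j and k = -3j pair off. If r = 1 or r =
  2, the term k = 1 or k = -1, equal to p(m) up to sign, has no partner. This gives 1/9, 1 - 5/9 and
  7/9 - 1 times F(m), and F(m) is asymptotically 3/8 of exp(pi sqrt(n/3))/n. The transformation of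
  theta4 is used only near q = 1. Elsewhere P is compared factor by factor with its value at |q|,
  which is enough because only an exponential saving is required. The triple product is proved as a
  finite identity in q-binomial coefficients, one excess at a time, so that no series in two
  variables occurs.\<close>

text \<open>Completeness of the cosines on [0, pi]. Product-to-sum formulas turn vanishing moments
  into orthogonality to all powers of cos x, the substitution y = cos x makes Stone-Weierstrass
  applicable, and the integral of D^2 is then arbitrarily small. Two continuous functions can thus
  be identified by their moments alone, without pointwise convergence of Fourier series.\<close>

lemma cosine_moments_eq_0_imp_eq_0:
  fixes D :: "real \<Rightarrow> real"
  assumes cont: "continuous_on {0..pi} D"
    and mom: "\<And>k::nat. integral {0..pi} (\<lambda>x. D x * cos (real k * x)) = 0"
    and x: "x \<in> {0..pi}"
  shows "D x = 0"
proof -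
  have int: "(\<lambda>x. D x * f x) integrable_on {0..pi}" if "continuous_on {0..pi} f" for f
    by (intro integrable_continuous_real continuous_intros cont that)
  have M: "integral {0..pi} (\<lambda>x. D x * (cos x ^ j * cos (real k * x))) = 0" for j k
  proof (induction j arbitrary: k)
    case 0
    then show ?case using mom by simp
  next
    case (Suc j)
    \<comment> \<open>On natural numbers \<open>k - 1\<close> is 0 at \<open>k = 0\<close>; the
      correction makes \<open>l\<close> the absolute value of k - 1, which suffices as cos is
      even.\<close>
    define l where "l = k - 1 + (if k = 0 then 1 else 0)"
    have *: "D x * (cos x ^ Suc j * cos (real k * x)) =
       (1/2) * (D x * (cos x ^ j * cos (real (Suc k) * x))) + (1/2) * (D x * (cos x ^ j * cos (real l * x)))" for x
    proof -
      have "cos x * cos (real k * x) = (cos (real (Suc k) * x) + cos (real l * x)) / 2"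
      proof (cases k)
        case (Suc i)
        have e1: "real (Suc k) * x = real k * x + x" and e2: "real l * x = real k * x - x"
          using Suc by (auto simp: algebra_simps l_def)
        show ?thesis unfolding e1 e2 cos_add cos_diff by (simp add: field_simps)
      qed (auto simp: l_def)
      then have "D x * (cos x ^ Suc j * cos (real k * x)) = D x * cos x ^ j *
          ((cos (real (Suc k) * x) + cos (real l * x)) / 2)"
        by (metis (no_types, lifting) mult.assoc power_Suc2)
      then show ?thesis by (simp add: field_simps)
    qed
    show ?case unfolding *
      by (subst Henstock_Kurzweil_Integration.integral_add)
        (auto intro!: integrable_on_cmult_left int continuous_intros simp: Suc.IH simp del: of_nat_Suc)
  qed
  have P: "integral {0..pi} (\<lambda>x. D x * (\<Sum>i\<le>n. a i * cos x ^ i)) = 0" for a and n :: nat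
  proof -
    have "integral {0..pi} (\<lambda>x. D x * (\<Sum>i\<le>n. a i * cos x ^ i)) = integral {0..pi} (\<lambda>x. \<Sum>i\<le>n. a i * (D x * cos x ^ i))"
      by (simp add: sum_distrib_left algebra_simps)
    also have "\<dots> = (\<Sum>i\<le>n. integral {0..pi} (\<lambda>x. a i * (D x * cos x ^ i)))"
      by (intro integral_sum integrable_continuous_real continuous_intros cont) auto
    also have "\<dots> = 0" using M[where k=0] by simp
    finally show ?thesis .
  qed
  define h where "h y = D (arccos y)" for y
  have hc: "continuous_on {-1..1} h"
    unfolding h_def
    by (rule continuous_on_compose2[OF cont continuous_on_arccos']) (auto simp: arccos_lbound arccos_ubound)
  have hD: "h (cos x) = D x" if "x \<in> {0..pi}" for x
    using that by (simp add: h_def arccos_cos)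
  define B where "B = integral {0..pi} (\<lambda>x. \<bar>D x\<bar>)"
  have sq: "integral {0..pi} (\<lambda>x. D x * D x) \<le> e * B" if "e > 0" for e
  proof -
    obtain p where p: "real_polynomial_function p" "\<And>y. y \<in> {-1..1} \<Longrightarrow> \<bar>h y - p y\<bar> < e"
      using Stone_Weierstrass_real_polynomial_function[OF _ hc \<open>e > 0\<close>] compact_Icc by metis
    obtain a n where a: "p = (\<lambda>x. \<Sum>i\<le>(n::nat). a i * x ^ i)"
      using p(1) real_polynomial_function_iff_sum by blast
    \<comment> \<open>The polynomial part integrates to 0 against \<open>D\<close>, so only the
      approximation error survives, weighted by |D|.\<close>
    have "integral {0..pi} (\<lambda>x. D x * D x) = integral {0..pi} (\<lambda>x. D x * (D x - p (cos x)) + D x * p (cos x))"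
      by (simp add: algebra_simps)
    also have "\<dots> = integral {0..pi} (\<lambda>x. D x * (D x - p (cos x))) + integral {0..pi} (\<lambda>x. D x * p (cos x))"
      by (intro Henstock_Kurzweil_Integration.integral_add int continuous_intros cont) (auto simp: a intro!: continuous_intros)
    also have "integral {0..pi} (\<lambda>x. D x * p (cos x)) = 0" using P by (simp add: a)
    also have "integral {0..pi} (\<lambda>x. D x * (D x - p (cos x))) \<le> integral {0..pi} (\<lambda>x. e * \<bar>D x\<bar>)"
    proof (intro integral_le int integrable_continuous_real continuous_intros cont)
      fix x :: real assume x: "x \<in> {0..pi}"
      have "\<bar>D x - p (cos x)\<bar> \<le> e" using p(2)[of "cos x"] hD[OF x] by auto
      then have "\<bar>D x\<bar> * \<bar>D x - p (cos x)\<bar> \<le> \<bar>D x\<bar> * e" by (intro mult_left_mono) auto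
      then show "D x * (D x - p (cos x)) \<le> e * \<bar>D x\<bar>" by (metis abs_le_D1 abs_mult mult.commute)
    qed (auto simp: a intro!: continuous_intros)
    also have "\<dots> = e * B" by (simp add: B_def)
    finally show ?thesis by simp
  qed
  have "integral {0..pi} (\<lambda>x. D x * D x) \<le> 0"
  proof (rule field_le_epsilon)
    fix e :: real assume "e > 0"
    have B0: "B \<ge> 0" unfolding B_def by (intro integral_nonneg integrable_continuous_real continuous_intros cont) auto
    have "integral {0..pi} (\<lambda>x. D x * D x) \<le> e / (B + 1) * B" using sq[of "e/(B+1)"] B0 \<open>e > 0\<close> by auto
    also have "\<dots> \<le> e" using B0 \<open>e > 0\<close> by (simp add: field_simps)
    finally show "integral {0..pi} (\<lambda>x. D x * D x) \<le> 0 + e" by simp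
  qed
  moreover have "integral {0..pi} (\<lambda>x. D x * D x) \<ge> 0"
    by (intro integral_nonneg int cont) auto
  ultimately have "integral {0..pi} (\<lambda>x. D x * D x) = 0" by simp
  then have "\<forall>x\<in>{0..pi}. D x * D x = 0"
    by (subst (asm) integral_eq_0_iff) (auto intro!: continuous_intros cont)
  with x show ?thesis by auto
qed

text \<open>The value is the characteristic function of the normal distribution after the scaling x
  -> c x, halved by evenness. The form as a limit over growing intervals is the one in which the
  unfolded integrals of a periodised Gaussian appear.\<close>

lemma gaussian_cosine_integral:
  fixes c k :: real
  assumes c: "c > 0"
  shows "((\<lambda>y. integral {0..y} (\<lambda>x. exp (- ((c * x)\<^sup>2) / 2) * cos (k * x))) \<longlongrightarrow>
      sqrt (pi / 2) / c * exp (- ((k / c)\<^sup>2) / 2)) at_top"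
proof -
  let ?f = "\<lambda>x. std_normal_density x * cos (k / c * x)"
  have i0: "integrable lborel ?f"
  proof (rule Bochner_Integration.integrable_bound)
    show "integrable lborel std_normal_density" by simp
    show "AE x in lborel. norm (?f x) \<le> norm (std_normal_density x)"
      by (auto simp: abs_mult intro!: mult_left_le)
  qed auto
  have "complex_of_real (exp (- ((k / c)\<^sup>2) / 2)) = (CLINT x|std_normal_distribution. iexp (k / c * x))"
    using fun_cong[OF char_std_normal_distribution, of "k / c"] by (simp add: char_def)
  also have "\<dots> = (CLINT x|lborel. std_normal_density x *\<^sub>R iexp (k / c * x))"
    by (subst integral_density) auto
  finally have "exp (- ((k / c)\<^sup>2) / 2) = Re (CLINT x|lborel. std_normal_density x *\<^sub>R iexp (k / c * x))"
    by (metis Re_complex_of_real)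
  also have "\<dots> = (LINT x|lborel. Re (std_normal_density x *\<^sub>R iexp (k / c * x)))"
  proof (rule integral_Re[symmetric])
    show "integrable lborel (\<lambda>x. std_normal_density x *\<^sub>R iexp (k / c * x))"
    proof (rule Bochner_Integration.integrable_bound)
      show "integrable lborel std_normal_density" by simp
    qed auto
  qed
  also have "\<dots> = (LINT x|lborel. ?f x)"
    by (intro Bochner_Integration.integral_cong) (auto simp: Re_exp cis_conv_exp[symmetric])
  finally have I: "has_bochner_integral lborel ?f (exp (- ((k / c)\<^sup>2) / 2))"
    using i0 by (simp add: has_bochner_integral_iff)
  then have "has_bochner_integral lborel (\<lambda>x. ?f (0 + c * x)) (exp (- ((k / c)\<^sup>2) / 2) /\<^sub>R \<bar>c\<bar>)"
    using c by (subst (asm) lborel_has_bochner_integral_real_affine_iff[of c _ _ 0]) auto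
  then have "has_bochner_integral lborel (\<lambda>x. sqrt (2 * pi) * ?f (0 + c * x)) (sqrt (2 * pi) * (exp (- ((k / c)\<^sup>2) / 2) /\<^sub>R \<bar>c\<bar>))"
    by (rule has_bochner_integral_mult_right)
  moreover have "(\<lambda>x. sqrt (2 * pi) * ?f (0 + c * x)) = (\<lambda>x. exp (- ((c * x)\<^sup>2) / 2) * cos (k * x))"
  proof
    fix x
    have "k / c * (0 + c * x) = k * x" using c by simp
    then show "sqrt (2 * pi) * ?f (0 + c * x) = exp (- ((c * x)\<^sup>2) / 2) * cos (k * x)"
      unfolding std_normal_density_def by simp
  qed
  moreover have "z /\<^sub>R \<bar>c\<bar> = z / c" for z
    using c by (simp add: field_simps)
  ultimately have J: "has_bochner_integral lborel (\<lambda>x. exp (- ((c * x)\<^sup>2) / 2) * cos (k * x))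
    (sqrt (2 * pi) * (exp (- ((k / c)\<^sup>2) / 2) / c))" (is "has_bochner_integral _ ?g ?J")
    by (simp only:)
  then have gi: "integrable lborel ?g" by (simp add: has_bochner_integral_iff)
  define h where "h x = indicator {0..} x *\<^sub>R ?g x" for x
  have hi: "integrable lborel h" unfolding h_def
    by (rule integrable_mult_indicator[OF _ gi]) auto
  have "has_bochner_integral lborel ?g (2 *\<^sub>R integral\<^sup>L lborel h)"
  proof (rule has_bochner_integral_even_function)
    show "has_bochner_integral lborel (\<lambda>x. indicator {0..} x *\<^sub>R ?g x) (integral\<^sup>L lborel h)"
      using hi unfolding h_def by (rule has_bochner_integral_integrable)
  qed simp
  with J have "2 * integral\<^sup>L lborel h = ?J" using has_bochner_integral_eq by fastforce
  moreover have "sqrt (2 * pi) = 2 * sqrt (pi / 2)"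
    by (rule real_sqrt_unique) (auto simp: power_mult_distrib)
  ultimately have hv: "integral\<^sup>L lborel h = sqrt (pi / 2) / c * exp (- ((k / c)\<^sup>2) / 2)" by simp
  have "((\<lambda>y. \<integral> x. indicator {.. y} x *\<^sub>R h x \<partial>lborel) \<longlongrightarrow> integral\<^sup>L lborel h) at_top"
    by (rule tendsto_integral_at_top[OF _ hi]) simp
  moreover have "(\<integral> x. indicator {.. y} x *\<^sub>R h x \<partial>lborel) = integral {0..y} ?g" for y
  proof -
    have "(\<integral> x. indicator {.. y} x *\<^sub>R h x \<partial>lborel) = (LINT x:{0..y}|lborel. ?g x)"
      unfolding set_lebesgue_integral_def h_def
      by (intro Bochner_Integration.integral_cong) (auto split: split_indicator)
    also have "\<dots> = integral {0..y} ?g"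
      by (rule set_borel_integral_eq_integral) (use integrable_mult_indicator[OF _ gi, of "{0..y}"] in \<open>simp add: set_integrable_def\<close>)
    finally show ?thesis .
  qed
  ultimately show ?thesis by (simp add: hv)
qed

lemma summable_exp_neg_square:
  fixes a :: real
  assumes a: "a > 0"
  shows "summable (\<lambda>n::nat. exp (- a * (real n)\<^sup>2))"
proof (rule summable_comparison_test')
  show "summable (\<lambda>n. exp (- a) ^ n)" using a by (intro summable_geometric) auto
  fix n :: nat
  have "real n \<le> (real n)\<^sup>2" by (cases n) (auto simp: power2_eq_square)
  then have "exp (- a * (real n)\<^sup>2) \<le> exp (real n * (- a))"
    using a by (auto simp: mult.commute)
  then show "norm (exp (- a * (real n)\<^sup>2)) \<le> exp (- a) ^ n"
    by (simp add: exp_of_nat_mult[symmetric])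
qed

lemma integral_suminf_uniform:
  fixes f :: "nat \<Rightarrow> real \<Rightarrow> 'a::banach"
  assumes c: "\<And>n. continuous_on {a..b} (f n)"
    and M: "\<And>n x. x \<in> {a..b} \<Longrightarrow> norm (f n x) \<le> M n" "summable M"
  shows "continuous_on {a..b} (\<lambda>x. \<Sum>n. f n x)"
    and "(\<lambda>n. integral {a..b} (f n)) sums integral {a..b} (\<lambda>x. \<Sum>n. f n x)"
proof -
  have u: "uniform_limit {a..b} (\<lambda>n x. \<Sum>i<n. f i x) (\<lambda>x. \<Sum>n. f n x) sequentially"
    by (rule Weierstrass_m_test) (use M in auto)
  show "continuous_on {a..b} (\<lambda>x. \<Sum>n. f n x)"
    by (rule uniform_limit_theorem[OF _ u]) (auto intro!: always_eventually continuous_on_sum c)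
  obtain I J where I: "\<And>n. ((\<lambda>x. \<Sum>i<n. f i x) has_integral I n) {a..b}"
    and J: "((\<lambda>x. \<Sum>n. f n x) has_integral J) {a..b}" and L: "I \<longlonglongrightarrow> J"
    using uniform_limit_integral[OF u] c by (auto intro!: continuous_intros)
  have "I n = (\<Sum>i<n. integral {a..b} (f i))" for n
  proof -
    have "((\<lambda>x. \<Sum>i<n. f i x) has_integral (\<Sum>i<n. integral {a..b} (f i))) {a..b}"
      by (intro has_integral_sum integrable_integral integrable_continuous_real c) auto
    with I[of n] show ?thesis using has_integral_unique by blast
  qed
  then have "I = (\<lambda>n. \<Sum>i<n. integral {a..b} (f i))" by (rule ext)
  with L show "(\<lambda>n. integral {a..b} (f n)) sums integral {a..b} (\<lambda>x. \<Sum>n. f n x)"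
    unfolding sums_def integral_unique[OF J] by simp
qed

lemma integral_cos_mult_cos:
  "integral {0..pi} (\<lambda>x. cos (real j * x) * cos (real k * x)) =
    (if j = k then if k = 0 then pi else pi / 2 else 0)"
proof -
  have sc: "((\<lambda>x. cos (real_of_int n * x)) has_integral (if n = 0 then pi else 0)) {0..pi}" for n :: int
  proof (cases "n = 0")
    case True
    then show ?thesis using has_integral_const_real[of "1::real" 0 pi] by simp
  next
    case False
    have "((\<lambda>x. cos (real_of_int n * x)) has_integral (sin (real_of_int n * pi) / n - sin (real_of_int n * 0) / n)) {0..pi}"
      using False by (intro fundamental_theorem_of_calculus)
        (auto intro!: derivative_eq_intros simp: has_real_derivative_iff_has_vector_derivative[symmetric])
    moreover have "sin (real_of_int n * pi) = 0" using sin_zero_iff_int2 by blast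
    ultimately show ?thesis using False by simp
  qed
  have "((\<lambda>x. (cos (real_of_int (int j - int k) * x) + cos (real_of_int (int j + int k) * x)) / 2) has_integral
    ((if int j - int k = 0 then pi else 0) + (if int j + int k = 0 then pi else 0)) / 2) {0..pi}"
    by (intro has_integral_divide has_integral_add sc)
  moreover have "(cos (real_of_int (int j - int k) * x) + cos (real_of_int (int j + int k) * x)) / 2 =
     cos (real j * x) * cos (real k * x)" for x
    by (simp add: algebra_simps cos_add cos_diff)
  ultimately show ?thesis by (auto simp: integral_unique)
qed

text \<open>Poisson summation by moments: the periodised Gaussian \<open>F\<close> and a multiple of
  the cosine series 1 + 2 S have equal cosine moments on [0, pi], hence agree there. Evaluation at
  pi instead of 0 yields the alternating signs on one side and the odd squares on the other.\<close>

lemma theta_transformation_real: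
  fixes t :: real
  assumes t: "t > 0"
  shows "1 + 2 * (\<Sum>n. (-1) ^ Suc n * exp (- t * (real (Suc n))\<^sup>2)) =
    2 * sqrt (pi / t) * (\<Sum>n. exp (- pi\<^sup>2 * (2 * real n + 1)\<^sup>2 / (4 * t)))"
proof -
  \<comment> \<open>With this width the Gaussian is exp(-y^2/(4t)), whose cosine transform at k is a
    multiple of exp(-t k^2).\<close>
  define c where "c = 1 / sqrt (2 * t)"
  have c: "c > 0" using t by (simp add: c_def)
  have c2: "c\<^sup>2 = 1 / (2 * t)" using t by (simp add: c_def power_divide)
  define g where "g y = exp (- ((c * y)\<^sup>2) / 2)" for y
  \<comment> \<open>\<open>u m\<close> maps [0, pi] onto [m pi, (m+1) pi], by a translation for even
    \<open>m\<close> and a reflection for odd \<open>m\<close>. As \<open>g\<close> is even, the sum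
    over \<open>m\<close> is the full 2 pi periodisation, while the pieces tile the
    half-line.\<close>
  define u where "u m x = (if even m then real m * pi + x else (real m + 1) * pi - x)" for m :: nat and x
  define F where "F x = (\<Sum>m. g (u m x))" for x
  have gM: "norm (g (u m x)) \<le> exp (- (c\<^sup>2 * pi\<^sup>2 / 2) * (real m)\<^sup>2)" if "x \<in> {0..pi}" for m x
  proof -
    have "real m * pi \<le> u m x" using that by (auto simp: u_def algebra_simps)
    then have "(real m * pi)\<^sup>2 \<le> (u m x)\<^sup>2" by (intro power_mono) auto
    then have "c\<^sup>2 * (real m * pi)\<^sup>2 \<le> c\<^sup>2 * (u m x)\<^sup>2" by (intro mult_left_mono) auto
    then show ?thesis by (simp add: g_def power_mult_distrib mult_ac)
  qed
  have gs: "summable (\<lambda>m. exp (- (c\<^sup>2 * pi\<^sup>2 / 2) * (real m)\<^sup>2))"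
    by (rule summable_exp_neg_square) (use c in auto)
  have gc: "continuous_on A g" for A unfolding g_def by (intro continuous_intros) auto
  have uc: "continuous_on A (u m)" for A m unfolding u_def by (cases "even m") (auto intro!: continuous_intros)
  have guc: "continuous_on A (\<lambda>x. g (u m x))" for A m
    by (rule continuous_on_compose2[OF gc uc]) auto
  note F1 = integral_suminf_uniform(1)[where f="\<lambda>m x. g (u m x)", OF guc gM gs, folded F_def]
  have Fc: "continuous_on {0..pi} F" by (rule F1)
  have Fk: "integral {0..pi} (\<lambda>x. F x * cos (real k * x)) = sqrt (pi * t) * exp (- t * (real k)\<^sup>2)" for k :: nat
  proof -
    let ?H = "\<lambda>y. g y * cos (real k * y)"
    have Hc: "continuous_on A ?H" for A by (intro continuous_intros gc)
    have per: "cos (a + 2 * pi * of_int i) = cos a" for a i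
      using cos.plus_of_int[of a i] by (simp add: mult_ac)
    have cu: "cos (real k * u m x) = cos (real k * x)" for m x
    proof (cases "even m")
      case True
      then obtain l where l: "m = 2 * l" by auto
      have e: "real k * u m x = real k * x + 2 * pi * of_int (int (k * l))"
        unfolding u_def using True by (simp add: l algebra_simps)
      show ?thesis unfolding e by (rule per)
    next
      case False
      then obtain l where l: "m = 2 * l + 1" by (auto elim: oddE)
      have e: "real k * u m x = - (real k * x) + 2 * pi * of_int (int (k * (l + 1)))"
        unfolding u_def using False by (simp add: l algebra_simps)
      show ?thesis unfolding e per by simp
    qed
    have piece: "integral {0..pi} (\<lambda>x. g (u m x) * cos (real k * x)) = integral {real m * pi..real (Suc m) * pi} ?H" for m
    proof -
      let ?I = "integral {real m * pi..real (Suc m) * pi} ?H"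
      have I: "(?H has_integral ?I) (cbox (real m * pi) (real (Suc m) * pi))"
        using integrable_integral[OF integrable_continuous_real[OF Hc]] by auto
      have "((\<lambda>x. ?H (u m x)) has_integral ?I) {0..pi}"
      proof (cases "even m")
        case True
        have e: "real (Suc m) * pi - real m * pi = pi" by (simp add: algebra_simps)
        show ?thesis using has_integral_affinity[OF I, of 1 "real m * pi"] True
          by (simp add: u_def e add.commute del: of_nat_Suc)
      next
        case False
        have e: "real (Suc m) * pi - real m * pi = pi" by (simp add: algebra_simps)
        have "u m x = - x + real (Suc m) * pi" for x using False by (simp add: u_def algebra_simps)
        then show ?thesis using has_integral_affinity[OF I, of "-1" "real (Suc m) * pi"] 
          by (simp add: e del: of_nat_Suc)
      qed
      then show ?thesis by (simp add: cu integral_unique)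
    qed
    have "(\<lambda>m. integral {0..pi} (\<lambda>x. g (u m x) * cos (real k * x))) sums
        integral {0..pi} (\<lambda>x. \<Sum>m. g (u m x) * cos (real k * x))"
    proof (rule integral_suminf_uniform(2))
      show "norm (g (u m x) * cos (real k * x)) \<le> exp (- (c\<^sup>2 * pi\<^sup>2 / 2) * (real m)\<^sup>2)" if "x \<in> {0..pi}" for m x
        using mult_mono[OF gM[OF that, of m] abs_cos_le_one[of "real k * x"]] by (simp add: abs_mult)
    qed (use gs in \<open>auto intro!: continuous_intros guc\<close>)
    also have "integral {0..pi} (\<lambda>x. \<Sum>m. g (u m x) * cos (real k * x)) = integral {0..pi} (\<lambda>x. F x * cos (real k * x))"
    proof (rule Henstock_Kurzweil_Integration.integral_cong)
      fix x :: real assume x: "x \<in> {0..pi}"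
      have "summable (\<lambda>m. g (u m x))"
        by (rule summable_comparison_test'[OF gs]) (use gM[OF x] in auto)
      then show "(\<Sum>m. g (u m x) * cos (real k * x)) = F x * cos (real k * x)"
        unfolding F_def by (rule suminf_mult2[symmetric])
    qed
    finally have 1: "(\<lambda>m. integral {real m * pi..real (Suc m) * pi} ?H) sums integral {0..pi} (\<lambda>x. F x * cos (real k * x))"
      by (simp only: piece)
    have 2: "(\<Sum>m<M. integral {real m * pi..real (Suc m) * pi} ?H) = integral {0..real M * pi} ?H" for M
    proof (induction M)
      case (Suc M)
      have "integral {0..real M * pi} ?H + integral {real M * pi..real (Suc M) * pi} ?H = integral {0..real (Suc M) * pi} ?H"
        by (rule Henstock_Kurzweil_Integration.integral_combine)
          (simp_all add: integrable_continuous_real Hc mult_right_mono)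
      with Suc show ?case by simp
    qed auto
    have "filterlim (\<lambda>M::nat. real M * pi) at_top sequentially"
      by (intro filterlim_at_top_mult_tendsto_pos[OF tendsto_const] filterlim_real_sequentially) auto
    from filterlim_compose[OF gaussian_cosine_integral[OF c, of "real k"] this]
    have "(\<lambda>M. integral {0..real M * pi} ?H) \<longlonglongrightarrow> sqrt (pi / 2) / c * exp (- ((real k / c)\<^sup>2) / 2)"
      by (simp add: g_def)
    moreover have "(\<lambda>M. integral {0..real M * pi} ?H) \<longlonglongrightarrow> integral {0..pi} (\<lambda>x. F x * cos (real k * x))"
      using 1 unfolding sums_def by (simp only: 2)
    ultimately have "integral {0..pi} (\<lambda>x. F x * cos (real k * x)) = sqrt (pi / 2) / c * exp (- ((real k / c)\<^sup>2) / 2)"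
      using LIMSEQ_unique by blast
    moreover have "sqrt (pi / 2) / c = sqrt (pi * t)"
      using t by (simp add: c_def real_sqrt_divide real_sqrt_mult)
    moreover have "- ((real k / c)\<^sup>2) / 2 = - t * (real k)\<^sup>2"
      using t by (simp add: power_divide c2)
    ultimately show ?thesis by simp
  qed
  define S where "S x = (\<Sum>n. exp (- t * (real (Suc n))\<^sup>2) * cos (real (Suc n) * x))" for x
  have es: "summable (\<lambda>n. exp (- t * (real (Suc n))\<^sup>2))"
    using summable_exp_neg_square[OF t] by (subst summable_Suc_iff)
  have cM: "norm (exp (- t * (real (Suc n))\<^sup>2) * cos (real (Suc n) * x)) \<le> exp (- t * (real (Suc n))\<^sup>2)" for n x
    by (simp add: abs_mult mult_left_le del: of_nat_Suc)
  note S1 = integral_suminf_uniform(1)[where f="\<lambda>n x. exp (- t * (real (Suc n))\<^sup>2) * cos (real (Suc n) * x)"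
    and a=0 and b=pi, OF _ cM es, folded S_def]
  have Sc: "continuous_on {0..pi} S" by (rule S1) (intro continuous_intros)
  have Sk: "integral {0..pi} (\<lambda>x. S x * cos (real k * x)) = (if k = 0 then 0 else pi / 2 * exp (- t * (real k)\<^sup>2))" for k :: nat
  proof -
    let ?f = "\<lambda>n x. exp (- t * (real (Suc n))\<^sup>2) * cos (real (Suc n) * x) * cos (real k * x)"
    have "(\<lambda>n. integral {0..pi} (?f n)) sums integral {0..pi} (\<lambda>x. \<Sum>n. ?f n x)"
    proof (rule integral_suminf_uniform(2)[OF _ _ es])
      show "norm (?f n x) \<le> exp (- t * (real (Suc n))\<^sup>2)" for n x
        using mult_mono[OF cM[of n x] abs_cos_le_one[of "real k * x"]] by (simp add: abs_mult del: of_nat_Suc)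
    qed (intro continuous_intros)
    moreover have "integral {0..pi} (\<lambda>x. \<Sum>n. ?f n x) = integral {0..pi} (\<lambda>x. S x * cos (real k * x))"
    proof (rule Henstock_Kurzweil_Integration.integral_cong)
      fix x :: real assume x: "x \<in> {0..pi}"
      have "summable (\<lambda>n. exp (- t * (real (Suc n))\<^sup>2) * cos (real (Suc n) * x))"
        by (rule summable_comparison_test'[OF es]) (rule cM)
      then show "(\<Sum>n. ?f n x) = S x * cos (real k * x)"
        unfolding S_def by (rule suminf_mult2[symmetric])
    qed
    moreover have "integral {0..pi} (?f n) = (if n = k - 1 \<and> k > 0 then pi / 2 * exp (- t * (real k)\<^sup>2) else 0)" for n
    proof -
      have "integral {0..pi} (?f n) = exp (- t * (real (Suc n))\<^sup>2) * integral {0..pi} (\<lambda>x. cos (real (Suc n) * x) * cos (real k * x))"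
        by (simp only: mult.assoc integral_mult_right)
      then show ?thesis by (subst (asm) integral_cos_mult_cos) auto
    qed
    ultimately have "(\<lambda>n. if n = k - 1 \<and> k > 0 then pi / 2 * exp (- t * (real k)\<^sup>2) else 0) sums integral {0..pi} (\<lambda>x. S x * cos (real k * x))"
      by simp
    moreover have "(\<lambda>n. if n = k - 1 \<and> k > 0 then pi / 2 * exp (- t * (real k)\<^sup>2) else 0) sums (if k = 0 then 0 else pi / 2 * exp (- t * (real k)\<^sup>2))"
      using sums_single[of "k - 1" "\<lambda>_. pi / 2 * exp (- t * (real k)\<^sup>2)"] by (cases "k = 0") auto
    ultimately show ?thesis using sums_unique2 by blast
  qed
  define D where "D x = F x - sqrt (t / pi) * (1 + 2 * S x)" for x
  have "D pi = 0"
  proof (rule cosine_moments_eq_0_imp_eq_0[of D])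
    show Dc: "continuous_on {0..pi} D" unfolding D_def by (intro continuous_intros Fc Sc)
    fix k :: nat
    have s: "sqrt (t / pi) * pi = sqrt (pi * t)"
      using t by (simp add: real_sqrt_divide real_sqrt_mult real_div_sqrt field_simps)
    have *: "D x * cos (real k * x) = F x * cos (real k * x) - (sqrt (t / pi) * (cos (real 0 * x) * cos (real k * x)) + (2 * sqrt (t / pi)) * (S x * cos (real k * x)))" for x
      by (simp add: D_def algebra_simps)
    have "integral {0..pi} (\<lambda>x. D x * cos (real k * x)) =
      integral {0..pi} (\<lambda>x. F x * cos (real k * x)) - (sqrt (t / pi) * integral {0..pi} (\<lambda>x. cos (real 0 * x) * cos (real k * x)) +
       (2 * sqrt (t / pi)) * integral {0..pi} (\<lambda>x. S x * cos (real k * x)))"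
    proof -
      let ?A = "\<lambda>x. F x * cos (real k * x)" and ?B = "\<lambda>x. sqrt (t / pi) * (cos (real 0 * x) * cos (real k * x))"
        and ?C = "\<lambda>x. (2 * sqrt (t / pi)) * (S x * cos (real k * x))"
      have i: "?A integrable_on {0..pi}" "?B integrable_on {0..pi}" "?C integrable_on {0..pi}"
        by (intro integrable_continuous_real continuous_intros Fc Sc)+
      have "integral {0..pi} (\<lambda>x. ?A x - (?B x + ?C x)) = integral {0..pi} ?A - (integral {0..pi} ?B + integral {0..pi} ?C)"
        using i by (simp only: Henstock_Kurzweil_Integration.integral_diff
            Henstock_Kurzweil_Integration.integral_add integrable_add)
      then show ?thesis by (simp only: * integral_mult_right)
    qed
    also have "\<dots> = 0" unfolding integral_cos_mult_cos Fk Sk using s by (auto simp: algebra_simps)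
    finally show "integral {0..pi} (\<lambda>x. D x * cos (real k * x)) = 0" .
  qed auto
  then have FS: "F pi = sqrt (t / pi) * (1 + 2 * S pi)" by (simp add: D_def)
  have Spi: "S pi = (\<Sum>n. (-1) ^ Suc n * exp (- t * (real (Suc n))\<^sup>2))"
    unfolding S_def by (intro suminf_cong) (metis cos_npi mult.commute)
  have "summable (\<lambda>m. g (u m pi))"
    by (rule summable_comparison_test'[OF gs]) (use gM[of pi] in auto)
  then have "(\<lambda>m. g (u m pi)) sums F pi" unfolding F_def by (rule summable_sums)
  \<comment> \<open>At x = pi the translated and the reflected argument coincide in (2n + 1) pi, so
    consecutive terms are equal in pairs.\<close>
  from sums_group[OF this, of 2]
  have "(\<lambda>n. \<Sum>m = n * 2..<n * 2 + 2. g (u m pi)) sums F pi" by simp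
  moreover have "(\<Sum>m = n * 2..<n * 2 + 2. g (u m pi)) = 2 * exp (- pi\<^sup>2 * (2 * real n + 1)\<^sup>2 / (4 * t))" for n
  proof -
    have "{n * 2..<n * 2 + 2} = {2 * n, 2 * n + 1}" by auto
    moreover have "u (2 * n) pi = (2 * real n + 1) * pi" "u (2 * n + 1) pi = (2 * real n + 1) * pi"
      by (simp_all add: u_def algebra_simps)
    moreover have "g ((2 * real n + 1) * pi) = exp (- pi\<^sup>2 * (2 * real n + 1)\<^sup>2 / (4 * t))"
      unfolding g_def power_mult_distrib c2 by (simp add: mult_ac)
    ultimately show ?thesis by simp
  qed
  ultimately have sF: "(\<lambda>n. 2 * exp (- pi\<^sup>2 * (2 * real n + 1)\<^sup>2 / (4 * t))) sums F pi" by simp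
  then have "(\<lambda>n. exp (- pi\<^sup>2 * (2 * real n + 1)\<^sup>2 / (4 * t))) sums (F pi / 2)"
    using sums_divide[OF sF, of 2] by simp
  then have "(\<Sum>n. exp (- pi\<^sup>2 * (2 * real n + 1)\<^sup>2 / (4 * t))) = F pi / 2" by (rule sums_unique[symmetric])
  moreover have "sqrt (pi / t) * sqrt (t / pi) = 1"
    using t by (simp flip: real_sqrt_mult)
  ultimately have Zpr: "(\<Sum>n. exp (- pi\<^sup>2 * (2 * real n + 1)\<^sup>2 / (4 * t))) = sqrt (t / pi) * (1 + 2 * S pi) / 2"
      "sqrt (pi / t) * sqrt (t / pi) = 1" unfolding FS by blast+
  have "2 * sqrt (pi / t) * (\<Sum>n. exp (- pi\<^sup>2 * (2 * real n + 1)\<^sup>2 / (4 * t))) = 1 + 2 * S pi"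
  proof -
    have "2 * p * (r * W / 2) = (p * r) * W" for p r W :: real by simp
    then show ?thesis unfolding Zpr using Zpr(2) by simp
  qed
  then show ?thesis unfolding Spi by simp
qed

section \<open>Theta functions as power series on the disc; the transformation on the
  half-plane\<close>

lemma norm_lacunary_le:
  fixes q :: complex
  assumes "n \<le> e" "norm q \<le> r" "r \<le> 1" "norm c \<le> 1"
  shows "norm (c * q ^ e) \<le> r ^ n"
proof -
  have r0: "0 \<le> r" using assms(2) norm_ge_zero order_trans by blast
  have "norm q ^ e \<le> r ^ e" by (rule power_mono) (use assms in auto)
  also have "\<dots> \<le> r ^ n" by (rule power_decreasing) (use assms r0 in auto)
  finally have "norm c * norm q ^ e \<le> 1 * r ^ n" using assms r0 by (intro mult_mono) auto
  then show ?thesis by (simp add: norm_mult norm_power)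
qed

lemma summable_lacunary:
  fixes q :: complex
  assumes "\<And>n. n \<le> e n" "norm q < 1" "\<And>n. norm (c n) \<le> 1"
  shows "summable (\<lambda>n. c n * q ^ e n)"
  by (rule summable_comparison_test'[of "\<lambda>n. norm q ^ n"])
     (use assms in \<open>auto intro!: summable_geometric norm_lacunary_le simp del: norm_mult\<close>)

lemma holomorphic_lacunary:
  assumes e: "\<And>n::nat. n \<le> e n" and c: "\<And>n. norm (c n) \<le> 1"
  shows "(\<lambda>q::complex. \<Sum>n. c n * q ^ e n) holomorphic_on ball 0 1"
proof (rule holomorphic_uniform_sequence)
  show "(\<lambda>q. \<Sum>i<n. c i * q ^ e i) holomorphic_on ball 0 1" for n
    by (intro holomorphic_intros)
  fix x :: complex assume x: "x \<in> ball 0 1"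
  define d where "d = (1 - norm x) / 2"
  have d: "d > 0" using x by (simp add: d_def)
  have nx: "norm q \<le> norm x + d" if "q \<in> cball x d" for q
  proof -
    have "norm (q - x) \<le> d" using that by (simp add: dist_norm norm_minus_commute)
    then show ?thesis using norm_triangle_sub[of q x] by linarith
  qed
  have d1: "norm x + d < 1" using x by (simp add: d_def field_simps)
  have "uniform_limit (cball x d) (\<lambda>n q. \<Sum>i<n. c i * q ^ e i) (\<lambda>q. \<Sum>n. c n * q ^ e n) sequentially"
  proof (rule Weierstrass_m_test)
    show "summable (\<lambda>n. (norm x + d) ^ n)" using d d1 by (intro summable_geometric) auto
    show "norm (c n * q ^ e n) \<le> (norm x + d) ^ n" if "q \<in> cball x d" for n q
      by (rule norm_lacunary_le) (use e c nx[OF that] d1 in auto)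
  qed
  moreover have "cball x d \<subseteq> ball 0 1" using nx d1 by fastforce
  ultimately show "\<exists>d>0. cball x d \<subseteq> ball 0 1 \<and> uniform_limit (cball x d) (\<lambda>n q. \<Sum>i<n. c i * q ^ e i) (\<lambda>q. \<Sum>n. c n * q ^ e n) sequentially"
    using d by blast
qed auto

definition theta4 :: "complex \<Rightarrow> complex" where
  "theta4 q = 1 + 2 * (\<Sum>n. (-1) ^ Suc n * q ^ ((Suc n)\<^sup>2))"

text \<open>Jacobi's theta_2 in the nome q without its leading factor 2 q^(1/4), which leaves a
  power series with constant term 1.\<close>

definition theta2 :: "complex \<Rightarrow> complex" where
  "theta2 q = (\<Sum>n. q ^ (n * (n + 1)))"

lemma Suc_le_power2: "n \<le> (Suc n)\<^sup>2"
  by (simp add: power2_eq_square)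

lemma theta4_holomorphic: "theta4 holomorphic_on ball 0 1"
  unfolding theta4_def[abs_def]
  by (intro holomorphic_intros holomorphic_lacunary) (auto simp: Suc_le_power2 norm_power norm_mult)

lemma theta2_holomorphic: "theta2 holomorphic_on ball 0 1"
  unfolding theta2_def[abs_def]
  using holomorphic_lacunary[of "\<lambda>n. n * (n + 1)" "\<lambda>_. 1"] by simp

lemma norm_theta2_minus_1_le:
  assumes q: "norm q \<le> 1/2"
  shows "norm (theta2 q - 1) \<le> 2 * norm q"
proof -
  have s: "summable (\<lambda>n. q ^ (n * (n + 1)))"
    using summable_lacunary[of "\<lambda>n. n * (n + 1)" q "\<lambda>_. 1"] q by simp
  then have "theta2 q - 1 = (\<Sum>n. q ^ (Suc n * (Suc n + 1)))"
    unfolding theta2_def by (subst suminf_split_head) auto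
  also have "norm \<dots> \<le> (\<Sum>n. norm q * (1/2) ^ n)"
  proof (rule norm_suminf_le)
    show "summable (\<lambda>n. norm q * (1 / 2) ^ n)" by (intro summable_mult summable_geometric) auto
    fix n
    have "norm (q ^ (Suc n * (Suc n + 1))) = norm q * norm q ^ (n * n + 3 * n + 1)"
      by (simp add: norm_power algebra_simps numeral_3_eq_3 flip: power_Suc power_add)
    also have "norm q ^ (n * n + 3 * n + 1) \<le> norm q ^ n"
      by (rule power_decreasing) (use q in auto)
    also have "norm q ^ n \<le> (1/2) ^ n" by (rule power_mono) (use q in auto)
    finally show "norm (q ^ (Suc n * (Suc n + 1))) \<le> norm q * (1 / 2) ^ n"
      by (simp add: mult_left_mono)
  qed
  also have "\<dots> = 2 * norm q" by (subst suminf_mult) (auto simp: suminf_geometric)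
  finally show ?thesis .
qed

text \<open>Both sides are holomorphic in the right half-plane and agree on the positive reals,
  which accumulate at 1. The principal root is holomorphic here because pi/z stays in the right
  half-plane.\<close>

theorem theta_transformation:
  assumes z: "Re z > 0"
  shows "theta4 (exp (-z)) =
    2 * csqrt (of_real pi / z) * exp (- of_real (pi\<^sup>2) / (4 * z)) * theta2 (exp (- of_real (pi\<^sup>2) / z))"
proof -
  let ?S = "{z. Re z > 0}"
  let ?g = "\<lambda>z. 2 * csqrt (of_real pi / z) * exp (- of_real (pi\<^sup>2) / (4 * z)) * theta2 (exp (- of_real (pi\<^sup>2) / z))"
  have pos: "Re (of_real c / z) > 0" if "Re z > 0" "c > 0" for z c
    using that by (auto simp: Re_divide' intro!: divide_pos_pos mult_pos_pos)
  have h4: "(\<lambda>z. theta4 (exp (-z))) holomorphic_on ?S"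
    by (rule holomorphic_on_compose_gen[OF _ theta4_holomorphic, unfolded o_def])
       (auto intro!: holomorphic_intros)
  have h2: "(\<lambda>z. theta2 (exp (- of_real (pi\<^sup>2) / z))) holomorphic_on ?S"
  proof -
    have "(\<lambda>z. exp (- of_real (pi\<^sup>2) / z)) ` ?S \<subseteq> ball 0 1"
    proof safe
      fix z assume "Re z > 0"
      then have "Re (of_real (pi\<^sup>2) / z) > 0" by (intro pos) auto
      then show "exp (- of_real (pi\<^sup>2) / z) \<in> ball 0 1" by simp
    qed
    moreover have "(\<lambda>z. exp (- of_real (pi\<^sup>2) / z)) holomorphic_on ?S"
      by (intro holomorphic_intros) auto
    ultimately show ?thesis
      using holomorphic_on_compose_gen[OF _ theta2_holomorphic] by (auto simp: o_def)
  qed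
  have hs: "(\<lambda>z. csqrt (of_real pi / z)) holomorphic_on ?S"
  proof (rule holomorphic_on_csqrt')
    show "(\<lambda>z. of_real pi / z) holomorphic_on ?S" by (intro holomorphic_intros) auto
    fix z assume "z \<in> ?S"
    then have "Re (of_real pi / z) > 0" using pos[of z pi] by auto
    then show "of_real pi / z \<notin> \<real>\<^sub>\<le>\<^sub>0" by (auto simp: complex_nonpos_Reals_iff)
  qed
  have "theta4 (exp (-z)) - ?g z = 0"
  proof (rule analytic_continuation[where f="\<lambda>z. theta4 (exp (-z)) - ?g z" and S="?S" and U="complex_of_real ` {0<..}" and \<xi> = 1])
    show "(\<lambda>z. theta4 (exp (-z)) - ?g z) holomorphic_on ?S"
      by (intro holomorphic_intros h4 h2 hs) auto
    show "open ?S" by (rule open_halfspace_Re_gt)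
    show "connected ?S" by (intro convex_connected convex_halfspace_Re_gt)
    show "1 islimpt complex_of_real ` {0<..}"
      unfolding islimpt_approachable
    proof safe
      fix e :: real assume "e > 0"
      then show "\<exists>x'\<in>complex_of_real ` {0<..}. x' \<noteq> 1 \<and> dist x' 1 < e"
        by (intro bexI[of _ "complex_of_real (1 + e / 2)"] imageI) (auto simp: dist_norm)
    qed
    fix w assume "w \<in> complex_of_real ` {0<..}"
    then obtain t where t: "w = of_real t" "t > 0" by auto
    have e4: "theta4 (exp (-w)) = of_real (1 + 2 * (\<Sum>n. (-1) ^ Suc n * exp (- t * (real (Suc n))\<^sup>2)))"
    proof -
      have "summable (\<lambda>n. (-1) ^ Suc n * exp (- t * (real (Suc n))\<^sup>2))"
      proof (rule summable_comparison_test')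
        show "summable (\<lambda>n. exp (- t * (real (Suc n))\<^sup>2))"
          using summable_exp_neg_square[OF t(2)] by (subst summable_Suc_iff)
      qed (simp add: abs_mult power_abs)
      moreover have "(-1) ^ Suc n * exp (- w) ^ ((Suc n)\<^sup>2) = complex_of_real ((-1) ^ Suc n * exp (- t * (real (Suc n))\<^sup>2))" for n
      proof -
        have "exp (- w) ^ ((Suc n)\<^sup>2) = exp (of_nat ((Suc n)\<^sup>2) * (- w))" by (rule exp_of_nat_mult[symmetric])
        also have "of_nat ((Suc n)\<^sup>2) * (- w) = complex_of_real (- t * (real (Suc n))\<^sup>2)"
          unfolding t by simp
        finally have "exp (- w) ^ ((Suc n)\<^sup>2) = complex_of_real (exp (- t * (real (Suc n))\<^sup>2))"
          by (simp only: exp_of_real)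
        then show ?thesis by (simp only: of_real_mult of_real_power of_real_minus of_real_1)
      qed
      ultimately show ?thesis
        unfolding theta4_def of_real_add of_real_mult by (subst suminf_of_real) simp_all
    qed
    have "summable (\<lambda>n. exp (- (pi\<^sup>2 / t)) ^ (n * (n + 1)))"
    proof (rule summable_comparison_test')
      show "summable (\<lambda>n. exp (- (pi\<^sup>2 / t)) ^ n)" using t by (intro summable_geometric) auto
      show "norm (exp (- (pi\<^sup>2 / t)) ^ (n * (n + 1))) \<le> exp (- (pi\<^sup>2 / t)) ^ n" for n
        unfolding norm_power using t by (auto intro!: power_decreasing)
    qed
    note sm = this
    have e2: "theta2 (exp (- of_real (pi\<^sup>2) / w)) = of_real (\<Sum>n. exp (- (pi\<^sup>2 / t)) ^ (n * (n + 1)))"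
      unfolding theta2_def by (subst suminf_of_real[OF sm]) (simp add: t exp_of_real[symmetric])
    \<comment> \<open>Since (2n+1)^2/4 = n(n+1) + 1/4, the factor exp(-pi^2/(4t)) splits off from
      every term.\<close>
    have "exp (- pi\<^sup>2 * (2 * real n + 1)\<^sup>2 / (4 * t)) = exp (- (pi\<^sup>2 / (4 * t))) * exp (- (pi\<^sup>2 / t)) ^ (n * (n + 1))" for n
    proof -
      have "- pi\<^sup>2 * (2 * real n + 1)\<^sup>2 / (4 * t) = - (pi\<^sup>2 / (4 * t)) + real (n * (n + 1)) * (- (pi\<^sup>2 / t))"
        using t by (simp add: field_simps power2_eq_square)
      then show ?thesis by (simp only: exp_add exp_of_nat_mult)
    qed
    then have e3: "(\<Sum>n. exp (- pi\<^sup>2 * (2 * real n + 1)\<^sup>2 / (4 * t))) = exp (- (pi\<^sup>2 / (4 * t))) * (\<Sum>n. exp (- (pi\<^sup>2 / t)) ^ (n * (n + 1)))"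
      using suminf_mult[OF sm] by simp
    have "csqrt (of_real pi / w) = csqrt (of_real (pi / t))" by (simp add: t)
    also have "\<dots> = of_real (sqrt (pi / t))"
      by (subst csqrt_of_real_nonneg) (use t in auto)
    finally have "csqrt (of_real pi / w) = of_real (sqrt (pi / t))" .
    moreover have "exp (- of_real (pi\<^sup>2) / (4 * w)) = of_real (exp (- (pi\<^sup>2 / (4 * t))))"
      by (simp add: t exp_of_real[symmetric])
    ultimately show "theta4 (exp (-w)) - ?g w = 0"
      unfolding e4 e2 theta_transformation_real[OF t(2)] e3 by simp
  qed (use z in auto)
  then show ?thesis by simp
qed

section \<open>The generating function of distinct partitions by excess\<close>

definition excess :: "nat set \<Rightarrow> int" where
  "excess P = int (num_parts_cong 1 3 P) - int (num_parts_cong 2 3 P)"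

definition num_excess :: "int \<Rightarrow> nat \<Rightarrow> nat" where
  "num_excess k n = card {P \<in> distinct_partitions n. excess P = k}"

definition part_sign :: "nat \<Rightarrow> int" where
  "part_sign x = (if x mod 3 = 1 then 1 else if x mod 3 = 2 then -1 else 0)"

lemma excess_empty [simp]: "excess {} = 0"
  by (simp add: excess_def num_parts_cong_def)

lemma excess_insert:
  assumes "finite P" "x \<notin> P"
  shows "excess (insert x P) = excess P + part_sign x"
proof -
  have "{y \<in> insert x P. [y = a] (mod 3)} =
      (if [x = a] (mod 3) then insert x {y \<in> P. [y = a] (mod 3)} else {y \<in> P. [y = a] (mod 3)})" for a
    by auto
  then have "num_parts_cong a 3 (insert x P) = num_parts_cong a 3 P + (if [x = a] (mod 3) then 1 else 0)" for a
    using assms by (auto simp: num_parts_cong_def)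
  moreover have "[x = 1] (mod 3) \<longleftrightarrow> x mod 3 = 1" "[x = 2] (mod 3) \<longleftrightarrow> x mod 3 = 2"
    by (auto simp: Cong.cong_def)
  ultimately show ?thesis by (simp add: excess_def part_sign_def)
qed

text \<open>Every part is congruent to its sign modulo 3. Consequently excess 0 occurs only for
  multiples of 3, which makes the series for excess 0 a series in q^3.\<close>

lemma cong_sum_excess: "finite P \<Longrightarrow> [int (\<Sum>P) = excess P] (mod 3)"
proof (induction P rule: finite_induct)
  case (insert x P)
  have "[int x = part_sign x] (mod 3)"
  proof -
    have "int x mod 3 = int (x mod 3)" by (simp add: zmod_int)
    moreover have "x mod 3 = 0 \<or> x mod 3 = 1 \<or> x mod 3 = 2" by arith
    moreover have "x mod 3 = 2 \<Longrightarrow> [int x = - 1] (mod 3)"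
      by (simp add: cong_iff_dvd_diff) presburger
    ultimately show ?thesis by (auto simp: part_sign_def Cong.cong_def)
  qed
  from cong_add[OF insert.IH this] insert.hyps show ?case
    by (simp add: excess_insert add.commute)
qed simp

lemma finite_distinct_partitions: "finite (distinct_partitions n)"
proof -
  have "distinct_partitions n \<subseteq> Pow {..n}"
    by (auto simp: distinct_partitions_def intro: member_le_sum[of _ _ "\<lambda>x. x", simplified])
  then show ?thesis using finite_subset by blast
qed

text \<open>The coefficient of z^k in the product of 1 + z^(part_sign x) q^x over x in
  \<open>S\<close>.\<close>

definition excess_gf :: "nat set \<Rightarrow> int \<Rightarrow> complex \<Rightarrow> complex" where
  "excess_gf S k q = (\<Sum>P | P \<subseteq> S \<and> excess P = k. q ^ \<Sum>P)"

lemma excess_gf_insert: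
  assumes "finite S" "x \<notin> S"
  shows "excess_gf (insert x S) k q = excess_gf S k q + q ^ x * excess_gf S (k - part_sign x) q"
proof -
  let ?A = "{P. P \<subseteq> S \<and> excess P = k}" and ?B = "{P. P \<subseteq> S \<and> excess P = k - part_sign x}"
  have fin: "finite P" if "P \<subseteq> S" for P using that assms finite_subset by blast
  have "{P. P \<subseteq> insert x S \<and> excess P = k} = ?A \<union> insert x ` ?B"
  proof (intro equalityI subsetI)
    fix P assume P: "P \<in> {P. P \<subseteq> insert x S \<and> excess P = k}"
    show "P \<in> ?A \<union> insert x ` ?B"
    proof (cases "x \<in> P")
      case True
      then have "P = insert x (P - {x})" by auto
      moreover have "P - {x} \<subseteq> S" using P by auto
      moreover have "excess P = excess (P - {x}) + part_sign x"
        using excess_insert[of "P - {x}" x] fin[OF \<open>P - {x} \<subseteq> S\<close>] True by (simp add: insert_absorb)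
      ultimately show ?thesis using P by (intro UnI2 image_eqI[of _ _ "P - {x}"]) auto
    qed (use P in auto)
  next
    fix P assume "P \<in> ?A \<union> insert x ` ?B"
    then show "P \<in> {P. P \<subseteq> insert x S \<and> excess P = k}"
    proof
      assume "P \<in> insert x ` ?B"
      then obtain R where R: "P = insert x R" "R \<subseteq> S" "excess R = k - part_sign x" by auto
      then have "excess P = k" using excess_insert[of R x] fin[of R] assms by auto
      then show ?thesis using R by auto
    qed auto
  qed
  moreover have "finite ?A" "finite ?B" using assms by auto
  moreover have "?A \<inter> insert x ` ?B = {}" using assms by auto
  moreover have "inj_on (insert x) ?B" using assms by (auto simp: inj_on_def)
  moreover have "(\<Sum>P\<in>?B. q ^ \<Sum>(insert x P)) = (\<Sum>P\<in>?B. q ^ x * q ^ \<Sum>P)"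
  proof (intro sum.cong refl)
    fix P assume "P \<in> ?B"
    then have "\<Sum>(insert x P) = x + \<Sum>P" using assms fin by (subst sum.insert) auto
    then show "q ^ \<Sum>(insert x P) = q ^ x * q ^ \<Sum>P" by (simp add: power_add)
  qed
  ultimately show ?thesis
    unfolding excess_gf_def by (simp add: sum.union_disjoint sum.reindex sum_distrib_left)
qed

lemma excess_gf_empty: "excess_gf {} k q = (if k = 0 then 1 else 0)"
proof -
  have "{P. P \<subseteq> {} \<and> excess P = k} = (if k = 0 then {{}} else {})" by auto
  then show ?thesis by (auto simp: excess_gf_def)
qed

text \<open>Parts of signs 1, -1 and 0 are adjoined together, so that one step here matches one step
  of the central q-binomials in \<open>qbinom_Suc\<close>.\<close>

lemma excess_gf_Suc:
  "excess_gf {1..3 * Suc N} k q = (1 + (q ^ 3) ^ Suc N) *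
     ((1 + q ^ (3 * N + 1) * q ^ (3 * N + 2)) * excess_gf {1..3 * N} k q +
      q ^ (3 * N + 1) * excess_gf {1..3 * N} (k - 1) q +
      q ^ (3 * N + 2) * excess_gf {1..3 * N} (k + 1) q)"
proof -
  have s: "{1..3 * Suc N} = insert (3 * N + 3) (insert (3 * N + 2) (insert (3 * N + 1) {1..3 * N}))"
    by auto
  have c: "part_sign (3 * N + 1) = 1" "part_sign (3 * N + 2) = -1" "part_sign (3 * N + 3) = 0"
    unfolding part_sign_def by presburger+
  let ?S1 = "insert (3 * N + 1) {1..3 * N}" and ?S2 = "insert (3 * N + 2) (insert (3 * N + 1) {1..3 * N})"
  have 1: "excess_gf ?S1 k q = excess_gf {1..3 * N} k q + q ^ (3 * N + 1) * excess_gf {1..3 * N} (k - 1) q" for k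
    by (subst excess_gf_insert) (auto simp only: c, auto)
  have 2: "excess_gf ?S2 k q = excess_gf ?S1 k q + q ^ (3 * N + 2) * excess_gf ?S1 (k + 1) q"
    by (subst excess_gf_insert) (auto simp only: c, auto)
  have 3: "excess_gf (insert (3 * N + 3) ?S2) k q = excess_gf ?S2 k q + q ^ (3 * N + 3) * excess_gf ?S2 k q"
    by (subst excess_gf_insert) (auto simp only: c, auto)
  have 4: "q ^ (3 * N + 3) = (q ^ 3) ^ Suc N" by (simp only: power_mult[symmetric]) (simp add: algebra_simps)
  define x y where "x = q ^ (3 * N + 1)" and "y = q ^ (3 * N + 2)"
  show ?thesis unfolding s 3 2 1 4 x_def[symmetric] y_def[symmetric]
    by (simp add: algebra_simps)
qed

section \<open>Gaussian binomials and the finite triple product\<close>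

definition qprod :: "complex \<Rightarrow> nat \<Rightarrow> complex" where
  "qprod q n = (\<Prod>i = 1..n. 1 - q ^ i)"

text \<open>The value 0 at negative \<open>k\<close> is the usual convention for 1/(q;q)_k; it makes
  \<open>qbinom\<close> vanish off its range and removes boundary cases from the
  recurrences.\<close>

definition qinv :: "complex \<Rightarrow> int \<Rightarrow> complex" where
  "qinv q k = (if k < 0 then 0 else 1 / qprod q (nat k))"

text \<open>The central row of Gaussian binomials: \<open>[2N choose N + k]\<close> in base \<open>q\<close>, for all integers \<open>k\<close>.\<close>
definition qbinom :: "complex \<Rightarrow> nat \<Rightarrow> int \<Rightarrow> complex" where
  "qbinom q N k = qprod q (2 * N) * qinv q (int N - k) * qinv q (int N + k)"

lemma one_minus_power_nonzero:
  fixes q :: complex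
  assumes "norm q < 1" "i > 0"
  shows "1 - q ^ i \<noteq> 0"
proof -
  have "norm (q ^ i) < 1" using assms by (simp add: norm_power power_less_one_iff)
  then show ?thesis by auto
qed

lemma qprod_nonzero: "norm q < 1 \<Longrightarrow> qprod q n \<noteq> 0"
  unfolding qprod_def by (subst prod_zero_iff) (auto simp: one_minus_power_nonzero simp del: right_minus_eq)

text \<open>At k = 0 the factor 1 - q^0 vanishes, in agreement with the value 0 at -1; for negative
  k both sides are 0. The recursion therefore holds on all integers.\<close>

lemma qinv_step:
  assumes q: "q \<noteq> 0" "norm q < 1"
  shows "qinv q (k - 1) = (1 - q powi k) * qinv q k"
proof (cases "k \<le> 0")
  case True
  then show ?thesis by (cases "k = 0") (auto simp: qinv_def)
next
  case False
  then have n: "k = int (Suc (nat (k - 1)))" by simp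
  define n where "n = nat (k - 1)"
  note n = n[folded n_def]
  have "qprod q (Suc n) = qprod q n * (1 - q ^ Suc n)"
    by (simp add: qprod_def)
  then show ?thesis
    using one_minus_power_nonzero[OF q(2), of "Suc n"] qprod_nonzero[OF q(2), of n]
    by (simp add: n qinv_def nat_add_distrib power_int_def del: power_Suc) 
qed

text \<open>Two q-Pascal steps in one. All q-binomials are expressed by the common factors
  \<open>qinv q (a + 1)\<close> and \<open>qinv q (b + 1)\<close>, after which a polynomial identity
  in q, x = q^a and y = q^b remains.\<close>

lemma qbinom_Suc:
  assumes q: "q \<noteq> 0" "norm q < 1"
  shows "qbinom q (Suc N) k = (1 + q ^ (2 * N + 1)) * qbinom q N k +
     q powi (int N + 1 - k) * qbinom q N (k - 1) + q powi (int N + 1 + k) * qbinom q N (k + 1)"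
proof -
  define a b where "a = int N - k" and "b = int N + k"
  define x y where "x = q powi a" and "y = q powi b"
  have p1: "q powi (j + 1) = q * q powi j" for j
    using q by (simp add: power_int_add)
  have xy: "q ^ (2 * N) = x * y"
  proof -
    have "x * y = q powi (a + b)" using q by (simp add: x_def y_def power_int_add)
    also have "a + b = int (2 * N)" by (simp add: a_def b_def)
    finally show ?thesis by (simp only: power_int_of_nat)
  qed
  have r: "qinv q j = (1 - q * q powi j) * qinv q (j + 1)" for j
    using qinv_step[OF q, of "j + 1"] by (simp add: p1)
  have r': "qinv q (j - 1) = (1 - q powi j) * (1 - q * q powi j) * qinv q (j + 1)" for j
    using qinv_step[OF q, of j] r[of j] by simp
  have L: "qbinom q (Suc N) k = qprod q (2 * N) * (1 - q * (x * y)) * (1 - q * (q * (x * y))) * qinv q (a + 1) * qinv q (b + 1)"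
    unfolding qbinom_def qprod_def a_def b_def by (simp add: xy[symmetric] algebra_simps)
  have 1: "qbinom q N k = qprod q (2 * N) * ((1 - q * x) * qinv q (a + 1)) * ((1 - q * y) * qinv q (b + 1))"
    unfolding qbinom_def by (simp add: r[of a, folded x_def] r[of b, folded y_def] flip: a_def b_def)
  have 2: "qbinom q N (k - 1) = qprod q (2 * N) * qinv q (a + 1) * ((1 - y) * (1 - q * y) * qinv q (b + 1))"
  proof -
    have "int N - (k - 1) = a + 1" "int N + (k - 1) = b - 1" by (simp_all add: a_def b_def)
    then show ?thesis unfolding qbinom_def by (simp only: r'[of b, folded y_def])
  qed
  have 3: "qbinom q N (k + 1) = qprod q (2 * N) * ((1 - x) * (1 - q * x) * qinv q (a + 1)) * qinv q (b + 1)"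
  proof -
    have "int N - (k + 1) = a - 1" "int N + (k + 1) = b + 1" by (simp_all add: a_def b_def)
    then show ?thesis unfolding qbinom_def by (simp only: r'[of a, folded x_def])
  qed
  have 4: "q powi (int N + 1 - k) = q * x" "q powi (int N + 1 + k) = q * y" "q ^ (2 * N + 1) = q * (x * y)"
  proof -
    have "int N + 1 - k = a + 1" "int N + 1 + k = b + 1" by (simp_all add: a_def b_def)
    then show "q powi (int N + 1 - k) = q * x" "q powi (int N + 1 + k) = q * y"
      by (simp_all only: p1 x_def y_def)
    show "q ^ (2 * N + 1) = q * (x * y)" using xy by simp
  qed
  show ?thesis unfolding L 1 2 3 4 by (simp add: algebra_simps)
qed

definition pent :: "int \<Rightarrow> int" where
  "pent k = k * (3 * k - 1) div 2"

lemma two_pent: "2 * pent k = k * (3 * k - 1)"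
proof -
  have "even (k * (3 * k - 1))" by auto
  then show ?thesis by (simp add: pent_def)
qed

lemma pent_nonneg: "pent k \<ge> 0"
proof -
  have "k * (3 * k - 1) \<ge> 0"
    by (cases "k \<le> 0") (auto intro: mult_nonpos_nonpos)
  then show ?thesis by (simp add: pent_def)
qed

text \<open>A finite Jacobi triple product in base q^3, with the multiples of 3 as the extra
  product. The recurrences of the two sides coincide because pent (k - 1) and pent (k + 1) differ
  from pent k by linear terms, which combine with 3N + 2 or 3N + 1 into exponents of q^3.\<close>

theorem finite_excess_gf:
  assumes q: "q \<noteq> 0" "norm q < 1"
  shows "excess_gf {1..3 * N} k q = q powi pent k * qbinom (q ^ 3) N k * (\<Prod>i = 1..N. 1 + (q ^ 3) ^ i)"
proof (induction N arbitrary: k)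
  case 0
  then show ?case by (auto simp: excess_gf_empty qbinom_def qinv_def qprod_def pent_def)
next
  case (Suc N)
  let ?Q = "q ^ 3" and ?R = "\<Prod>i = 1..N. 1 + (q ^ 3) ^ i"
  have Q: "?Q \<noteq> 0" "norm ?Q < 1" using q by (auto simp: norm_power power_less_one_iff)
  have Qpow: "?Q powi j = q powi (3 * j)" for j
    by (subst power_int_mult) simp
  have "2 * pent (k - 1) = 2 * (pent k - (3 * k - 2))" "2 * pent (k + 1) = 2 * (pent k + (3 * k + 1))"
    unfolding two_pent right_diff_distrib distrib_left by (simp_all add: algebra_simps)
  then have pm: "pent (k - 1) = pent k - (3 * k - 2)" and pp: "pent (k + 1) = pent k + (3 * k + 1)" by simp_all
  have e: "q ^ i * q powi pent k' = q powi pent k * ?Q powi j" if "int i + pent k' = pent k + 3 * j" for i k' j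
  proof -
    have "q ^ i * q powi pent k' = q powi (int i + pent k')"
      using q by (subst power_int_add) auto
    then show ?thesis using q unfolding that by (simp add: power_int_add Qpow)
  qed
  have e1: "q ^ (3 * N + 1) * q powi pent (k - 1) = q powi pent k * ?Q powi (int N + 1 - k)"
    by (rule e) (simp add: pm)
  have e2: "q ^ (3 * N + 2) * q powi pent (k + 1) = q powi pent k * ?Q powi (int N + 1 + k)"
    by (rule e) (simp add: pp)
  have e3: "q ^ (3 * N + 1) * q ^ (3 * N + 2) = ?Q ^ (2 * N + 1)"
  proof -
    have "3 * N + 1 + (3 * N + 2) = 3 * (2 * N + 1)" by simp
    then show ?thesis by (simp only: power_mult[symmetric] power_add[symmetric])
  qed
  have "excess_gf {1..3 * Suc N} k q = (1 + ?Q ^ Suc N) * ?R *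
     ((1 + q ^ (3 * N + 1) * q ^ (3 * N + 2)) * q powi pent k * qbinom ?Q N k +
      (q ^ (3 * N + 1) * q powi pent (k - 1)) * qbinom ?Q N (k - 1) +
      (q ^ (3 * N + 2) * q powi pent (k + 1)) * qbinom ?Q N (k + 1))"
    unfolding excess_gf_Suc Suc.IH by (simp add: algebra_simps)
  also have "\<dots> = (1 + ?Q ^ Suc N) * ?R * (q powi pent k * qbinom ?Q (Suc N) k)"
    unfolding e1 e2 e3 qbinom_Suc[OF Q] by (simp add: algebra_simps)
  finally show ?case by (simp add: mult_ac)
qed

section \<open>Passage to infinite products and power series\<close>

lemma sum_power_subsets:
  fixes q :: "'a::comm_ring_1"
  assumes "finite S"
  shows "(\<Sum>P\<in>Pow S. q ^ \<Sum>P) = (\<Prod>i\<in>S. 1 + q ^ i)"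
proof -
  have "(\<Prod>i\<in>S. q ^ i + 1) = (\<Sum>P\<in>Pow S. (\<Prod>i\<in>P. q ^ i) * (\<Prod>i\<in>S - P. 1))"
    by (rule prod_add[OF assms])
  then show ?thesis by (simp add: power_sum add.commute)
qed

lemma prod_one_plus_power_le:
  fixes r :: real
  assumes r: "0 \<le> r" "r < 1"
  shows "(\<Prod>i = 1..M. 1 + r ^ i) \<le> exp (1 / (1 - r))"
proof -
  have "(\<Prod>i = 1..M. 1 + r ^ i) \<le> (\<Prod>i = 1..M. exp (r ^ i))"
    by (rule prod_mono) (use r in auto)
  also have "\<dots> = exp (\<Sum>i = 1..M. r ^ i)" by (simp add: exp_sum)
  also have "(\<Sum>i = 1..M. r ^ i) \<le> (\<Sum>i. r ^ i)"
    by (rule sum_le_suminf) (use r in auto)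
  also have "\<dots> = 1 / (1 - r)" using r by (simp add: suminf_geometric)
  finally show ?thesis by simp
qed

lemma finite_family_bound:
  assumes "finite X" "\<And>P. P \<in> X \<Longrightarrow> finite P \<and> (0::nat) \<notin> P"
  obtains M where "\<And>P. P \<in> X \<Longrightarrow> P \<subseteq> {1..M}"
proof
  fix P assume P: "P \<in> X"
  show "P \<subseteq> {1..Max (insert 0 (\<Union>X))}"
  proof
    fix x assume x: "x \<in> P"
    then have "x \<le> Max (insert 0 (\<Union>X))" using P assms by (intro Max_ge) auto
    moreover have "x \<noteq> 0" using x P assms(2) by metis
    ultimately show "x \<in> {1..Max (insert 0 (\<Union>X))}" by simp
  qed
qed

text \<open>A finite family of partitions lies in the powerset of some {1..M}, whose total weight is
  a product bounded independently of M.\<close>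

lemma partition_weights_summable:
  assumes q: "norm (q::complex) < 1"
  shows "(\<lambda>P. q ^ \<Sum>P) summable_on {P. finite P \<and> 0 \<notin> P}"
proof (rule abs_summable_summable, rule nonneg_bdd_above_summable_on)
  let ?B = "{P::nat set. finite P \<and> 0 \<notin> P}"
  show "bdd_above (sum (\<lambda>P. norm (q ^ \<Sum>P)) ` {F. F \<subseteq> ?B \<and> finite F})"
  proof (rule bdd_aboveI2)
    fix F assume F: "F \<in> {F. F \<subseteq> ?B \<and> finite F}"
    then obtain M where "\<And>P. P \<in> F \<Longrightarrow> P \<subseteq> {1..M}"
      using finite_family_bound[of F] by auto
    then have "F \<subseteq> Pow {1..M}" by auto
    then have "(\<Sum>P\<in>F. norm (q ^ \<Sum>P)) \<le> (\<Sum>P\<in>Pow {1..M}. norm q ^ \<Sum>P)"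
      unfolding norm_power by (intro sum_mono2) auto
    also have "\<dots> = (\<Prod>i = 1..M. 1 + norm q ^ i)" by (rule sum_power_subsets) auto
    also have "\<dots> \<le> exp (1 / (1 - norm q))" by (rule prod_one_plus_power_le) (use q in auto)
    finally show "(\<Sum>P\<in>F. norm (q ^ \<Sum>P)) \<le> exp (1 / (1 - norm q))" .
  qed
qed auto

text \<open>Absolute summability over all partitions lets one sum be computed in two ways: along the
  exhausting families of subsets of {1..3N}, which gives \<open>L\<close>, and grouped by the
  partitioned number, which gives the power series.\<close>

lemma num_excess_sums:
  assumes q: "norm q < 1"
    and lim: "(\<lambda>N. excess_gf {1..3 * N} k q) \<longlonglongrightarrow> L"
  shows "(\<lambda>n. of_nat (num_excess k n) * q ^ n) sums L"
proof -
  let ?B = "{P::nat set. finite P \<and> 0 \<notin> P \<and> excess P = k}"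
  let ?f = "\<lambda>P::nat set. q ^ \<Sum>P"
  let ?S = "\<lambda>N. {P. P \<subseteq> {1..3 * N} \<and> excess P = k}"
  have "?f summable_on ?B"
    by (rule summable_on_subset_banach[OF partition_weights_summable[OF q]]) auto
  then obtain S where S: "(?f has_sum S) ?B" by (auto simp: summable_on_def)
  have "filterlim ?S (finite_subsets_at_top ?B) sequentially"
    unfolding filterlim_finite_subsets_at_top
  proof (intro allI impI)
    fix X assume X: "finite X \<and> X \<subseteq> ?B"
    then obtain M where M: "\<And>P. P \<in> X \<Longrightarrow> P \<subseteq> {1..M}"
      using finite_family_bound[of X] by auto
    have "X \<subseteq> ?S N" if "N \<ge> M" for N
    proof
      fix P assume "P \<in> X"
      with M[of P] X that show "P \<in> ?S N" by fastforce
    qed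
    then show "\<forall>\<^sub>F N in sequentially. finite (?S N) \<and>
       X \<subseteq> ?S N \<and> ?S N \<subseteq> ?B"
      by (intro eventually_sequentiallyI[of M]) (auto intro: finite_subset)
  qed
  from filterlim_compose[OF S[unfolded has_sum_def] this]
  have "(\<lambda>N. excess_gf {1..3 * N} k q) \<longlonglongrightarrow> S"
    unfolding excess_gf_def .
  with lim have "S = L" using LIMSEQ_unique by blast
  let ?A = "\<lambda>n. {P \<in> distinct_partitions n. excess P = k}"
  have "snd ` Sigma UNIV ?A = ?B"
    by (force simp: distinct_partitions_def image_iff)
  moreover have "inj_on snd (Sigma UNIV ?A)"
    by (auto simp: inj_on_def distinct_partitions_def)
  ultimately have "((?f \<circ> snd) has_sum L) (Sigma UNIV ?A)"
    using S \<open>S = L\<close> has_sum_reindex[of snd "Sigma UNIV ?A" ?f L] by simp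
  then have "((\<lambda>n. of_nat (num_excess k n) * q ^ n) has_sum L) UNIV"
  proof (rule has_sum_SigmaD)
    fix n
    have "((\<lambda>P. (?f \<circ> snd) (n, P)) has_sum (\<Sum>P\<in>?A n. (?f \<circ> snd) (n, P))) (?A n)"
      by (intro has_sum_finite) (use finite_distinct_partitions in auto)
    also have "(\<Sum>P\<in>?A n. (?f \<circ> snd) (n, P)) = (\<Sum>P\<in>?A n. q ^ n)"
      by (intro sum.cong) (auto simp: distinct_partitions_def)
    also have "\<dots> = of_nat (num_excess k n) * q ^ n"
      by (simp add: num_excess_def)
    finally show "((\<lambda>P. (?f \<circ> snd) (n, P)) has_sum of_nat (num_excess k n) * q ^ n) (?A n)" .
  qed
  then show ?thesis by (rule has_sum_imp_sums)
qed

lemma one_plus_power_nonzero: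
  fixes q :: complex
  assumes "norm q < 1" "i > 0"
  shows "1 + q ^ i \<noteq> 0"
proof -
  have "norm (q ^ i) < 1" using assms by (simp add: norm_power power_less_one_iff)
  moreover have "norm (q ^ i) = 1" if "1 + q ^ i = 0"
    using that by (metis add_eq_0_iff norm_minus_cancel norm_one)
  ultimately show ?thesis by auto
qed

lemma convergent_one_plus_power:
  fixes q :: complex
  assumes q: "norm q < 1" and c: "c = 1 \<or> c = -1"
  obtains E where "(\<lambda>N. \<Prod>i = 1..N. 1 + c * q ^ i) \<longlonglongrightarrow> E" "E \<noteq> 0"
proof -
  have nz: "1 + c * q ^ Suc i \<noteq> 0" for i
    using c one_plus_power_nonzero[OF q, of "Suc i"] one_minus_power_nonzero[OF q, of "Suc i"] by auto
  have cp: "convergent_prod (\<lambda>i. 1 + c * q ^ Suc i)"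
  proof (rule summable_imp_convergent_prod_complex)
    have "summable (\<lambda>i. norm q * norm q ^ i)" by (intro summable_mult summable_geometric) (use q in auto)
    then show "summable (\<lambda>i. norm (c * q ^ Suc i))" using c by (auto simp: norm_mult norm_power)
    show "c * q ^ Suc i \<noteq> - 1" for i using nz[of i] by (metis add.right_inverse)
  qed
  have "(\<Prod>i\<le>n. 1 + c * q ^ Suc i) = (\<Prod>i = 1..Suc n. 1 + c * q ^ i)" for n
    by (rule prod.reindex_bij_witness[of _ "\<lambda>i. i - 1" Suc]) auto
  with convergent_prod_LIMSEQ[OF cp]
  have "(\<lambda>n. \<Prod>i = 1..Suc n. 1 + c * q ^ i) \<longlonglongrightarrow> prodinf (\<lambda>i. 1 + c * q ^ Suc i)" by simp
  then have "(\<lambda>n. \<Prod>i = 1..n. 1 + c * q ^ i) \<longlonglongrightarrow> prodinf (\<lambda>i. 1 + c * q ^ Suc i)"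
    by (rule LIMSEQ_imp_Suc)
  moreover have "prodinf (\<lambda>i. 1 + c * q ^ Suc i) \<noteq> 0"
    by (rule prodinf_nonzero[OF cp nz])
  ultimately show ?thesis using that by blast
qed

definition qprod_lim :: "complex \<Rightarrow> complex" where
  "qprod_lim q = lim (qprod q)"

definition overpartition_gf :: "complex \<Rightarrow> complex" where
  "overpartition_gf q = lim (\<lambda>N. \<Prod>i = 1..N. (1 + q ^ i) / (1 - q ^ i))"

lemma qprod_tendsto:
  assumes q: "norm q < 1"
  shows "qprod q \<longlonglongrightarrow> qprod_lim q" "qprod_lim q \<noteq> 0"
proof -
  obtain E where E: "(\<lambda>N. \<Prod>i = 1..N. 1 + (-1) * q ^ i) \<longlonglongrightarrow> E" "E \<noteq> 0"
    using convergent_one_plus_power[OF q, of "-1"] by blast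
  then have "qprod q \<longlonglongrightarrow> E" by (simp add: qprod_def[abs_def])
  then show "qprod q \<longlonglongrightarrow> qprod_lim q" "qprod_lim q \<noteq> 0"
    using E(2) by (simp_all add: qprod_lim_def limI)
qed

lemma overpartition_gf_tendsto:
  assumes q: "norm q < 1"
  shows "(\<lambda>N. \<Prod>i = 1..N. (1 + q ^ i) / (1 - q ^ i)) \<longlonglongrightarrow> overpartition_gf q"
proof -
  obtain F where F: "(\<lambda>N. \<Prod>i = 1..N. 1 + 1 * q ^ i) \<longlonglongrightarrow> F"
    using convergent_one_plus_power[OF q, of 1] by blast
  have "(\<lambda>N. (\<Prod>i = 1..N. 1 + q ^ i) / qprod q N) \<longlonglongrightarrow> F / qprod_lim q"
    using F by (intro tendsto_divide qprod_tendsto q) simp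
  then have "(\<lambda>N. \<Prod>i = 1..N. (1 + q ^ i) / (1 - q ^ i)) \<longlonglongrightarrow> F / qprod_lim q"
    by (simp add: qprod_def prod_dividef)
  then show ?thesis by (simp add: overpartition_gf_def limI)
qed

lemma qinv_tendsto:
  assumes q: "norm q < 1"
  shows "(\<lambda>N. qinv q (int N + k)) \<longlonglongrightarrow> 1 / qprod_lim q"
proof -
  have "filterlim (\<lambda>N. nat (int N + k)) at_top sequentially"
    unfolding filterlim_at_top
  proof
    fix Z :: nat
    show "\<forall>\<^sub>F N in sequentially. Z \<le> nat (int N + k)"
      by (rule eventually_sequentiallyI[of "Z + nat (- k)"]) linarith
  qed
  from filterlim_compose[OF qprod_tendsto(1)[OF q] this]
  have "(\<lambda>N. 1 / qprod q (nat (int N + k))) \<longlonglongrightarrow> 1 / qprod_lim q"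
    by (intro tendsto_divide tendsto_const qprod_tendsto q)
  moreover have "\<forall>\<^sub>F N in sequentially. 1 / qprod q (nat (int N + k)) = qinv q (int N + k)"
    by (rule eventually_sequentiallyI[of "nat (- k)"]) (auto simp: qinv_def)
  ultimately show ?thesis by (rule Lim_transform_eventually)
qed

lemma qbinom_tendsto:
  assumes q: "norm q < 1"
  shows "(\<lambda>N. qbinom q N k) \<longlonglongrightarrow> 1 / qprod_lim q"
proof -
  have "(\<lambda>N. qprod q (2 * N)) \<longlonglongrightarrow> qprod_lim q"
    using filterlim_compose[OF qprod_tendsto(1)[OF q] mult_nat_left_at_top[of 2]] by simp
  then have "(\<lambda>N. qprod q (2 * N) * qinv q (int N + (- k)) * qinv q (int N + k)) \<longlonglongrightarrow>
     qprod_lim q * (1 / qprod_lim q) * (1 / qprod_lim q)"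
    by (intro tendsto_mult qinv_tendsto q)
  then show ?thesis using qprod_tendsto(2)[OF q] by (simp add: qbinom_def)
qed

text \<open>With Q = q^3, the q-binomial contributes 1/(Q;Q)_inf in the limit and the multiples of 3
  contribute (-Q;Q)_inf; together they form P(Q), for every k alike.\<close>

theorem num_excess_gf:
  assumes q: "q \<noteq> 0" "norm q < 1"
  shows "(\<lambda>n. of_nat (num_excess k n) * q ^ n) sums (q powi pent k * overpartition_gf (q ^ 3))"
proof (rule num_excess_sums[OF q(2)])
  let ?Q = "q ^ 3"
  have Q: "norm ?Q < 1" using q by (auto simp: norm_power power_less_one_iff)
  have "(\<lambda>N. (\<Prod>i = 1..N. (1 + ?Q ^ i) / (1 - ?Q ^ i)) * qprod ?Q N) \<longlonglongrightarrow> overpartition_gf ?Q * qprod_lim ?Q"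
    by (intro tendsto_mult overpartition_gf_tendsto qprod_tendsto Q)
  moreover have "(\<Prod>i = 1..N. (1 + ?Q ^ i) / (1 - ?Q ^ i)) * qprod ?Q N = (\<Prod>i = 1..N. 1 + ?Q ^ i)" for N
    using qprod_nonzero[OF Q, of N] by (simp add: qprod_def prod_dividef)
  ultimately have "(\<lambda>N. \<Prod>i = 1..N. 1 + ?Q ^ i) \<longlonglongrightarrow> overpartition_gf ?Q * qprod_lim ?Q" by simp
  then have "(\<lambda>N. q powi pent k * qbinom ?Q N k * (\<Prod>i = 1..N. 1 + ?Q ^ i)) \<longlonglongrightarrow>
      q powi pent k * (1 / qprod_lim ?Q) * (overpartition_gf ?Q * qprod_lim ?Q)"
    by (intro tendsto_mult tendsto_const qbinom_tendsto Q)
  then show "(\<lambda>N. excess_gf {1..3 * N} k q) \<longlonglongrightarrow> q powi pent k * overpartition_gf ?Q"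
    unfolding finite_excess_gf[OF q] using qprod_tendsto(2)[OF Q] by simp
qed

section \<open>Reduction of excess k to excess 0\<close>

lemma num_excess_0_right: "num_excess k 0 = (if k = 0 then 1 else 0)"
proof -
  have dp: "distinct_partitions 0 = {{}}"
    by (auto simp: distinct_partitions_def)
  have "{P \<in> distinct_partitions 0. excess P = k} = (if k = 0 then {{}} else {})"
    unfolding dp by auto
  then show ?thesis by (simp add: num_excess_def)
qed

lemma num_excess_0_eq_0:
  assumes "\<not> 3 dvd n"
  shows "num_excess 0 n = 0"
proof -
  have "{P \<in> distinct_partitions n. excess P = 0} = {}"
  proof safe
    fix P assume "P \<in> distinct_partitions n" "excess P = 0"
    then have "[int n = 0] (mod 3)" using cong_sum_excess[of P] by (auto simp: distinct_partitions_def)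
    then have "3 dvd int n" by (simp add: cong_0_iff)
    with assms show "P \<in> {}" by presburger
  qed
  then show ?thesis unfolding num_excess_def by (simp only: card.empty)
qed

text \<open>The series for \<open>k\<close> is q^(pent k) times the series for 0, and the
  coefficients of a convergent power series are determined by its values.\<close>

theorem num_excess_shift:
  "num_excess k n = (if pent k \<le> int n then num_excess 0 (n - nat (pent k)) else 0)"
proof (cases "k = 0")
  case False
  define e where "e = nat (pent k)"
  have e: "pent k = int e" using pent_nonneg by (simp add: e_def)
  have e0: "e \<noteq> 0"
  proof
    assume "e = 0"
    then have "k * (3 * k - 1) = 0" using two_pent[of k] e by simp
    with False show False by auto
  qed
  define f g where "f = Abs_fps (\<lambda>n. complex_of_nat (num_excess k n))"
    and "g = fps_X ^ e * Abs_fps (\<lambda>n. complex_of_nat (num_excess 0 n))"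
  have s: "(\<lambda>n. fps_nth f n * q ^ n) sums (q ^ e * overpartition_gf (q ^ 3))"
          "(\<lambda>n. fps_nth g n * q ^ n) sums (q ^ e * overpartition_gf (q ^ 3))" if q: "q \<noteq> 0" "norm q < 1" for q
  proof -
    show "(\<lambda>n. fps_nth f n * q ^ n) sums (q ^ e * overpartition_gf (q ^ 3))"
      using num_excess_gf[OF q, of k] by (simp add: f_def e)
    have "(\<lambda>n. q ^ e * (of_nat (num_excess 0 n) * q ^ n)) sums (q ^ e * overpartition_gf (q ^ 3))"
      using sums_mult[OF num_excess_gf[OF q, of 0], of "q ^ e"] by (simp add: pent_def)
    moreover have "fps_nth g (n + e) * q ^ (n + e) = q ^ e * (of_nat (num_excess 0 n) * q ^ n)" for n
      by (simp add: g_def fps_X_power_mult_nth power_add)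
    ultimately have "(\<lambda>n. fps_nth g (n + e) * q ^ (n + e)) sums (q ^ e * overpartition_gf (q ^ 3))" by simp
    moreover have "(\<Sum>i<e. fps_nth g i * q ^ i) = 0"
      by (intro sum.neutral) (auto simp: g_def fps_X_power_mult_nth)
    ultimately show "(\<lambda>n. fps_nth g n * q ^ n) sums (q ^ e * overpartition_gf (q ^ 3))"
      using sums_iff_shift[of "\<lambda>n. fps_nth g n * q ^ n" e "q ^ e * overpartition_gf (q ^ 3)"] by simp
  qed
  have ev: "eval_fps f q = eval_fps g q" if "norm q < 1" for q
  proof (cases "q = 0")
    \<comment> \<open>The generating function formula is available for nonzero q only. At 0 both
      constant coefficients vanish: the empty partition has excess 0, and \<open>g\<close> carries
      the factor X^e with e > 0.\<close>
    case True
    then show ?thesis using e0 False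
      by (simp add: eval_fps_at_0 f_def g_def num_excess_0_right)
  next
    case q: False
    show ?thesis using s[OF q that] by (simp add: eval_fps_def sums_iff)
  qed
  have r: "fps_conv_radius h > 0" if "\<And>q. q \<noteq> 0 \<Longrightarrow> norm q < 1 \<Longrightarrow> summable (\<lambda>n. fps_nth h n * q ^ n)" for h :: "complex fps"
  proof -
    have "summable (\<lambda>n. fps_nth h n * (1/2) ^ n)" by (rule that) (simp_all add: norm_divide)
    then have "conv_radius (fps_nth h) \<ge> norm (1/2::complex)" by (rule conv_radius_geI)
    then show ?thesis by (auto simp: fps_conv_radius_def norm_divide intro: less_le_trans[of _ "ereal (1/2)"])
  qed
  have "f = g"
  proof (rule eval_fps_eqD)
    show "fps_conv_radius f > 0" "fps_conv_radius g > 0"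
      using s by (auto intro!: r simp: sums_iff)
    have "\<forall>\<^sub>F z in nhds 0. z \<in> ball (0::complex) 1" by (intro eventually_nhds_in_open) auto
    then show "\<forall>\<^sub>F z in nhds 0. eval_fps f z = eval_fps g z"
      by eventually_elim (auto intro: ev)
  qed
  then have "fps_nth f n = fps_nth g n" by simp
  then show ?thesis by (auto simp: f_def g_def fps_X_power_mult_nth e split: if_splits)
qed (simp add: pent_def)

text \<open>The overpartition numbers, realised as counts of distinct partitions of excess 0;
  \<open>overpartitions_sums\<close> identifies their generating function with P.\<close>

definition overpartitions :: "nat \<Rightarrow> nat" where
  "overpartitions m = num_excess 0 (3 * m)"

theorem overpartitions_sums:
  assumes q: "q \<noteq> 0" "norm q < 1"
  shows "(\<lambda>m. of_nat (overpartitions m) * q ^ m) sums overpartition_gf q"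
proof -
  \<comment> \<open>A cube root of q: the series for excess 0 in the variable w has only exponents
    divisible by 3.\<close>
  define w where "w = exp (Ln q / 3)"
  have w3: "w ^ 3 = q" using q by (simp add: w_def flip: exp_of_nat_mult)
  have w: "w \<noteq> 0" "norm w < 1"
  proof -
    show "w \<noteq> 0" by (simp add: w_def)
    have "norm w ^ 3 < 1" using q by (simp add: w3 flip: norm_power)
    then show "norm w < 1" by (simp add: power_less_one_iff)
  qed
  have "(\<lambda>m. of_nat (num_excess 0 (3 * m)) * w ^ (3 * m)) sums (w powi pent 0 * overpartition_gf (w ^ 3))"
  proof (subst sums_mono_reindex[of "\<lambda>m. 3 * m" "\<lambda>n. of_nat (num_excess 0 n) * w ^ n"])
    fix n assume "n \<notin> range (\<lambda>m::nat. 3 * m)"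
    then have "\<not> 3 dvd n" by (auto elim: dvdE)
    then show "of_nat (num_excess 0 n) * w ^ n = 0" by (simp add: num_excess_0_eq_0)
  qed (auto simp: strict_mono_def intro: num_excess_gf[OF w])
  then show ?thesis by (simp add: overpartitions_def pent_def power_mult w3)
qed

section \<open>Gauss' identity and the minor-arc bound\<close>

lemma qbinom_eq_0: "k > int N \<or> k < - int N \<Longrightarrow> qbinom q N k = 0"
  by (auto simp: qbinom_def qinv_def)

lemma qbinom_minus: "qbinom q N (- k) = qbinom q N k"
  by (simp add: qbinom_def)

lemma sum_symmetric_int:
  fixes f :: "int \<Rightarrow> 'a::comm_ring_1"
  assumes "\<And>k. f (- k) = f k"
  shows "(\<Sum>k = - int N..int N. f k) = f 0 + 2 * (\<Sum>n<N. f (int (Suc n)))"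
proof (induction N)
  case (Suc N)
  have "{- int (Suc N)..int (Suc N)} = insert (int (Suc N)) (insert (- int (Suc N)) {- int N..int N})"
    by auto
  then have "(\<Sum>k = - int (Suc N)..int (Suc N). f k) = f (int (Suc N)) + (f (- int (Suc N)) + (\<Sum>k = - int N..int N. f k))"
    by simp
  then show ?case unfolding Suc.IH assms by simp
qed simp

definition theta_coeff :: "complex \<Rightarrow> int \<Rightarrow> complex" where
  "theta_coeff q k = (-1) powi k * q powi (k * k)"

lemma theta_coeff_minus: "theta_coeff q (- k) = theta_coeff q k"
  by (simp add: theta_coeff_def power_int_minus_one_minus)

text \<open>The finite triple product at z = -1. Both neighbours k - 1 and k + 1 enter with the same
  factor x = -q^(2N+1), so each step multiplies the sum by 1 + 2x + x^2 = (1 + x)^2.\<close>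

lemma finite_theta4_product:
  assumes q: "q \<noteq> 0" "norm q < 1"
  shows "(\<Sum>k = - int N..int N. theta_coeff q k * qbinom (q\<^sup>2) N k) = (\<Prod>i<N. 1 - q ^ (2 * i + 1))\<^sup>2"
proof (induction N)
  case 0
  then show ?case by (simp add: theta_coeff_def qbinom_def qinv_def qprod_def)
next
  case (Suc N)
  let ?Q = "q\<^sup>2" and ?x = "- (q ^ (2 * N + 1))"
  let ?h = "\<lambda>k. theta_coeff q k * qbinom ?Q N k"
  let ?I = "{- int (Suc N)..int (Suc N)}"
  have Q: "?Q \<noteq> 0" "norm ?Q < 1" using q by (auto simp: norm_power power_less_one_iff)
  have Qpow: "?Q powi j = q powi (2 * j)" for j by (subst power_int_mult) simp
  have xq: "?x = - (q powi (2 * int N + 1))"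
  proof -
    have "2 * int N + 1 = int (2 * N + 1)" by simp
    then show ?thesis by (simp only: power_int_of_nat)
  qed
  have c1: "theta_coeff q k * ?Q powi (int N + 1 - k) = ?x * theta_coeff q (k - 1)" for k
  proof -
    have m1: "(-1) powi k = - ((-1::complex) powi (k - 1))" by (simp add: power_int_diff)
    moreover have "q powi (k * k) * ?Q powi (int N + 1 - k) = q powi (k * k + 2 * (int N + 1 - k))"
      using q by (simp add: Qpow power_int_add)
    moreover have "q powi (2 * int N + 1) * q powi ((k - 1) * (k - 1)) = q powi ((2 * int N + 1) + (k - 1) * (k - 1))"
      using q by (subst power_int_add) auto
    moreover have "k * k + 2 * (int N + 1 - k) = (2 * int N + 1) + (k - 1) * (k - 1)" by (simp add: algebra_simps)
    ultimately have key: "q powi (k * k) * ?Q powi (int N + 1 - k) = q powi (2 * int N + 1) * q powi ((k - 1) * (k - 1))"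
      by (simp only:)
    show ?thesis unfolding theta_coeff_def xq m1 mult.assoc key by simp
  qed
  have c2: "theta_coeff q k * ?Q powi (int N + 1 + k) = ?x * theta_coeff q (k + 1)" for k
    using c1[of "- k"] theta_coeff_minus[of q "k + 1"] by (simp add: theta_coeff_minus)
  have c3: "?Q ^ (2 * N + 1) = ?x\<^sup>2" by (simp only: power2_minus power_mult[symmetric] mult.commute)
  have step: "theta_coeff q k * qbinom ?Q (Suc N) k = (1 + ?x\<^sup>2) * ?h k + ?x * ?h (k - 1) + ?x * ?h (k + 1)" for k
    unfolding qbinom_Suc[OF Q] c3 distrib_left
    using c1[of k] c2[of k] by (simp add: mult.assoc[symmetric])
  \<comment> \<open>Outside [-N, N] the q-binomials vanish, so the shifted sums over the larger
    interval all equal the unshifted one.\<close>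
  have h0: "?h k = 0" if "k \<notin> {- int N..int N}" for k
    using that by (auto simp: qbinom_eq_0)
  have s0: "(\<Sum>k\<in>?I. ?h k) = (\<Sum>k = - int N..int N. ?h k)"
    by (intro sum.mono_neutral_right ballI h0) auto
  have s1: "(\<Sum>k\<in>?I. ?h (k - 1)) = (\<Sum>k = - int N..int N. ?h k)"
  proof -
    have "(\<Sum>k\<in>?I. ?h (k - 1)) = (\<Sum>k = - int N - 2..int N. ?h k)"
      by (rule sum.reindex_bij_witness[of _ "\<lambda>k. k + 1" "\<lambda>k. k - 1"]) auto
    also have "\<dots> = (\<Sum>k = - int N..int N. ?h k)"
      by (intro sum.mono_neutral_right ballI h0) auto
    finally show ?thesis .
  qed
  have s2: "(\<Sum>k\<in>?I. ?h (k + 1)) = (\<Sum>k = - int N..int N. ?h k)"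
  proof -
    have "(\<Sum>k\<in>?I. ?h (k + 1)) = (\<Sum>k = - int N..int N + 2. ?h k)"
      by (rule sum.reindex_bij_witness[of _ "\<lambda>k. k - 1" "\<lambda>k. k + 1"]) auto
    also have "\<dots> = (\<Sum>k = - int N..int N. ?h k)"
      by (intro sum.mono_neutral_right ballI h0) auto
    finally show ?thesis .
  qed
  have "(\<Sum>k\<in>?I. theta_coeff q k * qbinom ?Q (Suc N) k) = (1 + ?x\<^sup>2 + ?x + ?x) * (\<Sum>k = - int N..int N. ?h k)"
    unfolding step sum.distrib sum_distrib_left[symmetric] s0 s1 s2 by (simp add: algebra_simps)
  also have "1 + ?x\<^sup>2 + ?x + ?x = (1 + ?x)\<^sup>2" by (simp add: power2_eq_square algebra_simps)
  finally show ?case unfolding Suc.IH by (simp add: power_mult_distrib mult.commute)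
qed

lemma qbinom_bounded:
  assumes q: "norm q < 1"
  obtains K where "\<And>N k. norm (qbinom q N k) \<le> K"
proof -
  have "(\<lambda>n. 1 / qprod q n) \<longlonglongrightarrow> 1 / qprod_lim q"
    by (intro tendsto_divide tendsto_const qprod_tendsto q)
  then have "Bseq (qprod q)" "Bseq (\<lambda>n. 1 / qprod q n)"
    using qprod_tendsto(1)[OF q] by (auto intro: convergent_imp_Bseq convergentI)
  then obtain K1 K2 where K: "K1 > 0" "\<And>n. norm (qprod q n) \<le> K1" "K2 > 0" "\<And>n. norm (1 / qprod q n) \<le> K2"
    unfolding Bseq_def by blast
  have i: "norm (qinv q k) \<le> K2" for k using K by (auto simp: qinv_def)
  have "norm (qbinom q N k) \<le> K1 * K2 * K2" for N k
    unfolding qbinom_def norm_mult by (intro mult_mono K i) (use K in auto)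
  then show ?thesis using that by blast
qed

text \<open>The limit of the finite identity by Tannery's theorem, the q-binomials being bounded
  uniformly in N and k; the product over odd exponents is (q;q)_inf / (q^2;q^2)_inf.\<close>

lemma theta4_eq_qprod_lim:
  assumes q: "q \<noteq> 0" "norm q < 1"
  shows "theta4 q = (qprod_lim q)\<^sup>2 / qprod_lim (q\<^sup>2)"
proof -
  let ?Q = "q\<^sup>2"
  have Q: "norm ?Q < 1" using q by (auto simp: norm_power power_less_one_iff)
  let ?E = "qprod_lim ?Q"
  have E: "?E \<noteq> 0" by (rule qprod_tendsto[OF Q])
  let ?c = "\<lambda>n. (-1) ^ Suc n * q ^ ((Suc n)\<^sup>2)"
  have coeff: "theta_coeff q (int (Suc n)) = ?c n" for n
    unfolding theta_coeff_def of_nat_mult[symmetric] power_int_of_nat power2_eq_square ..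
  have sym: "theta_coeff q (- k) * qbinom ?Q N (- k) = theta_coeff q k * qbinom ?Q N k" for N k
    by (simp add: qbinom_minus theta_coeff_minus)
  obtain K where K: "\<And>N k. norm (qbinom ?Q N k) \<le> K" using qbinom_bounded[OF Q] by blast
  have "(\<lambda>N. suminf (\<lambda>n. ?c n * qbinom ?Q N (int (Suc n)))) \<longlonglongrightarrow> suminf (\<lambda>n. ?c n * (1 / ?E))"
  proof (rule conjunct2[OF conjunct2[OF tannerys_theorem[where M="\<lambda>n. norm q ^ n * K"]]])
    show "(\<lambda>N. ?c n * qbinom ?Q N (int (Suc n))) \<longlonglongrightarrow> ?c n * (1 / ?E)" for n
      by (intro tendsto_mult tendsto_const qbinom_tendsto Q)
    have "norm (?c n * qbinom ?Q N (int (Suc n))) \<le> norm q ^ n * K" for n N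
      unfolding norm_mult[of "?c n"]
      by (intro mult_mono K norm_lacunary_le) (use q in \<open>auto simp: Suc_le_power2 norm_power\<close>)
    then show "\<forall>\<^sub>F (n, N) in sequentially \<times>\<^sub>F sequentially. norm (?c n * qbinom ?Q N (int (Suc n))) \<le> norm q ^ n * K"
      by (intro always_eventually) auto
    show "summable (\<lambda>n. norm q ^ n * K)" by (intro summable_mult2 summable_geometric) (use q in auto)
  qed auto
  moreover have "suminf (\<lambda>n. ?c n * (1 / ?E)) = suminf ?c * (1 / ?E)"
    by (rule suminf_mult2[symmetric], rule summable_lacunary) (use q in \<open>auto simp: Suc_le_power2 norm_power norm_mult\<close>)
  moreover have "suminf (\<lambda>n. ?c n * qbinom ?Q N (int (Suc n))) = (\<Sum>n<N. ?c n * qbinom ?Q N (int (Suc n)))" for N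
    by (rule suminf_finite) (auto simp: qbinom_eq_0)
  ultimately have "(\<lambda>N. \<Sum>n<N. ?c n * qbinom ?Q N (int (Suc n))) \<longlonglongrightarrow> suminf ?c * (1 / ?E)" by simp
  then have "(\<lambda>N. qbinom ?Q N 0 + 2 * (\<Sum>n<N. ?c n * qbinom ?Q N (int (Suc n)))) \<longlonglongrightarrow> 1 / ?E + 2 * (suminf ?c * (1 / ?E))"
    by (intro tendsto_add tendsto_mult tendsto_const qbinom_tendsto Q)
  also have "(\<lambda>N. qbinom ?Q N 0 + 2 * (\<Sum>n<N. ?c n * qbinom ?Q N (int (Suc n)))) = (\<lambda>N. (\<Prod>i<N. 1 - q ^ (2 * i + 1))\<^sup>2)"
    unfolding finite_theta4_product[OF q, symmetric]
    by (subst sum_symmetric_int[of "\<lambda>k. theta_coeff q k * qbinom (q\<^sup>2) N k" for N, OF sym]) (simp only: coeff, simp add: theta_coeff_def)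
  also have "1 / ?E + 2 * (suminf ?c * (1 / ?E)) = theta4 q / ?E" by (simp add: theta4_def add_divide_distrib)
  finally have L1: "(\<lambda>N. (\<Prod>i<N. 1 - q ^ (2 * i + 1))\<^sup>2) \<longlonglongrightarrow> theta4 q / ?E" .
  have "qprod q (2 * N) = (\<Prod>i<N. 1 - q ^ (2 * i + 1)) * qprod ?Q N" for N
  proof (induction N)
    case (Suc N)
    have "qprod q (2 * Suc N) = qprod q (2 * N) * (1 - q ^ (2 * N + 1)) * (1 - q ^ (2 * N + 2))"
      by (simp add: qprod_def)
    moreover have "qprod ?Q (Suc N) = qprod ?Q N * (1 - ?Q ^ Suc N)" by (simp add: qprod_def)
    moreover have "?Q ^ Suc N = q ^ (2 * N + 2)" by (simp only: power_mult[symmetric]) simp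
    ultimately show ?case using Suc.IH by (simp only: prod.lessThan_Suc mult_ac)
  qed (simp add: qprod_def)
  then have "(\<Prod>i<N. 1 - q ^ (2 * i + 1)) = qprod q (2 * N) / qprod ?Q N" for N
    using qprod_nonzero[OF Q, of N] by simp
  moreover have "(\<lambda>N. (qprod q (2 * N) / qprod ?Q N)\<^sup>2) \<longlonglongrightarrow> (qprod_lim q / ?E)\<^sup>2"
    using filterlim_compose[OF qprod_tendsto(1)[OF q(2)] mult_nat_left_at_top[of 2]]
    by (intro tendsto_power tendsto_divide qprod_tendsto Q) auto
  ultimately have "theta4 q / ?E = (qprod_lim q / ?E)\<^sup>2" using L1 LIMSEQ_unique by simp
  then show ?thesis using E by (simp add: field_simps power2_eq_square)
qed

text \<open>As (1 + q^i)(1 - q^i) = 1 - q^(2i), P equals (q^2;q^2)_inf / (q;q)_inf^2, the reciprocal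
  of the product for theta4.\<close>

theorem overpartition_gf_theta4:
  assumes q: "q \<noteq> 0" "norm q < 1"
  shows "overpartition_gf q * theta4 q = 1"
proof -
  have Q: "norm (q\<^sup>2) < 1" using q by (auto simp: norm_power power_less_one_iff)
  have "(\<Prod>i = 1..N. (1 + q ^ i) / (1 - q ^ i)) = qprod (q\<^sup>2) N / (qprod q N)\<^sup>2" for N
  proof -
    have "(1 + q ^ i) * (1 - q ^ i) = 1 - (q\<^sup>2) ^ i" for i
      by (simp add: algebra_simps power2_eq_square power_mult_distrib)
    then have "(\<Prod>i = 1..N. 1 + q ^ i) * qprod q N = qprod (q\<^sup>2) N"
      by (simp add: qprod_def prod.distrib[symmetric])
    then show ?thesis using qprod_nonzero[OF q(2), of N]
      by (simp add: prod_dividef qprod_def field_simps power2_eq_square)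
  qed
  moreover have "(\<lambda>N. qprod (q\<^sup>2) N / (qprod q N)\<^sup>2) \<longlonglongrightarrow> qprod_lim (q\<^sup>2) / (qprod_lim q)\<^sup>2"
    using qprod_tendsto(2)[OF q(2)] by (intro tendsto_divide tendsto_power qprod_tendsto Q q(2)) auto
  ultimately have "overpartition_gf q = qprod_lim (q\<^sup>2) / (qprod_lim q)\<^sup>2"
    using overpartition_gf_tendsto[OF q(2)] LIMSEQ_unique by simp
  then show ?thesis
    using theta4_eq_qprod_lim[OF q] qprod_tendsto(2)[OF q(2)] qprod_tendsto(2)[OF Q] by simp
qed

text \<open>The logarithm of the squared left-hand side, minus \<open>2 c\<close>, is increasing in \<open>c = Re w\<close>
  for fixed \<open>|w|\<close>, so its maximum is at \<open>w = |w|\<close>.\<close>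
lemma norm_overpartition_factor_le:
  fixes w :: complex
  assumes w: "norm w < 1"
  shows "norm ((1 + w) / (1 - w)) \<le> (1 + norm w) / (1 - norm w) * exp (- (norm w - Re w))"
proof -
  define r c where "r = norm w" and "c = Re w"
  have r: "0 \<le> r" "r < 1" using w by (auto simp: r_def)
  have c: "- r \<le> c" "c \<le> r" using abs_Re_le_cmod[of w] by (auto simp: r_def c_def)
  have w2: "(Re w)\<^sup>2 + (Im w)\<^sup>2 = r\<^sup>2" by (simp add: r_def cmod_power2)
  define s where "s = 1 + r\<^sup>2"
  have n1: "(norm (1 + w))\<^sup>2 = s + 2 * c" using w2 unfolding cmod_power2 s_def c_def by (simp add: power2_eq_square algebra_simps)
  have n2: "(norm (1 - w))\<^sup>2 = s - 2 * c" using w2 unfolding cmod_power2 s_def c_def by (simp add: power2_eq_square algebra_simps)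
  have r2: "r\<^sup>2 < 1" using r by (simp add: power_less_one_iff)
  have pos: "s + 2 * x > 0" "s - 2 * x > 0" if "- r \<le> x" "x \<le> r" for x
  proof -
    have "(1 - r)\<^sup>2 > 0" using r by auto
    then have "s - 2 * r > 0" by (simp add: s_def power2_eq_square algebra_simps)
    then show "s + 2 * x > 0" "s - 2 * x > 0" using that by linarith+
  qed
  let ?h = "\<lambda>x. ln (s + 2 * x) - ln (s - 2 * x) - 2 * x"
  have "?h c \<le> ?h r"
  proof (rule DERIV_nonneg_imp_nondecreasing[OF c(2)])
    fix x assume "c \<le> x" "x \<le> r"
    then have x: "s + 2 * x > 0" "s - 2 * x > 0" using pos c by auto
    have "(?h has_real_derivative (2 / (s + 2 * x) + 2 / (s - 2 * x) - 2)) (at x)"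
      using x by (auto intro!: derivative_eq_intros simp: divide_inverse)
    moreover have "2 / (s + 2 * x) + 2 / (s - 2 * x) - 2 \<ge> 0"
    proof -
      have "s * s \<le> 2 * s" using r2 by (intro mult_right_mono) (auto simp: s_def)
      moreover have "(s + 2 * x) * (s - 2 * x) \<le> s * s" by (simp add: algebra_simps)
      ultimately have "(s + 2 * x) * (s - 2 * x) \<le> 2 * s" by linarith
      moreover have "2 / (s + 2 * x) + 2 / (s - 2 * x) = 4 * s / ((s + 2 * x) * (s - 2 * x))"
        using x by (subst add_frac_eq) auto
      ultimately show ?thesis using x by (simp add: pos_le_divide_eq mult.commute)
    qed
    ultimately show "\<exists>y. (?h has_real_derivative y) (at x) \<and> 0 \<le> y" by blast
  qed
  then have "ln ((s + 2 * c) / (s - 2 * c)) \<le> ln ((s + 2 * r) / (s - 2 * r)) - 2 * (r - c)"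
    using pos[of c] pos[of r] c r by (simp add: ln_div)
  then have "exp (ln ((s + 2 * c) / (s - 2 * c))) \<le> exp (ln ((s + 2 * r) / (s - 2 * r)) + (- (2 * (r - c))))"
    by simp
  then have le: "(s + 2 * c) / (s - 2 * c) \<le> (s + 2 * r) / (s - 2 * r) * exp (- (2 * (r - c)))"
    using pos[of c] pos[of r] c r unfolding exp_add by simp
  have "(norm ((1 + w) / (1 - w)))\<^sup>2 = (s + 2 * c) / (s - 2 * c)"
    unfolding norm_divide power_divide n1 n2 ..
  also note le
  also have "s + 2 * r = (1 + r)\<^sup>2" by (simp add: s_def power2_sum)
  also have "s - 2 * r = (1 - r)\<^sup>2" by (simp add: s_def power2_diff)
  also have "exp (- (2 * (r - c))) = (exp (- (r - c)))\<^sup>2" by (simp flip: exp_double)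
  finally have "(norm ((1 + w) / (1 - w)))\<^sup>2 \<le> ((1 + r) / (1 - r) * exp (- (r - c)))\<^sup>2"
    unfolding power_mult_distrib power_divide .
  then show ?thesis
    unfolding r_def c_def by (rule power2_le_imp_le) (use w in auto)
qed

text \<open>The factor bound at w = q^i saves exp(-(|q|^i - Re q^i)), and the savings add up to
  geometric series. A single estimate thus covers everything away from q = 1, including the
  neighbourhoods of all other roots of unity.\<close>

theorem norm_overpartition_gf_le:
  assumes q: "norm q < 1"
  shows "norm (overpartition_gf q) \<le> norm (overpartition_gf (of_real (norm q))) *
     exp (- (norm q / (1 - norm q) - Re (q / (1 - q))))"
proof (rule LIMSEQ_le)
  let ?r = "norm q"
  let ?U = "\<lambda>N. norm (\<Prod>i = 1..N. (1 + q ^ i) / (1 - q ^ i))"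
  let ?V = "\<lambda>N. norm (\<Prod>i = 1..N. (1 + of_real ?r ^ i) / (1 - of_real ?r ^ i) :: complex) *
     exp (- ((\<Sum>i = 1..N. ?r ^ i) - Re (\<Sum>i = 1..N. q ^ i)))"
  show "?U \<longlonglongrightarrow> norm (overpartition_gf q)"
    by (intro tendsto_norm overpartition_gf_tendsto q)
  have gs: "(\<lambda>N. \<Sum>i = 1..N. z ^ i) \<longlonglongrightarrow> z / (1 - z)" if "norm z < 1" for z :: "'a::{real_normed_field,banach}"
  proof -
    have "(\<lambda>N. \<Sum>i<N. z ^ i * z) \<longlonglongrightarrow> 1 / (1 - z) * z"
      using sums_mult2[OF geometric_sums[OF that], of z] by (simp add: sums_def)
    moreover have "(\<Sum>i<N. z ^ i * z) = (\<Sum>i = 1..N. z ^ i)" for N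
      unfolding One_nat_def by (subst sum.atLeast1_atMost_eq) (simp add: mult.commute)
    ultimately show ?thesis by simp
  qed
  show "?V \<longlonglongrightarrow> norm (overpartition_gf (of_real ?r)) * exp (- (?r / (1 - ?r) - Re (q / (1 - q))))"
    by (intro tendsto_intros overpartition_gf_tendsto gs) (use q in auto)
  have "?U N \<le> ?V N" for N
  proof -
    have "norm (\<Prod>i = 1..N. (1 + q ^ i) / (1 - q ^ i)) \<le>
      (\<Prod>i = 1..N. (1 + ?r ^ i) / (1 - ?r ^ i) * exp (- (?r ^ i - Re (q ^ i))))"
      unfolding prod_norm[symmetric]
    proof (rule prod_mono, intro conjI norm_ge_zero)
      fix i assume "i \<in> {1..N}"
      then have "norm (q ^ i) < 1" using q by (auto simp: norm_power power_less_one_iff)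
      from norm_overpartition_factor_le[OF this]
      show "norm ((1 + q ^ i) / (1 - q ^ i)) \<le> (1 + ?r ^ i) / (1 - ?r ^ i) * exp (- (?r ^ i - Re (q ^ i)))"
        by (simp add: norm_power)
    qed
    also have "\<dots> = (\<Prod>i = 1..N. (1 + ?r ^ i) / (1 - ?r ^ i)) * exp (- ((\<Sum>i = 1..N. ?r ^ i) - Re (\<Sum>i = 1..N. q ^ i)))"
      unfolding prod.distrib by (simp add: exp_sum[symmetric] sum_subtractf)
    also have "(\<Prod>i = 1..N. (1 + ?r ^ i) / (1 - ?r ^ i)) = norm (\<Prod>i = 1..N. (1 + of_real ?r ^ i) / (1 - of_real ?r ^ i) :: complex)"
    proof -
      have "(\<Prod>i = 1..N. (1 + of_real ?r ^ i) / (1 - of_real ?r ^ i) :: complex) = of_real (\<Prod>i = 1..N. (1 + ?r ^ i) / (1 - ?r ^ i))"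
        by simp
      moreover have "(\<Prod>i = 1..N. (1 + ?r ^ i) / (1 - ?r ^ i)) \<ge> 0"
        by (intro prod_nonneg) (use q in \<open>auto simp: power_le_one\<close>)
      ultimately show ?thesis by (simp only: norm_of_real abs_of_nonneg)
    qed
    finally show ?thesis .
  qed
  then show "\<exists>N0. \<forall>N\<ge>N0. ?U N \<le> ?V N" by blast
qed

section \<open>The circle method for overpartitions\<close>

lemma integral_exp_int_circle:
  "((\<lambda>\<theta>. exp (of_int k * Complex t \<theta>)) has_integral (if k = 0 then 2 * of_real pi else 0)) {- pi..pi}"
proof (cases "k = 0")
  case True
  then show ?thesis using has_integral_const_real[of "1::complex" "- pi" pi] by (simp add: scaleR_conv_of_real)
next
  case False
  have C: "Complex t \<theta> = of_real t + \<i> * of_real \<theta>" for \<theta> by (simp add: complex_eq_iff)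
  let ?F = "\<lambda>\<theta>. exp (of_int k * (of_real t + \<i> * of_real \<theta>)) / (\<i> * of_int k)"
  have "((\<lambda>\<theta>. exp (of_int k * (of_real t + \<i> * of_real \<theta>))) has_integral (?F pi - ?F (- pi))) {- pi..pi}"
  proof (rule fundamental_theorem_of_calculus)
    fix x :: real
    have "((\<lambda>z. exp (of_int k * (of_real t + \<i> * z)) / (\<i> * of_int k)) has_field_derivative
        exp (of_int k * (of_real t + \<i> * of_real x))) (at (of_real x))"
      using False by (auto intro!: derivative_eq_intros simp: field_simps)
    then show "(?F has_vector_derivative exp (of_int k * (of_real t + \<i> * of_real x))) (at x within {- pi..pi})"
      by (rule has_vector_derivative_at_within[OF has_vector_derivative_real_field])
  qed auto
  moreover have "exp (of_int k * (of_real t + \<i> * of_real pi)) = exp (of_int k * (of_real t + \<i> * of_real (- pi)))"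
    unfolding exp_eq by (intro exI[of _ k]) (simp add: algebra_simps)
  ultimately show ?thesis using False by (simp add: C)
qed

text \<open>Cauchy's formula on the circle |q| = exp(-t). The coefficients being real, the real part
  of the integrand suffices, and passing to it later removes the odd part of the error at the saddle
  point.\<close>

lemma overpartition_gf_integral:
  assumes t: "t > 0"
  shows "((\<lambda>\<theta>. Re (overpartition_gf (exp (- Complex t \<theta>)) * exp (of_nat m * Complex t \<theta>)))
    has_integral (2 * pi * real (overpartitions m))) {- pi..pi}"
    and "continuous_on {- pi..pi} (\<lambda>\<theta>. Re (overpartition_gf (exp (- Complex t \<theta>)) * exp (of_nat m * Complex t \<theta>)))"
proof -
  let ?q = "\<lambda>\<theta>. exp (- Complex t \<theta>)"
  let ?f = "\<lambda>n \<theta>. of_nat (overpartitions n) * ?q \<theta> ^ n * exp (of_nat m * Complex t \<theta>)"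
  let ?M = "\<lambda>n. real (overpartitions n) * exp (- t) ^ n * exp (real m * t)"
  let ?G = "\<lambda>\<theta>. overpartition_gf (?q \<theta>) * exp (of_nat m * Complex t \<theta>)"
  have C: "Complex t \<theta> = of_real t + \<i> * of_real \<theta>" for \<theta> by (simp add: complex_eq_iff)
  have "summable (\<lambda>n. of_nat (overpartitions n) * (complex_of_real (exp (- t))) ^ n)"
    by (rule sums_summable[OF overpartitions_sums]) (use t in auto)
  also have "(\<lambda>n. of_nat (overpartitions n) * (complex_of_real (exp (- t))) ^ n) =
      (\<lambda>n. complex_of_real (real (overpartitions n) * exp (- t) ^ n))" by simp
  finally have "summable (\<lambda>n. real (overpartitions n) * exp (- t) ^ n)"
    by (simp only: summable_complex_of_real)
  then have Ms: "summable ?M" by (rule summable_mult2)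
  have Mb: "norm (?f n \<theta>) \<le> ?M n" for n \<theta> by (simp add: norm_mult norm_power)
  have fc: "continuous_on {- pi..pi} (?f n)" for n unfolding C by (intro continuous_intros)
  have G: "(\<Sum>n. ?f n \<theta>) = ?G \<theta>" for \<theta>
  proof -
    have "(\<lambda>n. of_nat (overpartitions n) * ?q \<theta> ^ n) sums overpartition_gf (?q \<theta>)"
      by (rule overpartitions_sums) (use t in auto)
    from sums_mult2[OF this, of "exp (of_nat m * Complex t \<theta>)"] show ?thesis by (simp add: sums_iff)
  qed
  have Gc: "continuous_on {- pi..pi} ?G"
    using integral_suminf_uniform(1)[where f="?f", OF fc Mb Ms] by (simp add: G)
  then show "continuous_on {- pi..pi} (\<lambda>\<theta>. Re (?G \<theta>))" by (rule continuous_on_Re)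
  have "(\<lambda>n. integral {- pi..pi} (?f n)) sums integral {- pi..pi} ?G"
    using integral_suminf_uniform(2)[where f="?f", OF fc Mb Ms] by (simp add: G)
  moreover have "integral {- pi..pi} (?f n) = (if n = m then of_nat (overpartitions m) * (2 * of_real pi) else 0)" for n
  proof -
    have e: "?f n = (\<lambda>\<theta>. of_nat (overpartitions n) * exp (of_int (int m - int n) * Complex t \<theta>))"
    proof
      fix \<theta>
      show "?f n \<theta> = of_nat (overpartitions n) * exp (of_int (int m - int n) * Complex t \<theta>)"
      proof -
      have "?q \<theta> ^ n * exp (of_nat m * Complex t \<theta>) = exp (of_nat n * (- Complex t \<theta>) + of_nat m * Complex t \<theta>)"
        by (simp only: exp_add exp_of_nat_mult)
      also have "of_nat n * (- Complex t \<theta>) + of_nat m * Complex t \<theta> = of_int (int m - int n) * Complex t \<theta>"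
        by (simp add: algebra_simps)
      finally show ?thesis by (simp only: mult.assoc)
      qed
    qed
    have "((\<lambda>\<theta>. of_nat (overpartitions n) * exp (of_int (int m - int n) * Complex t \<theta>)) has_integral
        of_nat (overpartitions n) * (if int m - int n = 0 then 2 * of_real pi else 0)) {- pi..pi}"
      by (intro has_integral_mult_right integral_exp_int_circle)
    from integral_unique[OF this] show ?thesis unfolding e by (auto simp: scaleR_conv_of_real mult.commute)
  qed
  ultimately have "(\<lambda>n. if n = m then of_nat (overpartitions m) * (2 * of_real pi) else 0) sums integral {- pi..pi} ?G"
    by simp
  with sums_single[of m "\<lambda>_. of_nat (overpartitions m) * (2 * of_real pi)"]
  have "integral {- pi..pi} ?G = of_nat (overpartitions m) * (2 * of_real pi)"
    using sums_unique2 by fastforce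
  then have "(?G has_integral of_nat (overpartitions m) * (2 * of_real pi)) {- pi..pi}"
    using integrable_integral[OF integrable_continuous_real[OF Gc]] by simp
  from has_integral_linear[OF this bounded_linear_Re]
  show "((\<lambda>\<theta>. Re (?G \<theta>)) has_integral (2 * pi * real (overpartitions m))) {- pi..pi}"
    by (simp add: o_def mult.commute)
qed

section \<open>Estimates at the saddle point\<close>

text \<open>With w = 1 + i u this is sqrt(w) exp(-l u^2/w): the complex integrand at z = t w, up to
  its size at the saddle point and the factor 1/theta2.\<close>

definition saddle :: "real \<Rightarrow> real \<Rightarrow> complex" where
  "saddle l u = exp (Ln (1 + \<i> * u) / 2 - l * u\<^sup>2 / (1 + \<i> * u))"

lemma Re_inverse_1_plus_iu: "Re (1 / (1 + \<i> * of_real u)) = 1 / (1 + u\<^sup>2)"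
  by (simp add: Re_divide power2_eq_square)

lemma Re_divide_1_plus_iu: "Re (of_real c / (1 + \<i> * of_real u)) = c * (1 / (1 + u\<^sup>2))"
proof -
  have "of_real c / (1 + \<i> * of_real u) = of_real c * (1 / (1 + \<i> * of_real u))" by simp
  then show ?thesis using Re_inverse_1_plus_iu[of u] by (simp only: times_complex.sel(1)) simp
qed

lemma norm_1_plus_iu: "norm (1 + \<i> * of_real u) = sqrt (1 + u\<^sup>2)"
  by (simp add: cmod_def)

lemma Re_Ln_1_plus_iu: "Re (Ln (1 + \<i> * of_real u)) = ln (1 + u\<^sup>2) / 2"
proof -
  have "1 + \<i> * of_real u \<noteq> 0" by (simp add: complex_eq_iff)
  moreover have "1 + u\<^sup>2 > 0" by (rule add_pos_nonneg) auto
  ultimately show ?thesis by (simp add: norm_1_plus_iu ln_sqrt)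
qed

lemma norm_saddle_le:
  assumes u: "\<bar>u\<bar> \<le> 1" and l: "l \<ge> 0"
  shows "norm (saddle l u) \<le> 2 * exp (- (l * u\<^sup>2 / 2))"
proof -
  have u2: "u\<^sup>2 \<le> 1" using u by (simp add: abs_square_le_1)
  have "ln (1 + u\<^sup>2) \<le> u\<^sup>2" using ln_add_one_self_le_self[of "u\<^sup>2"] by simp
  then have "ln (1 + u\<^sup>2) / 4 \<le> 1/4" using u2 by linarith
  moreover have "u\<^sup>2 / 2 \<le> u\<^sup>2 / (1 + u\<^sup>2)"
    using u2 by (intro divide_left_mono) (auto intro: add_pos_nonneg)
  then have "l * (u\<^sup>2 / 2) \<le> l * (u\<^sup>2 / (1 + u\<^sup>2))" using l by (rule mult_left_mono)
  moreover have "Re (Ln (1 + \<i> * u) / 2 - l * u\<^sup>2 / (1 + \<i> * u)) = ln (1 + u\<^sup>2) / 4 - l * (u\<^sup>2 / (1 + u\<^sup>2))"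
  proof -
    have "Re (complex_of_real l * (complex_of_real u)\<^sup>2 / (1 + \<i> * u)) = l * u\<^sup>2 * (1 / (1 + u\<^sup>2))"
      using Re_divide_1_plus_iu[of "l * u\<^sup>2" u] by simp
    then show ?thesis using Re_Ln_1_plus_iu[of u] by simp
  qed
  ultimately have "norm (saddle l u) \<le> exp (1/4 + (- (l * u\<^sup>2 / 2)))"
    unfolding saddle_def norm_exp_eq_Re by simp
  also have "\<dots> \<le> 2 * exp (- (l * u\<^sup>2 / 2))"
  proof -
    have "exp (1/4::real) \<le> 1 + 1/4 + (1/4)\<^sup>2" by (rule exp_bound) auto
    then have "exp (1/4::real) \<le> 2" by (simp add: power2_eq_square)
    then show ?thesis unfolding exp_add by (intro mult_right_mono) auto
  qed
  finally show ?thesis .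
qed

text \<open>The rate x/4 lets polynomial factors be absorbed by exp(-x/2) with exp(-x/4) to spare.
  The constants are n! 4^n for n = 1, 2, 3.\<close>

lemma poly_exp_bound:
  fixes x :: real
  assumes "x \<ge> 0"
  shows "x \<le> 4 * exp (x / 4)" "x\<^sup>2 \<le> 32 * exp (x / 4)" "x ^ 3 \<le> 384 * exp (x / 4)"
proof -
  define y where "y = x / 4"
  have y: "y \<ge> 0" "x = 4 * y" using assms by (auto simp: y_def)
  have e: "y ^ n \<le> fact n * exp y" for n
  proof -
    have "y ^ n /\<^sub>R fact n \<le> (\<Sum>k\<le>n. y ^ k /\<^sub>R fact k)"
      using y by (intro member_le_sum) auto
    also have "\<dots> = (\<Sum>k<Suc n. y ^ k /\<^sub>R fact k)" by (simp add: lessThan_Suc_atMost)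
    also have "\<dots> \<le> (\<Sum>k. y ^ k /\<^sub>R fact k)"
      using y by (intro sum_le_suminf summable_exp_generic) auto
    finally show ?thesis by (simp add: exp_def field_simps)
  qed
  show "x \<le> 4 * exp (x / 4)" "x\<^sup>2 \<le> 32 * exp (x / 4)" "x ^ 3 \<le> 384 * exp (x / 4)"
    using e[of 1] e[of 2] e[of 3] unfolding y_def[symmetric] y(2)
    by (auto simp: power_mult_distrib fact_numeral)
qed

text \<open>Write the saddle factor as exp(-x) exp w. The modulus of w is of order |u| (1 + x),
  which alone would give an error of order l^(-1/2). But the part of w that is odd in u is
  imaginary, so Re w is of order (x + x^2)/l, and Re (exp w) - 1 is controlled by Re w and |w|^2,
  both of order 1/l up to polynomials in x.\<close>

lemma Re_saddle_approx:
  assumes u: "\<bar>u\<bar> \<le> 1" and l: "l \<ge> 1"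
  shows "\<bar>Re (saddle l u) - exp (- (l * u\<^sup>2))\<bar> \<le> 7000 / l * exp (- (l * u\<^sup>2 / 4))"
proof -
  \<comment> \<open>The expansion 1/(1 + iu) = 1 - iu - u^2/(1 + iu) separates the exponent -l u^2
    from the remainder \<open>w\<close>.\<close>
  define w where "w = Ln (1 + \<i> * u) / 2 + \<i> * (l * u ^ 3) + (l * u ^ 4) / (1 + \<i> * u)"
  define x where "x = l * u\<^sup>2"
  have x0: "x \<ge> 0" using l by (simp add: x_def)
  have nz: "1 + \<i> * complex_of_real u \<noteq> 0" by (simp add: complex_eq_iff)
  have s: "saddle l u = exp (- of_real x) * exp w"
  proof -
    have "- (l * u\<^sup>2) / (1 + \<i> * complex_of_real u) = - (l * u\<^sup>2) + \<i> * (l * u ^ 3) + (l * u ^ 4) / (1 + \<i> * u)"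
      using nz by (simp add: field_simps power2_eq_square power3_eq_cube power4_eq_xxxx)
    then show ?thesis unfolding saddle_def exp_add[symmetric]
      by (intro arg_cong[of _ _ exp]) (simp add: w_def x_def)
  qed
  have lnb: "0 \<le> ln (1 + u\<^sup>2)" "ln (1 + u\<^sup>2) \<le> u\<^sup>2"
    using ln_add_one_self_le_self[of "u\<^sup>2"] by auto
  have Rew: "Re w = ln (1 + u\<^sup>2) / 4 + l * u ^ 4 * (1 / (1 + u\<^sup>2))"
  proof -
    have "Re (complex_of_real l * (complex_of_real u) ^ 4 / (1 + \<i> * u)) = l * u ^ 4 * (1 / (1 + u\<^sup>2))"
      using Re_divide_1_plus_iu[of "l * u ^ 4" u] by simp
    then show ?thesis using Re_Ln_1_plus_iu[of u] by (simp add: w_def)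
  qed
  have lu4: "l * u ^ 4 = x\<^sup>2 / l" using l by (simp add: x_def power2_eq_square power4_eq_xxxx)
  have ul: "u\<^sup>2 = x / l" using l by (simp add: x_def)
  have Re0: "0 \<le> Re w" unfolding Rew using lnb l by (intro add_nonneg_nonneg mult_nonneg_nonneg) auto
  have frac: "1 / (1 + u\<^sup>2) \<le> 1" by (simp add: add_pos_nonneg)
  have Re1: "Re w \<le> (x + x\<^sup>2) / l"
  proof -
    have "l * u ^ 4 * (1 / (1 + u\<^sup>2)) \<le> l * u ^ 4 * 1" using frac l by (intro mult_left_mono) auto
    then have "Re w \<le> u\<^sup>2 + l * u ^ 4" unfolding Rew using lnb by linarith
    then show ?thesis by (simp add: lu4 ul add_divide_distrib)
  qed
  have nw: "norm w \<le> \<bar>u\<bar> * (1 + 2 * x)"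
  proof -
    have "norm (Ln (1 + \<i> * u)) \<le> 2 * \<bar>u\<bar>"
    proof -
      have "Ln (1 + \<i> * u) = Complex (ln (1 + u\<^sup>2) / 2) (arctan u)"
      proof -
        have "Im (Ln (1 + \<i> * u)) = arctan u"
          by (subst Im_Ln_eq) (auto simp: complex_eq_iff)
        then show ?thesis using Re_Ln_1_plus_iu[of u] by (simp add: complex_eq_iff)
      qed
      then have "norm (Ln (1 + \<i> * u)) \<le> \<bar>ln (1 + u\<^sup>2) / 2\<bar> + \<bar>arctan u\<bar>"
        using cmod_le[of "Ln (1 + \<i> * u)"] by simp
      also have "\<bar>arctan u\<bar> \<le> \<bar>u\<bar>" by (rule abs_arctan_le)
      also have "\<bar>ln (1 + u\<^sup>2) / 2\<bar> \<le> \<bar>u\<bar>"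
      proof -
        have "u\<^sup>2 \<le> \<bar>u\<bar>" using u by (metis abs_ge_zero mult_left_le power2_abs power2_eq_square)
        then show ?thesis using lnb by linarith
      qed
      finally show ?thesis by simp
    qed
    moreover have "norm (\<i> * (l * u ^ 3)) = \<bar>u\<bar> * x" 
      using l by (simp add: norm_mult norm_power x_def power3_eq_cube power2_eq_square abs_mult)
    moreover have "norm ((l * u ^ 4) / (1 + \<i> * u)) \<le> \<bar>u\<bar> * x"
    proof -
      have "sqrt (1 + u\<^sup>2) \<ge> 1" by simp
      then have "norm (complex_of_real (l * u ^ 4) / (1 + \<i> * u)) \<le> norm (complex_of_real (l * u ^ 4)) / 1"
        unfolding norm_divide norm_1_plus_iu by (intro divide_left_mono) (auto intro: add_pos_nonneg)
      also have "\<dots> = \<bar>l * u ^ 4\<bar>" by (simp only: norm_of_real div_by_1)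
      also have "\<dots> = \<bar>u\<bar> * (\<bar>u\<bar> * x)" using l by (simp add: x_def power4_eq_xxxx power2_eq_square abs_mult)
      also have "\<dots> \<le> \<bar>u\<bar> * (1 * x)" using u x0 by (intro mult_left_mono mult_right_mono) auto
      finally show ?thesis by simp
    qed
    ultimately have "norm w \<le> (2 * \<bar>u\<bar>) / 2 + \<bar>u\<bar> * x + \<bar>u\<bar> * x"
      unfolding w_def by (intro norm_triangle_le add_mono) (auto simp: norm_divide)
    then show ?thesis by (simp add: algebra_simps)
  qed
  have nw2: "(norm w)\<^sup>2 \<le> (2 * x + 8 * x ^ 3) / l"
  proof -
    have "(norm w)\<^sup>2 \<le> (\<bar>u\<bar> * (1 + 2 * x))\<^sup>2" using nw by (intro power_mono) auto
    also have "\<dots> = x / l * (1 + 2 * x)\<^sup>2" by (simp add: power_mult_distrib ul)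
    also have "\<dots> \<le> x / l * (2 + 8 * x\<^sup>2)"
    proof (intro mult_left_mono)
      have "0 \<le> (1 - 2 * x)\<^sup>2" by simp
      then show "(1 + 2 * x)\<^sup>2 \<le> 2 + 8 * x\<^sup>2" by (simp add: power2_eq_square algebra_simps)
    qed (use x0 l in auto)
    also have "\<dots> = (2 * x + 8 * x ^ 3) / l" by (simp add: algebra_simps power2_eq_square power3_eq_cube add_divide_distrib)
    finally show ?thesis .
  qed
  have T: "norm (exp w - (1 + w)) \<le> exp (Re w) * (norm w)\<^sup>2"
    using Taylor_exp[of w 1] Re0 by (simp add: power2_eq_square)
  have "norm (exp (- of_real x) * exp w) \<le> 2 * exp (- (x / 2))"
    using norm_saddle_le[OF u, of l] l s by (simp add: x_def)
  then have E: "exp (- x) * exp (Re w) \<le> 2 * exp (- (x / 2))" by (simp add: norm_mult)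
  have "\<bar>Re (saddle l u) - exp (- x)\<bar> = exp (- x) * \<bar>Re (exp w - (1 + w)) + Re w\<bar>"
  proof -
    have "exp (- complex_of_real x) = of_real (exp (- x))" by (metis exp_of_real of_real_minus)
    then have "Re (saddle l u) - exp (- x) = exp (- x) * (Re (exp w - (1 + w)) + Re w)"
      unfolding s by (simp add: algebra_simps)
    then show ?thesis by (simp add: abs_mult)
  qed
  also have "\<dots> \<le> exp (- x) * (exp (Re w) * (norm w)\<^sup>2 + Re w)"
    using abs_Re_le_cmod[of "exp w - (1 + w)"] T Re0 by (intro mult_left_mono) (linarith, simp)
  also have "\<dots> = (exp (- x) * exp (Re w)) * (norm w)\<^sup>2 + exp (- x) * Re w" by (simp add: algebra_simps)
  also have "\<dots> \<le> (2 * exp (- (x / 2))) * ((2 * x + 8 * x ^ 3) / l) + exp (- (x / 2)) * ((x + x\<^sup>2) / l)"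
    by (rule add_mono[OF mult_mono[OF E nw2] mult_mono[OF _ Re1]]) (use Re0 x0 in auto)
  also have "\<dots> = exp (- (x / 2)) * (5 * x + x\<^sup>2 + 16 * x ^ 3) / l"
    by (simp add: algebra_simps add_divide_distrib)
  also have "\<dots> \<le> exp (- (x / 2)) * (7000 * exp (x / 4)) / l"
  proof -
    \<comment> \<open>By \<open>poly_exp_bound\<close> the left side is at most 20 + 32 + 6144 =
      6196 times exp(x/4).\<close>
    have "5 * x + x\<^sup>2 + 16 * x ^ 3 \<le> 7000 * exp (x / 4)"
      using poly_exp_bound[OF x0] exp_gt_zero[of "x/4"] by linarith
    then show ?thesis using l by (intro divide_right_mono mult_left_mono) auto
  qed
  also have "exp (- (x / 2)) * (7000 * exp (x / 4)) = 7000 * exp (- (x / 4))"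
  proof -
    have "- (x / 4) = - (x / 2) + x / 4" by simp
    then show ?thesis by (simp only: exp_add mult_ac)
  qed
  finally show ?thesis by (simp add: x_def)
qed

lemma theta2_bounds:
  assumes q: "norm q \<le> 1/4"
  shows "theta2 q \<noteq> 0" "norm (1 / theta2 q - 1) \<le> 4 * norm q" "norm (1 / theta2 q) \<le> 2"
proof -
  have d: "norm (theta2 q - 1) \<le> 2 * norm q" by (rule norm_theta2_minus_1_le) (use q in auto)
  have "1 \<le> norm (theta2 q) + norm (theta2 q - 1)"
    using norm_triangle_ineq4[of "theta2 q" "theta2 q - 1"] by simp
  then have n: "norm (theta2 q) \<ge> 1/2" using d q by linarith
  then show nz: "theta2 q \<noteq> 0" by auto
  have "1 / theta2 q - 1 = (1 - theta2 q) / theta2 q" using nz by (simp add: field_simps)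
  then have "norm (1 / theta2 q - 1) = norm (theta2 q - 1) / norm (theta2 q)"
    by (simp add: norm_divide norm_minus_commute)
  also have "\<dots> \<le> (2 * norm q) / (1/2)" using d n by (intro frac_le) auto
  finally show "norm (1 / theta2 q - 1) \<le> 4 * norm q" by simp
  show "norm (1 / theta2 q) \<le> 2" using n frac_le[of 1 1 "1/2" "norm (theta2 q)"] by (simp add: norm_divide)
qed

lemma overpartition_gf_transformation:
  assumes z: "Re z > 0"
  shows "overpartition_gf (exp (- z)) =
    1 / (2 * csqrt (of_real pi / z)) * exp (of_real (pi\<^sup>2) / (4 * z)) * (1 / theta2 (exp (- of_real (pi\<^sup>2) / z)))"
proof -
  have "overpartition_gf (exp (- z)) * theta4 (exp (- z)) = 1"
    by (rule overpartition_gf_theta4) (use z in auto)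
  moreover from this have "theta4 (exp (- z)) \<noteq> 0" by auto
  ultimately have "overpartition_gf (exp (- z)) = 1 / theta4 (exp (- z))" by (simp add: field_simps)
  also have "\<dots> = 1 / (2 * csqrt (of_real pi / z) * exp (- of_real (pi\<^sup>2) / (4 * z)) * theta2 (exp (- of_real (pi\<^sup>2) / z)))"
    by (simp only: theta_transformation[OF z])
  also have "exp (- of_real (pi\<^sup>2) / (4 * z)) = inverse (exp (of_real (pi\<^sup>2) / (4 * z)))"
    by (simp add: exp_minus)
  also have "1 / (2 * a * inverse b * c) = 1 / (2 * a) * b * (1 / c)" for a b c :: complex
    by (simp add: field_simps)
  finally show ?thesis .
qed

text \<open>With \<open>t = pi / (2 sqrt m)\<close> and \<open>l = pi sqrt m / 2\<close> the exponent \<open>pi^2 / (4 z) + m z\<close> at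
  \<open>z = t (1 + i u)\<close> equals \<open>2 l - l u^2 / (1 + i u)\<close>.\<close>
locale saddle_point =
  fixes m :: nat and l t A :: real
  assumes m: "m > 0"
  defines "l \<equiv> pi * sqrt m / 2" and "t \<equiv> pi / (2 * sqrt m)"
  defines "A \<equiv> sqrt (t / pi) * exp (2 * l) / 2"
begin

lemma l_ge_1: "l \<ge> 1"
proof -
  have "sqrt m \<ge> 1" using m by simp
  then have "2 * 1 \<le> pi * sqrt m" using pi_ge_two by (intro mult_mono) auto
  then show ?thesis by (simp add: l_def)
qed

lemma t_pos: "t > 0" using m by (simp add: t_def)

lemma A_pos: "A > 0" using t_pos by (simp add: A_def)

lemma pi2_t: "pi\<^sup>2 / t = 4 * l"
  using m by (simp add: t_def l_def power2_eq_square)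

lemma m_t: "real m * t = l"
  using m by (simp add: t_def l_def real_div_sqrt field_simps)

definition integrand :: "real \<Rightarrow> real" where
  "integrand \<theta> = Re (overpartition_gf (exp (- Complex t \<theta>)) * exp (of_nat m * Complex t \<theta>))"

text \<open>On this arc the transformed nome exp(-pi^2/z) has modulus at most exp(-2l), so theta2 is
  nearly 1 and costs only 8/l; with the saddle error 7000/l this makes 7008/l.\<close>

lemma major_arc:
  assumes \<theta>: "\<bar>\<theta>\<bar> \<le> t"
  shows "\<bar>integrand \<theta> - A * exp (- (l * (\<theta> / t)\<^sup>2))\<bar> \<le> A * (7008 / l * exp (- (l * (\<theta> / t)\<^sup>2 / 4)))"
proof -
  define u where "u = \<theta> / t"
  have u: "\<bar>u\<bar> \<le> 1" using \<theta> t_pos by (simp add: u_def)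
  have u2: "u\<^sup>2 \<le> 1" using u by (simp add: abs_square_le_1)
  define w where "w = 1 + \<i> * complex_of_real u"
  have Rew: "Re w = 1" by (simp add: w_def)
  have w0: "w \<noteq> 0" using Rew by auto
  define z where "z = Complex t \<theta>"
  have zw: "z = of_real t * w" using t_pos by (simp add: z_def w_def u_def complex_eq_iff)
  have Rez: "Re z > 0" using t_pos by (simp add: z_def)
  define q where "q = exp (- of_real (pi\<^sup>2) / z)"
  have nq: "norm q \<le> exp (- (2 * l))"
  proof -
    have "of_real (pi\<^sup>2) / z = of_real (pi\<^sup>2 / t) * (1 / w)" using t_pos w0 by (simp add: zw)
    also have "\<dots> = of_real (4 * l) * (1 / w)" by (simp only: pi2_t)
    also have "Re \<dots> = 4 * l * (1 / (1 + u\<^sup>2))"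
      using Re_inverse_1_plus_iu[of u, folded w_def] by (subst times_complex.sel(1)) simp
    finally have "Re (of_real (pi\<^sup>2) / z) = 4 * l * (1 / (1 + u\<^sup>2))" .
    moreover have "1 / 2 \<le> 1 / (1 + u\<^sup>2)" using u2 by (intro divide_left_mono) (auto intro: add_pos_nonneg)
    then have "4 * l * (1 / 2) \<le> 4 * l * (1 / (1 + u\<^sup>2))" using l_ge_1 by (intro mult_left_mono) auto
    ultimately show ?thesis by (simp add: q_def)
  qed
  \<comment> \<open>One of the two factors exp(-l) is traded for 1/l and the other is later
    majorised by exp(-l u^2/4), which gives this error the same shape as the saddle error.\<close>
  have e4: "4 * exp (- (2 * l)) \<le> 4 / l * exp (- l)"
  proof -
    have "l * exp (- l) \<le> 1"
    proof -
      have "l \<le> exp l" using exp_ge_add_one_self[of l] by linarith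
      then show ?thesis by (simp add: exp_minus field_simps)
    qed
    then have "exp (- l) \<le> 1 / l" using l_ge_1 by (simp add: field_simps)
    then have "4 * (exp (- l) * exp (- l)) \<le> 4 * (1 / l * exp (- l))" by (intro mult_left_mono mult_right_mono) auto
    then show ?thesis by (simp flip: exp_add)
  qed
  have nq4: "norm q \<le> 1/4"
  proof -
    have "4 \<le> exp (2 * l)" 
    proof -
      have "2 \<le> exp l" using exp_ge_add_one_self[of l] l_ge_1 by linarith
      then have "2 * 2 \<le> exp l * exp l" by (intro mult_mono) auto
      then show ?thesis by (simp flip: exp_add)
    qed
    then have "exp (- (2 * l)) \<le> 1/4" by (simp add: exp_minus field_simps)
    with nq show ?thesis by linarith
  qed
  \<comment> \<open>The principal logarithm splits without a jump because Re w = 1 is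
    positive.\<close>
  have cs: "1 / csqrt (of_real pi / z) = of_real (sqrt (t / pi)) * exp (Ln w / 2)"
  proof -
    have nn: "w \<notin> \<real>\<^sub>\<le>\<^sub>0" using Rew by (auto simp: complex_nonpos_Reals_iff)
    have "of_real pi / z = of_real (pi / t) * inverse w" using t_pos w0 by (simp add: zw divide_inverse)
    moreover have "Ln (of_real (pi / t) * inverse w) = of_real (ln (pi / t)) + Ln (inverse w)"
      using Ln_times_of_real[of "pi / t" "inverse w"] t_pos w0 Ln_of_real[of "pi / t"]
      by (simp del: of_real_divide)
    moreover have "Ln (inverse w) = - Ln w" by (rule Ln_inverse[OF nn])
    ultimately have "csqrt (of_real pi / z) = exp ((of_real (ln (pi / t)) - Ln w) / 2)"
      using Rez t_pos w0 by (subst csqrt_exp_Ln) auto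
    also have "\<dots> = exp (of_real (ln (pi / t) / 2)) / exp (Ln w / 2)"
      by (simp add: exp_diff diff_divide_distrib)
    also have "exp (complex_of_real (ln (pi / t) / 2)) = of_real (sqrt (pi / t))"
      using t_pos by (simp only: exp_of_real) (simp flip: ln_sqrt)
    finally show ?thesis by (simp add: real_sqrt_divide)
  qed
  have ex: "exp (of_real (pi\<^sup>2) / (4 * z)) * exp (of_nat m * z) * exp (Ln w / 2) = of_real (exp (2 * l)) * saddle l u"
  proof -
    have "of_real (pi\<^sup>2) / (4 * z) = of_real (pi\<^sup>2 / t) / (4 * w)" using t_pos w0 by (simp add: zw)
    also have "\<dots> = of_real l / w" unfolding pi2_t by simp
    finally have 1: "of_real (pi\<^sup>2) / (4 * z) = of_real l / w" .
    have 2: "of_nat m * z = of_real l * w" unfolding zw m_t[symmetric] by simp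
    \<comment> \<open>This is w + 1/w = 2 + (w - 1)^2/w with (w - 1)^2 = -u^2.\<close>
    have "complex_of_real l / w + of_real l * w + Ln w / 2 = of_real (2 * l) + (Ln w / 2 - l * u\<^sup>2 / w)"
    proof -
      have "of_real l / w + of_real l * w - (of_real (2 * l) - l * u\<^sup>2 / w) = of_real l * (1 + w * w - 2 * w + u\<^sup>2) / w"
        using w0 by (simp add: field_simps)
      also have "1 + w * w - 2 * w + u\<^sup>2 = 0" by (simp add: w_def algebra_simps power2_eq_square)
      finally show ?thesis by (simp add: algebra_simps)
    qed
    then show ?thesis unfolding 1 2 saddle_def w_def[symmetric] exp_add[symmetric]
      by (simp only: exp_add exp_of_real) simp
  qed
  have "overpartition_gf (exp (- z)) * exp (of_nat m * z) =
     1 / csqrt (of_real pi / z) / 2 * (exp (of_real (pi\<^sup>2) / (4 * z)) * exp (of_nat m * z)) * (1 / theta2 q)"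
    unfolding overpartition_gf_transformation[OF Rez] q_def by simp
  also have "\<dots> = of_real (sqrt (t / pi)) / 2 * (exp (of_real (pi\<^sup>2) / (4 * z)) * exp (of_nat m * z) * exp (Ln w / 2)) * (1 / theta2 q)"
    unfolding cs by (simp add: mult_ac)
  also have "\<dots> = of_real A * (saddle l u * (1 / theta2 q))"
    unfolding ex A_def by simp
  also have "\<dots> = of_real A * (saddle l u + saddle l u * (1 / theta2 q - 1))"
    by (simp add: algebra_simps)
  finally have I: "integrand \<theta> = A * (Re (saddle l u) + Re (saddle l u * (1 / theta2 q - 1)))"
    by (simp add: integrand_def z_def)
  have "norm (saddle l u * (1 / theta2 q - 1)) \<le> 2 * (4 / l * exp (- l))"
    unfolding norm_mult
  proof (intro mult_mono)
    have "norm (saddle l u) \<le> 2 * exp (- (l * u\<^sup>2 / 2))" by (rule norm_saddle_le[OF u]) (use l_ge_1 in auto)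
    also have "\<dots> \<le> 2" using l_ge_1 by simp
    finally show "norm (saddle l u) \<le> 2" .
    show "norm (1 / theta2 q - 1) \<le> 4 / l * exp (- l)"
      using theta2_bounds(2)[OF nq4] nq e4 by linarith
  qed auto
  also have "exp (- l) \<le> exp (- (l * u\<^sup>2 / 4))"
  proof -
    have "l * u\<^sup>2 \<le> l * 1" using u2 l_ge_1 by (intro mult_left_mono) auto
    then show ?thesis using l_ge_1 by simp
  qed
  then have "2 * (4 / l * exp (- l)) \<le> 8 / l * exp (- (l * u\<^sup>2 / 4))"
    using l_ge_1 by (simp add: divide_right_mono)
  finally have "\<bar>Re (saddle l u * (1 / theta2 q - 1))\<bar> \<le> 8 / l * exp (- (l * u\<^sup>2 / 4))"
    using abs_Re_le_cmod order_trans by blast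
  moreover have "\<bar>Re (saddle l u) - exp (- (l * u\<^sup>2))\<bar> \<le> 7000 / l * exp (- (l * u\<^sup>2 / 4))"
    by (rule Re_saddle_approx[OF u l_ge_1])
  moreover have "7000 / l * exp (- (l * u\<^sup>2 / 4)) + 8 / l * exp (- (l * u\<^sup>2 / 4)) = 7008 / l * exp (- (l * u\<^sup>2 / 4))"
    by (simp add: add_divide_distrib[symmetric] algebra_simps)
  ultimately have "\<bar>Re (saddle l u) + Re (saddle l u * (1 / theta2 q - 1)) - exp (- (l * u\<^sup>2))\<bar> \<le> 7008 / l * exp (- (l * u\<^sup>2 / 4))"
    by linarith
  then have "A * \<bar>Re (saddle l u) + Re (saddle l u * (1 / theta2 q - 1)) - exp (- (l * u\<^sup>2))\<bar> \<le> A * (7008 / l * exp (- (l * u\<^sup>2 / 4)))"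
    using A_pos by (intro mult_left_mono) auto
  moreover have "integrand \<theta> - A * exp (- (l * u\<^sup>2)) = A * (Re (saddle l u) + Re (saddle l u * (1 / theta2 q - 1)) - exp (- (l * u\<^sup>2)))"
    by (simp add: I algebra_simps)
  ultimately show ?thesis using A_pos by (simp add: abs_mult u_def)
qed

text \<open>At the real point r the transformation bounds P by a multiple of exp l, and the
  comparison along the circle lowers this exponent. For |theta| >= t the distance |1 - q| is at
  least 11/10 (1 - r), so Re (q/(1 - q)) falls short of r/(1 - r) by at least a fraction 1/11 of it,
  and r/(1 - r) is of order 1/t, hence of order l.\<close>

lemma minor_arc:
  assumes t: "t \<le> 1/2" and \<theta>: "t \<le> \<bar>\<theta>\<bar>" "\<bar>\<theta>\<bar> \<le> pi"
  shows "\<bar>integrand \<theta>\<bar> \<le> A * (4 * exp (- (l / 60)))"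
proof -
  define q r where "q = exp (- Complex t \<theta>)" and "r = exp (- t)"
  have nq: "norm q = r" by (simp add: q_def r_def)
  have r1: "r < 1" using t_pos by (simp add: r_def)
  have rt: "1 - r \<le> t" using exp_ge_add_one_self[of "- t"] by (simp add: r_def)
  have r2: "r \<ge> 1/2" using rt t by linarith
  have gr: "norm (overpartition_gf (of_real r)) \<le> 2 * sqrt (t / pi) / 2 * exp l"
  proof -
    have "overpartition_gf (of_real r) = overpartition_gf (exp (- of_real t))" by (simp add: r_def flip: exp_of_real)
    also have "\<dots> = 1 / (2 * csqrt (of_real pi / of_real t)) * exp (of_real (pi\<^sup>2) / (4 * of_real t)) *
        (1 / theta2 (exp (- of_real (pi\<^sup>2) / of_real t)))"
      by (rule overpartition_gf_transformation) (use t_pos in auto)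
    also have "csqrt (of_real pi / of_real t) = of_real (sqrt (pi / t))"
    proof -
      have "csqrt (of_real pi / of_real t) = csqrt (of_real (pi / t))" by simp
      also have "\<dots> = of_real (sqrt (pi / t))" by (subst csqrt_of_real_nonneg) (use t_pos in auto)
      finally show ?thesis .
    qed
    also have "complex_of_real (pi\<^sup>2) / (4 * of_real t) = of_real l"
    proof -
      have "complex_of_real (pi\<^sup>2) / (4 * of_real t) = of_real (pi\<^sup>2 / t / 4)" by simp
      then show ?thesis unfolding pi2_t by simp
    qed
    finally have "norm (overpartition_gf (of_real r)) = 1 / (2 * sqrt (pi / t)) * exp l * norm (1 / theta2 (exp (- of_real (pi\<^sup>2) / of_real t)))"
      using t_pos by (simp add: norm_mult norm_divide del: of_real_power)
    also have "\<dots> \<le> 1 / (2 * sqrt (pi / t)) * exp l * 2"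
    proof (intro mult_left_mono theta2_bounds(3))
      have "complex_of_real (pi\<^sup>2) / of_real t = of_real (4 * l)" using pi2_t by (metis of_real_divide)
      then have "norm (exp (- complex_of_real (pi\<^sup>2) / of_real t)) = exp (- (4 * l))" by simp
      also have "\<dots> \<le> 1/4"
      proof -
        have "4 \<le> exp (4 * l)" using exp_ge_add_one_self[of "4 * l"] l_ge_1 by linarith
        then show ?thesis by (simp add: exp_minus field_simps)
      qed
      finally show "norm (exp (- complex_of_real (pi\<^sup>2) / of_real t)) \<le> 1/4" .
    qed (use t_pos in auto)
    also have "\<dots> = 2 * sqrt (t / pi) / 2 * exp l" using t_pos by (simp add: real_sqrt_divide)
    finally show ?thesis .
  qed
  have gain: "r / (1 - r) - Re (q / (1 - q)) \<ge> l / 60"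
  proof -
    have qt: "q = of_real r * (cos \<theta> - \<i> * sin \<theta>)"
      by (simp add: q_def r_def exp_eq_polar cis.ctr complex_eq_iff)
    have Req: "Re q = r * cos \<theta>" and Imq: "Im q = - (r * sin \<theta>)" by (simp_all add: qt)
    have "(norm (1 - q))\<^sup>2 = (1 - r * cos \<theta>)\<^sup>2 + (r * sin \<theta>)\<^sup>2"
      by (simp add: cmod_power2 Req Imq)
    also have "\<dots> = (1 - r)\<^sup>2 + 2 * r * (1 - cos \<theta>)"
    proof -
      have "(r * cos \<theta>)\<^sup>2 + (r * sin \<theta>)\<^sup>2 = r\<^sup>2"
        by (simp add: power_mult_distrib flip: distrib_left)
      then show ?thesis by (simp add: power2_diff right_diff_distrib)
    qed
    finally have n1: "(norm (1 - q))\<^sup>2 = (1 - r)\<^sup>2 + 2 * r * (1 - cos \<theta>)" .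
    have cosb: "1 - cos \<theta> \<ge> t\<^sup>2 / 4"
    proof -
      have "cos \<theta> \<le> cos t"
      proof -
        have "cos \<bar>\<theta>\<bar> \<le> cos t" using \<theta> t_pos by (intro cos_monotone_0_pi_le) auto
        then show ?thesis by (simp add: cos_abs_real)
      qed
      also have "cos t \<le> 1 - t\<^sup>2 / 4"
      proof -
        have "(\<lambda>x. sin x - x / 2) 0 \<le> (\<lambda>x. sin x - x / 2) y" if y: "0 \<le> y" "y \<le> 1/2" for y :: real
        proof (rule DERIV_nonneg_imp_nondecreasing[where f="\<lambda>x. sin x - x / 2", OF y(1)])
          fix x :: real assume x: "0 \<le> x" "x \<le> y"
          have "cos (pi / 3) \<le> cos x" using x y pi_gt3 by (intro cos_monotone_0_pi_le) auto
          then have "cos x - 1 / 2 \<ge> 0" by (simp add: cos_60)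
          moreover have "((\<lambda>x. sin x - x / 2) has_real_derivative (cos x - 1 / 2)) (at x)"
            by (auto intro!: derivative_eq_intros)
          ultimately show "\<exists>d. ((\<lambda>x. sin x - x / 2) has_real_derivative d) (at x) \<and> 0 \<le> d" by blast
        qed
        then have sn: "sin y - y / 2 \<ge> 0" if "0 \<le> y" "y \<le> 1/2" for y :: real using that by simp
        have "(\<lambda>x. 1 - x\<^sup>2 / 4 - cos x) 0 \<le> (\<lambda>x. 1 - x\<^sup>2 / 4 - cos x) t"
        proof (rule DERIV_nonneg_imp_nondecreasing[where f="\<lambda>x. 1 - x\<^sup>2 / 4 - cos x" and a=0 and b=t])
          fix x assume x: "0 \<le> x" "x \<le> t"
          have "((\<lambda>x. 1 - x\<^sup>2 / 4 - cos x) has_real_derivative (sin x - x / 2)) (at x)"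
            by (auto intro!: derivative_eq_intros)
          moreover have "sin x - x / 2 \<ge> 0" using x t by (intro sn) auto
          ultimately show "\<exists>d. ((\<lambda>x. 1 - x\<^sup>2 / 4 - cos x) has_real_derivative d) (at x) \<and> 0 \<le> d" by blast
        qed (use t_pos in auto)
        then show ?thesis by simp
      qed
      finally show ?thesis by simp
    qed
    define D where "D = norm (1 - q)"
    \<comment> \<open>The excess of the left side over (1 - r)^2 is 21/100 (1 - r)^2, which is below
      t^2/4 because 1 - r <= t.\<close>
    have "(11 / 10 * (1 - r))\<^sup>2 \<le> (1 - r)\<^sup>2 + t\<^sup>2 / 4"
    proof -
      have "(1 - r)\<^sup>2 \<le> t\<^sup>2" using rt r1 by (intro power_mono) auto
      moreover have "(11 / 10 * (1 - r))\<^sup>2 = 121 / 100 * (1 - r)\<^sup>2"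
        by (simp only: power_mult_distrib) (simp add: power_divide)
      ultimately show ?thesis using zero_le_power2[of t] by linarith
    qed
    also have "\<dots> \<le> (1 - r)\<^sup>2 + 2 * r * (1 - cos \<theta>)"
    proof -
      have "1 * (t\<^sup>2 / 4) \<le> 2 * r * (1 - cos \<theta>)" using cosb r2 by (intro mult_mono) auto
      then show ?thesis by simp
    qed
    also have "\<dots> = D\<^sup>2" by (simp add: n1 D_def)
    finally have D: "11 / 10 * (1 - r) \<le> D" by (rule power2_le_imp_le) (simp add: D_def)
    have "Re (q / (1 - q)) \<le> norm (q / (1 - q))" by (rule complex_Re_le_cmod)
    also have "\<dots> = r / D" by (simp add: norm_divide nq D_def)
    also have "\<dots> \<le> r / (11 / 10 * (1 - r))" using D r1 r2 by (intro divide_left_mono mult_pos_pos) auto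
    finally have "r / (1 - r) - Re (q / (1 - q)) \<ge> r / (1 - r) - r / (11 / 10 * (1 - r))" by simp
    also have "r / (11 / 10 * (1 - r)) = (10 / 11 * r) / (1 - r)" by simp
    also have "r / (1 - r) - (10 / 11 * r) / (1 - r) = (r / 11) / (1 - r)"
      unfolding diff_divide_distrib[symmetric] by simp
    finally have 1: "r / (1 - r) - Re (q / (1 - q)) \<ge> (r / 11) / (1 - r)" .
    \<comment> \<open>The constant 60 comes from l t = pi^2/4 <= 60/22; the fraction 1/22 is half of
      1/11, as r >= 1/2.\<close>
    have "l / 60 \<le> (1 / 22) / t"
    proof -
      have "pi\<^sup>2 \<le> (16 / 5)\<^sup>2" using pi_approx by (intro power_mono) auto
      moreover have "4 * l * t = pi\<^sup>2" using pi2_t t_pos by (simp add: field_simps)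
      ultimately have "l * t \<le> 60 / 22" by (simp add: power2_eq_square)
      then show ?thesis using t_pos by (simp add: field_simps)
    qed
    also have "\<dots> \<le> (r / 11) / (1 - r)" using r1 r2 rt by (rule_tac frac_le) auto
    finally show ?thesis using 1 by (rule order_trans)
  qed
  have "norm (overpartition_gf q) \<le> norm (overpartition_gf (of_real r)) * exp (- (r / (1 - r) - Re (q / (1 - q))))"
    using norm_overpartition_gf_le[of q] nq r1 by simp
  also have "\<dots> \<le> (2 * sqrt (t / pi) / 2 * exp l) * exp (- (l / 60))"
    using gr gain t_pos by (intro mult_mono) auto
  finally have g: "norm (overpartition_gf q) \<le> (2 * sqrt (t / pi) / 2 * exp l) * exp (- (l / 60))" .
  have "\<bar>integrand \<theta>\<bar> \<le> norm (overpartition_gf q * exp (of_nat m * Complex t \<theta>))"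
    unfolding integrand_def q_def by (rule abs_Re_le_cmod)
  also have "\<dots> = norm (overpartition_gf q) * exp l" by (simp add: norm_mult m_t)
  also have "\<dots> \<le> (2 * sqrt (t / pi) / 2 * exp l) * exp (- (l / 60)) * exp l"
    using g by (intro mult_right_mono) auto
  also have "\<dots> = A * (2 * exp (- (l / 60)))"
    by (simp add: A_def exp_double power2_eq_square)
  also have "\<dots> \<le> A * (4 * exp (- (l / 60)))" using A_pos by (intro mult_left_mono) auto
  finally show ?thesis .
qed

section \<open>Gaussian integrals and assembly of the arcs\<close>

lemma gaussian_integrals:
  fixes b :: real
  assumes b: "b > 0"
  defines "h \<equiv> \<lambda>\<theta>. exp (- (b * (\<theta> / t)\<^sup>2))"
  shows "((\<lambda>y. integral {0..y} h) \<longlongrightarrow> t * sqrt (pi / b) / 2) at_top"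
    and "0 \<le> y \<Longrightarrow> integral {0..y} h \<le> t * sqrt (pi / b) / 2"
    and "integral {- pi..pi} h = 2 * integral {0..pi} h"
proof -
  have hc: "continuous_on S h" for S unfolding h_def using t_pos by (intro continuous_intros) auto
  have hpos: "h x \<ge> 0" for x by (simp add: h_def)
  define c where "c = sqrt (2 * b) / t"
  have c: "c > 0" using b t_pos by (simp add: c_def)
  have "(c * x)\<^sup>2 / 2 = b * (x / t)\<^sup>2" for x
    using b by (simp add: c_def power_mult_distrib power_divide)
  then have h: "(\<lambda>x. exp (- ((c * x)\<^sup>2) / 2) * cos (0 * x)) = h"
    by (simp add: h_def)
  have "sqrt (pi / 2) / c = t * (sqrt (pi / 2) / sqrt (2 * b))" by (simp add: c_def)
  also have "sqrt (pi / 2) / sqrt (2 * b) = sqrt ((pi / 2) / (2 * b))" by (rule real_sqrt_divide[symmetric])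
  also have "(pi / 2) / (2 * b) = (pi / b) / 4" by simp
  also have "sqrt ((pi / b) / 4) = sqrt (pi / b) / 2" by (simp only: real_sqrt_divide real_sqrt_four)
  finally have "sqrt (pi / 2) / c = t * sqrt (pi / b) / 2" by simp
  with gaussian_cosine_integral[OF c, of 0] show lim: "((\<lambda>y. integral {0..y} h) \<longlongrightarrow> t * sqrt (pi / b) / 2) at_top"
    unfolding h by simp
  show "integral {0..y} h \<le> t * sqrt (pi / b) / 2" if "0 \<le> y"
  proof (rule tendsto_lowerbound[OF lim])
    show "\<forall>\<^sub>F x in at_top. integral {0..y} h \<le> integral {0..x} h"
      using eventually_ge_at_top[of y]
    proof eventually_elim
      case (elim x)
      show ?case
        by (rule integral_subset_le) (use elim in \<open>auto intro!: integrable_continuous_real hc hpos\<close>)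
    qed
  qed auto
  have "integral {- pi..0} h = integral {0..pi} h"
  proof -
    have "integral {- pi..- 0} (\<lambda>x. h (- x)) = integral {0..pi} h"
      using Henstock_Kurzweil_Integration.integral_reflect_real[of pi 0 h] by simp
    then show ?thesis by (simp add: h_def)
  qed
  moreover have "integral {- pi..0} h + integral {0..pi} h = integral {- pi..pi} h"
    by (rule Henstock_Kurzweil_Integration.integral_combine) (auto intro!: integrable_continuous_real hc)
  ultimately show "integral {- pi..pi} h = 2 * integral {0..pi} h" by simp
qed

text \<open>\<open>W\<close> is the integral over the whole line. Beyond pi one has theta/t >= 1, so
  a factor exp(-3l/4), at most 4/(3l), splits off and leaves the broader Gaussian with l/4. The two
  tails cost 8/(3l), rounded up to 4/l.\<close>

lemma gaussian_integral_bounds: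
  defines "W \<equiv> t * sqrt (pi / l)"
  shows "integral {- pi..pi} (\<lambda>\<theta>. exp (- (l * (\<theta> / t)\<^sup>2))) \<le> W"
    and "t \<le> 1 \<Longrightarrow> W - 4 / l * W \<le> integral {- pi..pi} (\<lambda>\<theta>. exp (- (l * (\<theta> / t)\<^sup>2)))"
    and "integral {- pi..pi} (\<lambda>\<theta>. exp (- (l * (\<theta> / t)\<^sup>2 / 4))) \<le> 2 * W"
proof -
  have l0: "l > 0" "l / 4 > 0" using l_ge_1 by auto
  let ?g = "\<lambda>\<theta>. exp (- (l * (\<theta> / t)\<^sup>2))" and ?h = "\<lambda>\<theta>. exp (- (l / 4 * (\<theta> / t)\<^sup>2))"
  have c: "continuous_on S ?g" "continuous_on S ?h" for S
    using t_pos by (auto intro!: continuous_intros)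
  show "integral {- pi..pi} ?g \<le> W"
    using gaussian_integrals(2)[OF l0(1), of pi] gaussian_integrals(3)[OF l0(1)] by (simp add: W_def)
  have "sqrt (pi / (l / 4)) = sqrt (2\<^sup>2 * (pi / l))" by simp
  also have "\<dots> = 2 * sqrt (pi / l)" by (simp only: real_sqrt_mult real_sqrt_abs abs_numeral)
  finally have s4: "t * sqrt (pi / (l / 4)) / 2 = W" by (simp add: W_def)
  have "integral {- pi..pi} ?h \<le> 2 * W"
    using gaussian_integrals(2)[OF l0(2), of pi] gaussian_integrals(3)[OF l0(2)] pi_ge_zero unfolding s4 by simp
  then show "integral {- pi..pi} (\<lambda>\<theta>. exp (- (l * (\<theta> / t)\<^sup>2 / 4))) \<le> 2 * W" by simp
  assume t1: "t \<le> 1"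
  have "W / 2 \<le> integral {0..pi} ?g + 4 / (3 * l) * W"
  proof (rule tendsto_upperbound[OF gaussian_integrals(1)[OF l0(1), folded W_def]])
    show "\<forall>\<^sub>F y in at_top. integral {0..y} ?g \<le> integral {0..pi} ?g + 4 / (3 * l) * W"
      using eventually_ge_at_top[of pi]
    proof eventually_elim
      case (elim y)
      have "integral {pi..y} ?g \<le> integral {pi..y} (\<lambda>\<theta>. 4 / (3 * l) * ?h \<theta>)"
      proof (intro integral_le integrable_continuous_real)
        fix \<theta> assume "\<theta> \<in> {pi..y}"
        then have "1 \<le> \<theta> / t" using t1 t_pos pi_ge_two by simp
        then have "1\<^sup>2 \<le> (\<theta> / t)\<^sup>2" by (intro power_mono) auto
        then have "3 * l / 4 * 1 \<le> 3 * l / 4 * (\<theta> / t)\<^sup>2" using l0 by (intro mult_left_mono) auto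
        moreover have "3 * l / 4 * v = l * v - l / 4 * v" for v by (simp add: field_simps)
        ultimately have "l * (\<theta> / t)\<^sup>2 \<ge> 3 * l / 4 + l / 4 * (\<theta> / t)\<^sup>2" by simp
        then have "?g \<theta> \<le> exp (- (3 * l / 4) + - (l / 4 * (\<theta> / t)\<^sup>2))" by simp
        also have "\<dots> = exp (- (3 * l / 4)) * ?h \<theta>" by (simp only: exp_add)
        also have "exp (- (3 * l / 4)) \<le> 4 / (3 * l)"
        proof -
          have "3 * l / 4 \<le> exp (3 * l / 4)" using exp_ge_add_one_self[of "3 * l / 4"] by linarith
          then show ?thesis using l0 by (simp add: exp_minus field_simps)
        qed
        finally show "?g \<theta> \<le> 4 / (3 * l) * ?h \<theta>" by (simp add: mult_right_mono)
      qed (use l0 t_pos in \<open>auto intro!: continuous_intros\<close>)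
      also have "\<dots> = 4 / (3 * l) * integral {pi..y} ?h" by (rule integral_mult_right)
      also have "integral {pi..y} ?h \<le> integral {0..y} ?h"
        by (rule integral_subset_le) (use t_pos in \<open>auto intro!: integrable_continuous_real continuous_intros\<close>)
      also have "\<dots> \<le> W" using gaussian_integrals(2)[OF l0(2), of y] elim pi_ge_zero by (simp only: s4)
      finally have "integral {pi..y} ?g \<le> 4 / (3 * l) * W" using l0 by (simp add: divide_right_mono)
      moreover have "integral {0..pi} ?g + integral {pi..y} ?g = integral {0..y} ?g"
        by (rule Henstock_Kurzweil_Integration.integral_combine) (use elim in \<open>auto intro!: integrable_continuous_real c\<close>)
      ultimately show ?case by simp
    qed
  qed auto
  then have "W \<le> 2 * integral {0..pi} ?g + 8 / 3 * (W / l)" by simp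
  moreover have "W / l \<ge> 0" using t_pos l0 by (simp add: W_def)
  ultimately have "W - 4 / l * W \<le> 2 * integral {0..pi} ?g" by simp
  then show "W - 4 / l * W \<le> integral {- pi..pi} ?g"
    using gaussian_integrals(3)[OF l0(1)] by simp
qed

text \<open>\<open>A * W\<close> is 2 pi times the main term, and every error is at most a multiple
  of A W / l, where 1/l is at most 1/sqrt m. The restriction on \<open>t\<close> is the one of the
  minor arcs.\<close>

lemma overpartitions_approx:
  assumes t: "t \<le> 1/2"
  shows "\<bar>real (overpartitions m) - exp (pi * sqrt m) / (8 * real m)\<bar> \<le> 10 ^ 8 / sqrt m * (exp (pi * sqrt m) / (8 * real m))"
proof -
  define W where "W = t * sqrt (pi / l)"
  have l0: "l > 0" using l_ge_1 by auto
  have W0: "W > 0" using t_pos l0 by (simp add: W_def)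
  let ?g = "\<lambda>\<theta>. exp (- (l * (\<theta> / t)\<^sup>2))" and ?h = "\<lambda>\<theta>. exp (- (l * (\<theta> / t)\<^sup>2 / 4))"
  define E where "E = exp (- (l / 60))"
  have c: "continuous_on S ?g" "continuous_on S ?h" for S
    using t_pos by (auto intro!: continuous_intros)
  have ci: "continuous_on {- pi..pi} integrand"
    unfolding integrand_def using overpartition_gf_integral(2)[OF t_pos] .
  have I: "integral {- pi..pi} integrand = 2 * pi * real (overpartitions m)"
    unfolding integrand_def using overpartition_gf_integral(1)[OF t_pos] by (rule integral_unique)
  \<comment> \<open>One bound for the whole circle: off the major arc the integrand (4 E) and the
    Gaussian (E) are both exponentially small.\<close>
  have pw: "\<bar>integrand \<theta> - A * ?g \<theta>\<bar> \<le> A * (7008 / l * ?h \<theta>) + A * (5 * E)" if "\<theta> \<in> {- pi..pi}" for \<theta>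
  proof (cases "\<bar>\<theta>\<bar> \<le> t")
    case True
    have "0 \<le> A * (5 * E)" using A_pos by (simp add: E_def)
    with major_arc[OF True] show ?thesis by linarith
  next
    case False
    have "\<bar>integrand \<theta>\<bar> \<le> A * (4 * E)"
      unfolding E_def by (rule minor_arc[OF t]) (use False that in auto)
    moreover have "?g \<theta> \<le> E"
    proof -
      have "1 \<le> \<bar>\<theta>\<bar> / t" using False t_pos by simp
      then have "1\<^sup>2 \<le> (\<bar>\<theta>\<bar> / t)\<^sup>2" by (intro power_mono) auto
      then have "l * 1 \<le> l * (\<theta> / t)\<^sup>2" using l0 by (intro mult_left_mono) (auto simp: power_divide)
      then show ?thesis using l0 by (simp add: E_def)
    qed
    then have "A * ?g \<theta> \<le> A * E" using A_pos by (intro mult_left_mono) auto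
    moreover have "0 \<le> A * ?g \<theta>" "0 \<le> A * (7008 / l * ?h \<theta>)" using A_pos l0 by auto
    moreover have "A * (5 * E) = A * (4 * E) + A * E" by (simp add: algebra_simps)
    ultimately show ?thesis by linarith
  qed
  have i: "(\<lambda>\<theta>. integrand \<theta> - A * ?g \<theta>) integrable_on {- pi..pi}"
    by (intro integrable_continuous_real continuous_intros ci c)
  have "\<bar>integral {- pi..pi} (\<lambda>\<theta>. integrand \<theta> - A * ?g \<theta>)\<bar> \<le>
      integral {- pi..pi} (\<lambda>\<theta>. A * (7008 / l * ?h \<theta>) + A * (5 * E))"
    unfolding real_norm_def[symmetric]
  proof (rule integral_norm_bound_integral[OF i])
    show "(\<lambda>\<theta>. A * (7008 / l * ?h \<theta>) + A * (5 * E)) integrable_on {- pi..pi}"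
      by (intro integrable_continuous_real continuous_intros c)
  qed (use pw in simp)
  also have "\<dots> = A * (7008 / l * integral {- pi..pi} ?h) + 2 * pi * (A * (5 * E))"
    by (subst Henstock_Kurzweil_Integration.integral_add)
       (use l0 in \<open>auto intro!: integrable_continuous_real continuous_intros c\<close>)
  also have "\<dots> \<le> A * (7008 / l * (2 * W)) + 2 * pi * (A * (5 * E))"
    using gaussian_integral_bounds(3) A_pos l0 unfolding W_def by (intro add_mono mult_left_mono) auto
  finally have 1: "\<bar>integral {- pi..pi} (\<lambda>\<theta>. integrand \<theta> - A * ?g \<theta>)\<bar> \<le> A * (14016 / l * W) + 10 * pi * (A * E)"
    by (simp add: mult_ac)
  have 2: "integral {- pi..pi} (\<lambda>\<theta>. integrand \<theta> - A * ?g \<theta>) = 2 * pi * real (overpartitions m) - A * integral {- pi..pi} ?g"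
    by (subst Henstock_Kurzweil_Integration.integral_diff)
       (use I in \<open>auto intro!: integrable_continuous_real continuous_intros ci c\<close>)
  have 3: "\<bar>A * integral {- pi..pi} ?g - A * W\<bar> \<le> A * (4 / l * W)"
  proof -
    have "\<bar>integral {- pi..pi} ?g - W\<bar> \<le> 4 / l * W"
      using gaussian_integral_bounds(1,2) t W0 l0 unfolding W_def[symmetric] by (simp add: abs_le_iff) 
    then have "A * \<bar>integral {- pi..pi} ?g - W\<bar> \<le> A * (4 / l * W)" using A_pos by (intro mult_left_mono) auto
    moreover have "A * \<bar>integral {- pi..pi} ?g - W\<bar> = \<bar>A * integral {- pi..pi} ?g - A * W\<bar>"
      using A_pos by (simp add: abs_mult right_diff_distrib[symmetric])
    ultimately show ?thesis by simp
  qed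
  \<comment> \<open>\<open>W\<close> is of order l^(-3/2), hence at least 1/l^2, while y^3/6 <= exp
    y at y = l/60 bounds \<open>E\<close> by 1296000/l^3, where 1296000 = 6 * 60^3.\<close>
  have EW: "E \<le> 1296000 / l * W"
  proof -
    have W: "W * (l * sqrt l) = pi\<^sup>2 / 4 * sqrt pi"
    proof -
      have "t * l = pi\<^sup>2 / 4" using pi2_t t_pos by (simp add: field_simps)
      then show ?thesis using l0 by (simp add: W_def real_sqrt_divide mult_ac)
    qed
    have "1 * 1 \<le> pi\<^sup>2 / 4 * sqrt pi"
    proof (intro mult_mono)
      have "2\<^sup>2 \<le> pi\<^sup>2" using pi_ge_two by (intro power_mono) auto
      then show "1 \<le> pi\<^sup>2 / 4" by simp
      show "1 \<le> sqrt pi" using pi_ge_two by simp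
    qed auto
    then have "1 \<le> W * (l * sqrt l)" using W by simp
    also have "\<dots> \<le> W * (l * l)"
    proof -
      have "sqrt l \<le> l" using l_ge_1 by (intro real_le_lsqrt) (auto simp: power2_eq_square)
      then show ?thesis using W0 l0 by (intro mult_left_mono) auto
    qed
    finally have W1: "1 \<le> W * (l * l)" .
    define y where "y = l / 60"
    have "y ^ 3 / 6 \<le> exp y"
    proof -
      have "(4 * y) ^ 3 \<le> 384 * exp (4 * y / 4)" by (rule poly_exp_bound(3)) (use l0 in \<open>simp add: y_def\<close>)
      then show ?thesis by (simp add: power_mult_distrib)
    qed
    then have "l ^ 3 / 1296000 \<le> exp (l / 60)" by (simp add: y_def power_divide)
    then have "E * l ^ 3 \<le> 1296000" unfolding E_def using l0 by (simp add: exp_minus field_simps)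
    then have "E * l ^ 3 * 1 \<le> 1296000 * (W * (l * l))" using W1 by (intro mult_mono) (auto simp: W0 less_imp_le)
    then have "(E * l) * (l * l) \<le> (1296000 * W) * (l * l)" by (simp add: power3_eq_cube mult_ac)
    then have "E * l \<le> 1296000 * W" using l0 by (simp add: mult_le_cancel_right)
    then show ?thesis using l0 by (simp add: field_simps)
  qed
  have "10 * pi * (A * E) \<le> 40 * (A * (1296000 / l * W))"
    using EW A_pos pi_less_4 l0 W0 by (intro mult_mono) (auto simp: E_def)
  then have "\<bar>2 * pi * real (overpartitions m) - A * W\<bar> \<le> A * (14016 / l * W) + 40 * (A * (1296000 / l * W)) + A * (4 / l * W)"
    using 1 2 3 by linarith
  \<comment> \<open>The sum of 14016, which is 7008 times the mass 2 W, of 40 * 1296000 and of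
    4.\<close>
  also have "\<dots> = 51854020 / l * (A * W)" by (simp add: field_simps)
  finally have 4: "\<bar>2 * pi * real (overpartitions m) - A * W\<bar> \<le> 51854020 / l * (A * W)" .
  have AW: "A * W = 2 * pi * (exp (pi * sqrt m) / (8 * real m))"
  proof -
    have "sqrt (t / pi) * sqrt (pi / l) = sqrt (t / l)" using l0 t_pos by (simp flip: real_sqrt_mult)
    also have "t / l = 1 / real m" using m by (simp add: t_def l_def field_simps)
    also have "sqrt (1 / real m) = 1 / sqrt m" by (simp add: real_sqrt_divide)
    finally have s: "sqrt (t / pi) * sqrt (pi / l) = 1 / sqrt m" .
    have "A * W = (sqrt (t / pi) * sqrt (pi / l)) * t / 2 * exp (2 * l)" by (simp add: A_def W_def)
    also have "\<dots> = pi / (4 * (sqrt m * sqrt m)) * exp (pi * sqrt m)" unfolding s by (simp add: t_def l_def)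
    also have "sqrt m * sqrt m = m" by simp
    finally show ?thesis by simp
  qed
  let ?F = "exp (pi * sqrt m) / (8 * real m)"
  have "2 * pi * \<bar>real (overpartitions m) - ?F\<bar> = \<bar>2 * pi * real (overpartitions m) - A * W\<bar>"
    unfolding AW right_diff_distrib[symmetric] abs_mult by simp
  also have "\<dots> \<le> 2 * pi * (51854020 / l * ?F)" using 4 unfolding AW by (simp add: mult_ac)
  finally have "\<bar>real (overpartitions m) - ?F\<bar> \<le> 51854020 / l * ?F"
    by (rule mult_left_le_imp_le) simp
  also have "\<dots> \<le> 10 ^ 8 / sqrt m * ?F"
  proof (intro mult_right_mono)
    have "sqrt m \<le> l" unfolding l_def using pi_ge_two mult_right_mono[of 2 pi "sqrt m"] by simp
    then show "51854020 / l \<le> 10 ^ 8 / sqrt m" using m by (intro frac_le) auto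
  qed auto
  finally show ?thesis .
qed

end

theorem overpartitions_asymptotics:
  obtains C where "C > 0"
    "\<And>m. m > 0 \<Longrightarrow> \<bar>real (overpartitions m) - exp (pi * sqrt m) / (8 * real m)\<bar> \<le> C / sqrt m * (exp (pi * sqrt m) / (8 * real m))"
proof -
  let ?F = "\<lambda>m::nat. exp (pi * sqrt m) / (8 * real m)"
  let ?e = "\<lambda>m. \<bar>real (overpartitions m) - ?F m\<bar> * sqrt m / ?F m"
  \<comment> \<open>The additional sum absorbs the finitely many m <= 16; for larger m, sqrt m >= 4
    gives t <= 1/2.\<close>
  define C where "C = 10 ^ 8 + (\<Sum>m = 1..16. ?e m)"
  have n: "?e m \<ge> 0" for m by simp
  have "C > 0" unfolding C_def using n by (intro add_pos_nonneg sum_nonneg) auto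
  moreover have "\<bar>real (overpartitions m) - ?F m\<bar> \<le> C / sqrt m * ?F m" if m: "m > 0" for m
  proof (cases "m \<le> 16")
    case True
    have "?e m \<le> (\<Sum>m = 1..16. ?e m)"
      by (rule member_le_sum) (use True m n in auto)
    then have "?e m \<le> C" by (simp add: C_def)
    then show ?thesis using m by (simp add: field_simps)
  next
    case False
    interpret saddle_point m "pi * sqrt m / 2" "pi / (2 * sqrt m)" "sqrt (pi / (2 * sqrt m) / pi) * exp (2 * (pi * sqrt m / 2)) / 2"
      using m by unfold_locales
    have "4 \<le> sqrt m" using False real_le_rsqrt[of 4 m] by simp
    then have "pi / (2 * sqrt m) \<le> 4 / (2 * 4)" using pi_less_4 by (intro frac_le) auto
    then have "\<bar>real (overpartitions m) - ?F m\<bar> \<le> 10 ^ 8 / sqrt m * ?F m"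
      using overpartitions_approx by simp
    also have "\<dots> \<le> C / sqrt m * ?F m"
      unfolding C_def using n by (intro mult_right_mono divide_right_mono) (auto intro!: sum_nonneg)
    finally show ?thesis .
  qed
  ultimately show ?thesis using that by blast
qed

section \<open>Reduction to alternating sums of overpartition numbers\<close>

lemma num_parts_cong_le:
  assumes "P \<in> distinct_partitions n"
  shows "num_parts_cong a k P \<le> n"
proof -
  have P: "finite P" "0 \<notin> P" "\<Sum>P = n" using assms by (auto simp: distinct_partitions_def)
  have "num_parts_cong a k P \<le> card P"
    unfolding num_parts_cong_def by (rule card_mono) (use P in auto)
  also have "card P = (\<Sum>x\<in>P. 1)" by simp
  also have "\<dots> \<le> \<Sum>P" by (rule sum_mono) (use P in \<open>auto intro!: Suc_leI intro: gr0I\<close>)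
  finally show ?thesis using P by simp
qed

text \<open>The sign \<open>s\<close> serves both inequalities at once. The excess of a partition of
  n is at most n in absolute value, so the cut-off \<open>K\<close> is free above n and can be taken
  divisible by 3.\<close>

lemma card_partition_by_excess:
  assumes "n \<le> K" "\<And>P. P \<in> distinct_partitions n \<Longrightarrow> Q P \<longleftrightarrow> s * excess P > 0" "s = 1 \<or> s = -1"
  shows "card {P \<in> distinct_partitions n. Q P} = (\<Sum>k = 1..K. num_excess (s * int k) n)"
proof -
  have "{P \<in> distinct_partitions n. Q P} = (\<Union>k\<in>{1..K}. {P \<in> distinct_partitions n. excess P = s * int k})"
  proof (intro equalityI subsetI)
    fix P assume P: "P \<in> {P \<in> distinct_partitions n. Q P}"
    then have "s * excess P > 0" using assms(2) by auto
    moreover have "s * excess P \<le> int n"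
      using num_parts_cong_le[of P n 1 3] num_parts_cong_le[of P n 2 3] P assms(3) by (auto simp: excess_def)
    moreover have "s * (s * excess P) = excess P" using assms(3) by auto
    ultimately show "P \<in> (\<Union>k\<in>{1..K}. {P \<in> distinct_partitions n. excess P = s * int k})"
      using P assms(1) by (intro UN_I[of "nat (s * excess P)"]) auto
  qed (use assms in auto)
  also have "card \<dots> = (\<Sum>k = 1..K. card {P \<in> distinct_partitions n. excess P = s * int k})"
    by (rule card_UN_disjoint) (use assms(3) finite_distinct_partitions[of n] in auto)
  finally show ?thesis by (simp add: num_excess_def)
qed

lemma d0_difference:
  assumes "n \<le> K"
  shows "real (d0 1 2 3 n) - real (d0 2 1 3 n) =
    (\<Sum>k = 1..K. real (num_excess (int k) n) - real (num_excess (- int k) n))"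
proof -
  have "d0 1 2 3 n = (\<Sum>k = 1..K. num_excess (1 * int k) n)"
    unfolding d0_def by (rule card_partition_by_excess[OF assms]) (auto simp: excess_def)
  moreover have "d0 2 1 3 n = (\<Sum>k = 1..K. num_excess (- 1 * int k) n)"
    unfolding d0_def by (rule card_partition_by_excess[OF assms]) (auto simp: excess_def)
  ultimately show ?thesis by (simp add: sum_subtractf)
qed

section \<open>Selection of the quadratic sequences by residue class\<close>

text \<open>Extended by 0 to negative arguments, so that exponents exceeding m call for no case
  distinction.\<close>

definition opart :: "int \<Rightarrow> real" where
  "opart x = (if x \<ge> 0 then real (overpartitions (nat x)) else 0)"

lemma num_excess_eq_opart:
  assumes "int n - pent k = 3 * x"
  shows "real (num_excess k n) = opart x"
proof (cases "pent k \<le> int n")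
  case True
  then have "x \<ge> 0" using assms by simp
  moreover have "n - nat (pent k) = 3 * nat x" using assms True pent_nonneg[of k] by linarith
  ultimately show ?thesis using True by (simp add: num_excess_shift[of k] opart_def overpartitions_def)
next
  case False
  then show ?thesis using assms by (simp add: num_excess_shift[of k] opart_def)
qed

text \<open>Modulo 3, 2 (n - pent k) is 2n + k, so for each n a single residue class of k
  survives.\<close>

lemma num_excess_eq_0:
  assumes "\<not> 3 dvd 2 * int n + k"
  shows "num_excess k n = 0"
proof (cases "pent k \<le> int n")
  case True
  have "\<not> 3 dvd n - nat (pent k)"
  proof
    assume "3 dvd n - nat (pent k)"
    then have "3 dvd int (n - nat (pent k))" by presburger
    also have "int (n - nat (pent k)) = int n - pent k" using True pent_nonneg[of k] by simp
    finally have "3 dvd 2 * (int n - pent k)" by (rule dvd_mult)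
    moreover have "2 * (int n - pent k) = (2 * int n + k) - 3 * (k * k)"
      using two_pent[of k] by (simp add: algebra_simps)
    ultimately have "3 dvd (2 * int n + k) - 3 * (k * k)" by (simp only:)
    then have "3 dvd (2 * int n + k) - 3 * (k * k) + 3 * (k * k)" by (intro dvd_add) auto
    with assms show False by simp
  qed
  then show ?thesis by (simp add: num_excess_shift[of k] num_excess_0_eq_0)
qed (simp add: num_excess_shift[of k])

text \<open>One third of \<open>pent k\<close>, shifted by 0, 1 or 2, as k runs through one residue
  class modulo 3; the values of \<open>a\<close> that occur are 1, 5, 7 and their negatives. For odd
  \<open>a\<close> the division is exact.\<close>

definition expo :: "int \<Rightarrow> nat \<Rightarrow> int" where
  "expo a j = int j * (9 * int j + a) div 2"

lemma two_expo_real: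
  assumes "odd a"
  shows "2 * real_of_int (expo a j) = real j * (9 * real j + of_int a)"
proof -
  have "2 * expo a j = int j * (9 * int j + a)" using assms by (simp add: expo_def)
  from arg_cong[OF this, of real_of_int] show ?thesis by simp
qed

lemma two_expo: "odd a \<Longrightarrow> 2 * expo a j = int j * (9 * int j + a)"
  by (simp add: expo_def)

definition alt_term :: "int \<Rightarrow> nat \<Rightarrow> nat \<Rightarrow> real" where
  "alt_term a m j = opart (int m - expo (- a) j) - opart (int m - expo a j)"

text \<open>The upper limit m + 1 comes from cutting the excess at 3 (m + 1), which exceeds n for
  all three residues.\<close>

definition alt_sum :: "int \<Rightarrow> nat \<Rightarrow> real" where
  "alt_sum a m = (\<Sum>j = 1..m + 1. alt_term a m j)"

lemma pent_step:
  assumes "odd a" "2 * c + k * (3 * k - 1) = 3 * (int j * (9 * int j + a))"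
  shows "pent k + c = 3 * expo a j"
proof -
  have "2 * (pent k + c) = 2 * (3 * expo a j)" using two_pent[of k] two_expo[OF assms(1), of j] assms(2) by simp
  then show ?thesis by simp
qed

lemma sum_triples:
  fixes f :: "nat \<Rightarrow> real"
  shows "(\<Sum>k = 1..3 * K. f k) = (\<Sum>j = 1..K. f (3 * j - 2) + f (3 * j - 1) + f (3 * j))"
proof (induction K)
  case (Suc K)
  have "{1..3 * Suc K} = insert (3 * K + 3) (insert (3 * K + 2) (insert (3 * K + 1) {1..3 * K}))" by auto
  then have "(\<Sum>k = 1..3 * Suc K. f k) = f (3 * K + 3) + (f (3 * K + 2) + (f (3 * K + 1) + (\<Sum>k = 1..3 * K. f k)))"
    by simp
  then show ?case using Suc.IH by (simp add: numeral_3_eq_3)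
qed simp

lemma opart_beyond:
  assumes "odd a" "a \<ge> 0"
  shows "opart (int m - expo a (Suc m)) = 0"
proof -
  have "2 * expo a (Suc m) = int (Suc m) * (9 * int (Suc m) + a)" by (rule two_expo[OF assms(1)])
  also have "\<dots> \<ge> int (Suc m) * 2" by (rule mult_left_mono) (use assms in auto)
  finally have "expo a (Suc m) \<ge> int (Suc m)" by simp
  then show ?thesis by (simp add: opart_def)
qed

text \<open>Starting one index earlier adds the term of j = 0, which is p(m); at the other end the
  index m + 1 contributes 0 by \<open>opart_beyond\<close>.\<close>

lemma sum_shift_opart:
  assumes "odd a" "a \<ge> 0"
  shows "(\<Sum>j = 1..m + 1. opart (int m - expo a (j - 1))) = opart (int m) + (\<Sum>j = 1..m + 1. opart (int m - expo a j))"
proof -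
  have "(\<Sum>j = 1..m + 1. opart (int m - expo a (j - 1))) = (\<Sum>j\<in>{0..m}. opart (int m - expo a j))"
    by (rule sum.reindex_bij_witness[of _ Suc "\<lambda>j. j - 1"]) auto
  also have "\<dots> = opart (int m) + (\<Sum>j = 1..m. opart (int m - expo a j))"
    by (subst sum.atLeast_Suc_atMost) (simp_all add: expo_def)
  finally show ?thesis using opart_beyond[OF assms, of m] by simp
qed

lemma d0_difference_mod_0:
  "real (d0 1 2 3 (3 * m)) - real (d0 2 1 3 (3 * m)) = alt_sum 1 m"
proof -
  let ?n = "3 * m"
  let ?f = "\<lambda>k. real (num_excess (int k) ?n) - real (num_excess (- int k) ?n)"
  have "real (d0 1 2 3 ?n) - real (d0 2 1 3 ?n) = (\<Sum>k = 1..3 * (m + 1). ?f k)"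
    by (rule d0_difference) simp
  also have "\<dots> = alt_sum 1 m"
    unfolding sum_triples alt_sum_def alt_term_def
  proof (rule sum.cong[OF refl])
    fix j assume j: "j \<in> {1..m + 1}"
    have z: "num_excess (int (3 * j - 2)) ?n = 0" "num_excess (- int (3 * j - 2)) ?n = 0"
      "num_excess (int (3 * j - 1)) ?n = 0" "num_excess (- int (3 * j - 1)) ?n = 0"
      by (rule num_excess_eq_0, use j in presburger)+
    have "pent (int (3 * j)) + 0 = 3 * expo (- 1) j" "pent (- int (3 * j)) + 0 = 3 * expo 1 j"
      by (rule pent_step; simp add: algebra_simps)+
    then have "real (num_excess (int (3 * j)) ?n) = opart (int m - expo (- 1) j)"
      "real (num_excess (- int (3 * j)) ?n) = opart (int m - expo 1 j)"
      by (intro num_excess_eq_opart; simp)+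
    with z show "?f (3 * j - 2) + ?f (3 * j - 1) + ?f (3 * j) =
      opart (int m - expo (- 1) j) - opart (int m - expo 1 j)" by simp
  qed
  finally show ?thesis .
qed

text \<open>The surviving k are 1, 4, 7, ... and -2, -5, ...; the value k = 1 has no partner and
  gives \<open>opart (int m)\<close>.\<close>

lemma d0_difference_mod_1:
  "real (d0 1 2 3 (3 * m + 1)) - real (d0 2 1 3 (3 * m + 1)) = opart (int m) - alt_sum 5 m"
proof -
  let ?n = "3 * m + 1"
  let ?f = "\<lambda>k. real (num_excess (int k) ?n) - real (num_excess (- int k) ?n)"
  have "real (d0 1 2 3 ?n) - real (d0 2 1 3 ?n) = (\<Sum>k = 1..3 * (m + 1). ?f k)"
    by (rule d0_difference) simp
  also have "\<dots> = (\<Sum>j = 1..m + 1. opart (int m - expo 5 (j - 1)) - opart (int m - expo (- 5) j))"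
    unfolding sum_triples
  proof (rule sum.cong[OF refl])
    fix j assume j: "j \<in> {1..m + 1}"
    then obtain i where i: "j = Suc i" by (cases j) auto
    have z: "num_excess (int (3 * j)) ?n = 0" "num_excess (- int (3 * j - 2)) ?n = 0"
      "num_excess (int (3 * j - 1)) ?n = 0" "num_excess (- int (3 * j)) ?n = 0"
      by (rule num_excess_eq_0, use j in presburger)+
    have "pent (int (3 * j - 2)) + (-1) = 3 * expo 5 i" "pent (- int (3 * j - 1)) + (-1) = 3 * expo (- 5) j"
      by (rule pent_step; simp add: i algebra_simps)+
    then have "real (num_excess (int (3 * j - 2)) ?n) = opart (int m - expo 5 (j - 1))"
      "real (num_excess (- int (3 * j - 1)) ?n) = opart (int m - expo (- 5) j)"
      by (intro num_excess_eq_opart; simp add: i)+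
    with z show "?f (3 * j - 2) + ?f (3 * j - 1) + ?f (3 * j) =
      opart (int m - expo 5 (j - 1)) - opart (int m - expo (- 5) j)" by simp
  qed
  also have "\<dots> = opart (int m) - alt_sum 5 m"
    using sum_shift_opart[of 5 m] by (simp add: sum_subtractf alt_sum_def alt_term_def)
  finally show ?thesis .
qed

text \<open>The surviving k are 2, 5, 8, ... and -1, -4, ...; the unpaired value k = -1 enters with
  a minus sign.\<close>

lemma d0_difference_mod_2:
  "real (d0 1 2 3 (3 * m + 2)) - real (d0 2 1 3 (3 * m + 2)) = alt_sum 7 m - opart (int m)"
proof -
  let ?n = "3 * m + 2"
  let ?f = "\<lambda>k. real (num_excess (int k) ?n) - real (num_excess (- int k) ?n)"
  have "real (d0 1 2 3 ?n) - real (d0 2 1 3 ?n) = (\<Sum>k = 1..3 * (m + 1). ?f k)"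
    by (rule d0_difference) simp
  also have "\<dots> = (\<Sum>j = 1..m + 1. opart (int m - expo (- 7) j) - opart (int m - expo 7 (j - 1)))"
    unfolding sum_triples
  proof (rule sum.cong[OF refl])
    fix j assume j: "j \<in> {1..m + 1}"
    then obtain i where i: "j = Suc i" by (cases j) auto
    have z: "num_excess (int (3 * j)) ?n = 0" "num_excess (- int (3 * j - 1)) ?n = 0"
      "num_excess (int (3 * j - 2)) ?n = 0" "num_excess (- int (3 * j)) ?n = 0"
      by (rule num_excess_eq_0, use j in presburger)+
    have "pent (int (3 * j - 1)) + (-2) = 3 * expo (- 7) j" "pent (- int (3 * j - 2)) + (-2) = 3 * expo 7 i"
      by (rule pent_step; simp add: i algebra_simps)+
    then have "real (num_excess (int (3 * j - 1)) ?n) = opart (int m - expo (- 7) j)"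
      "real (num_excess (- int (3 * j - 2)) ?n) = opart (int m - expo 7 (j - 1))"
      by (intro num_excess_eq_opart; simp add: i)+
    with z show "?f (3 * j - 2) + ?f (3 * j - 1) + ?f (3 * j) =
      opart (int m - expo (- 7) j) - opart (int m - expo 7 (j - 1))" by simp
  qed
  also have "\<dots> = alt_sum 7 m - opart (int m)"
    using sum_shift_opart[of 7 m] by (simp add: sum_subtractf alt_sum_def alt_term_def)
  finally show ?thesis .
qed

section \<open>Asymptotics of the alternating sums\<close>

definition overpart_main :: "real \<Rightarrow> real" where
  "overpart_main y = exp (pi * sqrt y) / (8 * y)"

lemma overpart_main_pos: "y > 0 \<Longrightarrow> overpart_main y > 0"
  by (simp add: overpart_main_def)

text \<open>Concavity gives sqrt (m - x) <= sqrt m - x/(2 sqrt m). The exponent then uses pi/2 >= 1,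
  and m - x >= m/2 in the denominator costs the factor 2.\<close>

lemma overpart_main_decay:
  assumes m: "m > 0" and x: "0 \<le> x" "2 * x \<le> m"
  shows "overpart_main (m - x) \<le> 2 * overpart_main m * exp (- (x / sqrt m))"
proof -
  have "sqrt (m - x) \<le> sqrt m - x / (2 * sqrt m)"
  proof (rule real_le_lsqrt)
    have "x / (2 * sqrt m) \<le> m / sqrt m" using m x by (intro frac_le) auto
    then show "0 \<le> sqrt m - x / (2 * sqrt m)" using m by (simp add: real_div_sqrt)
    have "(sqrt m - x / (2 * sqrt m))\<^sup>2 = (sqrt m)\<^sup>2 - x + (x / (2 * sqrt m))\<^sup>2"
      using m by (simp add: power2_diff)
    then show "m - x \<le> (sqrt m - x / (2 * sqrt m))\<^sup>2" using m by simp
  qed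
  then have "pi * sqrt (m - x) \<le> pi * (sqrt m - x / (2 * sqrt m))" by (intro mult_left_mono) auto
  also have "\<dots> = pi * sqrt m - pi / 2 * (x / sqrt m)" by (simp add: algebra_simps)
  also have "\<dots> \<le> pi * sqrt m - 1 * (x / sqrt m)"
    using pi_ge_two m x by (intro diff_left_mono mult_right_mono) auto
  finally have "exp (pi * sqrt (m - x)) \<le> exp (pi * sqrt m + - (x / sqrt m))" by simp
  then have e: "exp (pi * sqrt (m - x)) \<le> exp (pi * sqrt m) * exp (- (x / sqrt m))" by (simp only: exp_add)
  have "overpart_main (m - x) \<le> (exp (pi * sqrt m) * exp (- (x / sqrt m))) / (4 * m)"
    unfolding overpart_main_def using e m x by (intro frac_le) auto
  then show ?thesis by (simp add: overpart_main_def)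
qed

definition overpart_main' :: "real \<Rightarrow> real" where
  "overpart_main' y = overpart_main y * (pi / (2 * sqrt y) - 1 / y)"

definition overpart_main'' :: "real \<Rightarrow> real" where
  "overpart_main'' y = overpart_main y * ((pi / (2 * sqrt y) - 1 / y)\<^sup>2 + (1 / y\<^sup>2 - pi / (4 * y * sqrt y)))"

lemma overpart_main_deriv:
  assumes y: "y > 0"
  shows "(overpart_main has_real_derivative overpart_main' y) (at y)"
proof -
  have "((\<lambda>y. exp (pi * sqrt y) / (8 * y)) has_real_derivative
     (exp (pi * sqrt y) * (pi * (inverse (sqrt y) / 2)) * (8 * y) - exp (pi * sqrt y) * 8) / ((8 * y) * (8 * y))) (at y)"
    using y by (auto intro!: derivative_eq_intros)
  also have "(exp (pi * sqrt y) * (pi * (inverse (sqrt y) / 2)) * (8 * y) - exp (pi * sqrt y) * 8) / ((8 * y) * (8 * y)) = overpart_main' y"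
    using y by (simp add: overpart_main'_def overpart_main_def field_simps)
  finally show ?thesis by (simp add: overpart_main_def[abs_def])
qed

lemma overpart_main'_deriv:
  assumes y: "y > 0"
  shows "(overpart_main' has_real_derivative overpart_main'' y) (at y)"
proof -
  have 1: "((\<lambda>y. pi / (2 * sqrt y) - 1 / y) has_real_derivative (1 / y\<^sup>2 - pi / (4 * y * sqrt y))) (at y)"
  proof -
    have "((\<lambda>y. pi / 2 * inverse (sqrt y) - inverse y) has_real_derivative
        (pi / 2 * (- (inverse (sqrt y) * (inverse (sqrt y) / 2) * inverse (sqrt y))) - (- (inverse y * 1 * inverse y)))) (at y)"
      using y by (auto intro!: derivative_eq_intros)
    moreover have "pi / 2 * (- (inverse (sqrt y) * (inverse (sqrt y) / 2) * inverse (sqrt y))) - (- (inverse y * 1 * inverse y))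
       = 1 / y\<^sup>2 - pi / (4 * y * sqrt y)"
      using y by (simp add: field_simps power2_eq_square)
    moreover have "(\<lambda>y. pi / 2 * inverse (sqrt y) - inverse y) = (\<lambda>y. pi / (2 * sqrt y) - 1 / y)"
      by (simp add: inverse_eq_divide)
    ultimately show ?thesis by simp
  qed
  have "((\<lambda>y. overpart_main y * (pi / (2 * sqrt y) - 1 / y)) has_real_derivative
      (overpart_main' y * (pi / (2 * sqrt y) - 1 / y) + (1 / y\<^sup>2 - pi / (4 * y * sqrt y)) * overpart_main y)) (at y)"
    by (rule DERIV_mult[OF overpart_main_deriv[OF y] 1])
  moreover have "overpart_main' y * (pi / (2 * sqrt y) - 1 / y) + (1 / y\<^sup>2 - pi / (4 * y * sqrt y)) * overpart_main y = overpart_main'' y"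
    unfolding overpart_main'_def overpart_main''_def power2_eq_square[of "pi / (2 * sqrt y) - 1 / y"] by (simp add: algebra_simps)
  ultimately show ?thesis by (simp add: overpart_main'_def[abs_def])
qed

text \<open>The logarithmic derivative is O(y^(-1/2)) and its derivative is O(1/y), so F''/F is
  O(1/y); the constant is 4 + 1 + 1.\<close>

lemma overpart_main''_bound:
  assumes y: "y \<ge> 1"
  shows "\<bar>overpart_main'' y\<bar> \<le> 6 / y * overpart_main y"
proof -
  define r where "r = 1 / sqrt y"
  have r: "0 < r" "r \<le> 1" using y by (auto simp: r_def)
  have ry: "r\<^sup>2 = 1 / y" using y by (simp add: r_def power_divide)
  have 1: "pi / (2 * sqrt y) - 1 / y = pi / 2 * r - r\<^sup>2" by (simp add: ry) (simp add: r_def)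
  have r2: "r\<^sup>2 \<le> r" using r by (simp add: power2_eq_square)
  have "pi / 2 * r \<le> 2 * r" "0 \<le> pi / 2 * r" using pi_less_4 r by (auto intro!: mult_right_mono)
  then have "\<bar>pi / 2 * r - r\<^sup>2\<bar> \<le> 2 * r" using r r2 zero_le_power2[of r] unfolding abs_le_iff by linarith
  then have "(pi / 2 * r - r\<^sup>2)\<^sup>2 \<le> (2 * r)\<^sup>2" by (metis abs_ge_zero power2_abs power_mono)
  then have 2: "(pi / 2 * r - r\<^sup>2)\<^sup>2 \<le> 4 * r\<^sup>2" by (simp add: power_mult_distrib)
  have 3: "1 / y\<^sup>2 \<le> r\<^sup>2" unfolding ry using y by (intro frac_le) (auto simp: power2_eq_square)
  have 4: "pi / (4 * y * sqrt y) \<le> r\<^sup>2"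
  proof -
    have "pi / (4 * y * sqrt y) = r\<^sup>2 * (pi / 4 * r)" by (simp add: ry) (simp add: r_def)
    also have "\<dots> \<le> r\<^sup>2 * (1 * 1)" using pi_less_4 r by (intro mult_left_mono mult_mono) auto
    finally show ?thesis by simp
  qed
  have 5: "0 \<le> 1 / y\<^sup>2" "0 \<le> pi / (4 * y * sqrt y)" "0 \<le> (pi / 2 * r - r\<^sup>2)\<^sup>2" using y by auto
  have "\<bar>(pi / (2 * sqrt y) - 1 / y)\<^sup>2 + (1 / y\<^sup>2 - pi / (4 * y * sqrt y))\<bar> \<le> 6 * r\<^sup>2"
    unfolding 1 using 2 3 4 5 by linarith
  then have "overpart_main y * \<bar>(pi / (2 * sqrt y) - 1 / y)\<^sup>2 + (1 / y\<^sup>2 - pi / (4 * y * sqrt y))\<bar> \<le> overpart_main y * (6 * r\<^sup>2)"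
    using overpart_main_pos[of y] y by (intro mult_left_mono) auto
  then show ?thesis using overpart_main_pos[of y] y
    by (simp add: overpart_main''_def abs_mult ry mult.commute)
qed

text \<open>By the mean value theorem both increments are lengths times values of f' at points of
  [c, d], and these values differ by at most (d - c) M. The comparison is thus accurate to second
  order wherever the smaller interval lies.\<close>

lemma sub_interval_difference:
  fixes f f' f'' :: "real \<Rightarrow> real"
  assumes I: "c \<le> a" "a < b" "b \<le> d"
    and f: "\<And>x. c \<le> x \<Longrightarrow> x \<le> d \<Longrightarrow> (f has_real_derivative f' x) (at x)"
    and f': "\<And>x. c \<le> x \<Longrightarrow> x \<le> d \<Longrightarrow> (f' has_real_derivative f'' x) (at x)"
    and M: "\<And>x. c \<le> x \<Longrightarrow> x \<le> d \<Longrightarrow> \<bar>f'' x\<bar> \<le> M"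
  shows "\<bar>(f b - f a) - (b - a) / (d - c) * (f d - f c)\<bar> \<le> (b - a) * ((d - c) * M)"
proof -
  obtain x where x: "a < x" "x < b" "f b - f a = (b - a) * f' x"
    using MVT2[OF I(2), of f f'] f I by (meson less_imp_le order_trans)
  have cd: "c < d" using I by linarith
  obtain y where y: "c < y" "y < d" "f d - f c = (d - c) * f' y"
    using MVT2[OF cd, of f f'] f by blast
  have "\<bar>f' x - f' y\<bar> \<le> M * \<bar>x - y\<bar>"
  proof -
    have "norm (f' x - f' y) \<le> M * norm (x - y)"
    proof (rule differentiable_bound[of "{c..d}" f' "\<lambda>z. (*) (f'' z)"])
      show "(f' has_derivative (*) (f'' z)) (at z within {c..d})" if "z \<in> {c..d}" for z
        using f'[of z] that by (auto simp: has_field_derivative_def intro: has_derivative_at_withinI)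
      show "onorm ((*) (f'' z)) \<le> M" if "z \<in> {c..d}" for z
        by (rule onorm_le) (use M[of z] that in \<open>auto simp: abs_mult intro: mult_right_mono\<close>)
    qed (use x y I in auto)
    then show ?thesis by simp
  qed
  also have "\<dots> \<le> M * (d - c)"
    using x y I M[of c] by (intro mult_left_mono) (auto simp: abs_le_iff)
  finally have "(b - a) * \<bar>f' x - f' y\<bar> \<le> (b - a) * (M * (d - c))" using I by (intro mult_left_mono) auto
  moreover have "(f b - f a) - (b - a) / (d - c) * (f d - f c) = (b - a) * (f' x - f' y)"
    using cd by (simp add: x(3) y(3) right_diff_distrib)
  ultimately show ?thesis using I by (simp add: abs_mult mult.commute)
qed

section \<open>Summation over the grid\<close>

text \<open>The interval from \<open>grid j\<close> to \<open>grid (Suc j)\<close> has length 9 j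
  and the same midpoint 9 j^2/2 as the interval of length a j between \<open>expo (- a) j\<close>
  and \<open>expo a j\<close>. The ratio a/9 is independent of j and adjacent grid intervals share
  an end point, which is what permits telescoping.\<close>

definition grid :: "nat \<Rightarrow> real" where
  "grid j = 9 * real j * (real j - 1) / 2"

text \<open>With s = m^(1/4) these are Gaussian weights of width s. Each is at most exp(9/4)
  exp(-j/s), and the geometric series of exp(-j/s) is at most s.\<close>

lemma grid_exp_sum:
  assumes s: "s \<ge> 1"
  shows "(\<Sum>j = 1..J. (1 + (real j)\<^sup>2 / s\<^sup>2) * exp (- (grid j / s\<^sup>2))) \<le> exp (9 / 4) * s"
proof -
  have "(1 + (real j)\<^sup>2 / s\<^sup>2) * exp (- (grid j / s\<^sup>2)) \<le> exp (9 / 4) * exp (- (real j / s))" if j: "j \<in> {1..J}" for j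
  proof -
    define y where "y = real j / s"
    have y2: "(real j)\<^sup>2 / s\<^sup>2 = y\<^sup>2" by (simp add: y_def power_divide)
    have s2: "s\<^sup>2 \<ge> 1" using s by (simp add: one_le_power)
    \<comment> \<open>The product is twice grid j - 2 j^2 + 2. The coefficient 2 of j^2 leaves room
      to absorb 1 + y^2 <= exp (y^2).\<close>
    have "0 \<le> (real j - 1) * (5 * real j - 4)" using j by (intro mult_nonneg_nonneg) auto
    then have "grid j \<ge> 2 * (real j)\<^sup>2 - 2" by (simp add: grid_def power2_eq_square algebra_simps)
    then have "(2 * (real j)\<^sup>2 - 2) / s\<^sup>2 \<le> grid j / s\<^sup>2" by (rule divide_right_mono) auto
    moreover have "(2 * (real j)\<^sup>2 - 2) / s\<^sup>2 = 2 * y\<^sup>2 - 2 / s\<^sup>2" by (simp add: diff_divide_distrib flip: y2)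
    moreover have "2 / s\<^sup>2 \<le> 2" using divide_left_mono[OF s2, of 2] s by simp
    ultimately have g: "- (grid j / s\<^sup>2) \<le> 2 - 2 * y\<^sup>2" by linarith
    have "0 \<le> (y - 1 / 2)\<^sup>2" by simp
    then have yy: "- y\<^sup>2 \<le> 1 / 4 - y" by (simp add: power2_eq_square algebra_simps)
    have "(1 + y\<^sup>2) * exp (- (grid j / s\<^sup>2)) \<le> exp (y\<^sup>2) * exp (2 - 2 * y\<^sup>2)"
      using g exp_ge_add_one_self[of "y\<^sup>2"] by (intro mult_mono) auto
    also have "\<dots> = exp (2 - y\<^sup>2)" by (simp flip: exp_add)
    also have "\<dots> \<le> exp (9 / 4 + (- y))" using yy by simp
    also have "\<dots> = exp (9 / 4) * exp (- y)" by (simp only: exp_add)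
    finally show ?thesis unfolding y2 y_def[symmetric] .
  qed
  then have "(\<Sum>j = 1..J. (1 + (real j)\<^sup>2 / s\<^sup>2) * exp (- (grid j / s\<^sup>2))) \<le> (\<Sum>j = 1..J. exp (9 / 4) * exp (- (real j / s)))"
    by (rule sum_mono)
  also have "\<dots> = exp (9 / 4) * (\<Sum>j = 1..J. exp (- (real j / s)))" by (simp add: sum_distrib_left)
  also have "(\<Sum>j = 1..J. exp (- (real j / s))) \<le> s"
  proof -
    define x where "x = exp (- (1 / s))"
    have x: "0 < x" "x < 1" using s by (auto simp: x_def)
    have "exp (- (real j / s)) = x ^ j" for j by (simp add: x_def flip: exp_of_nat_mult)
    then have "(\<Sum>j = 1..J. exp (- (real j / s))) = (\<Sum>j<J. x * x ^ j)"
      by (simp only:) (rule sum.reindex_bij_witness[of _ Suc "\<lambda>j. j - 1"]; auto simp: power_eq_if)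
    also have "\<dots> \<le> (\<Sum>j. x * x ^ j)"
      by (rule sum_le_suminf) (use x in \<open>auto intro!: summable_mult summable_geometric\<close>)
    also have "\<dots> = x * (1 / (1 - x))"
      using x by (subst suminf_mult) (auto simp: suminf_geometric summable_geometric)
    also have "\<dots> \<le> s"
    proof -
      have "1 + 1 / s \<le> exp (1 / s)" by (rule exp_ge_add_one_self)
      then have "x * (1 + 1 / s) \<le> x * exp (1 / s)" using x by (intro mult_left_mono) auto
      also have "x * exp (1 / s) = 1" by (simp add: x_def flip: exp_add)
      finally have "x / s \<le> 1 - x" by (simp add: algebra_simps)
      then show ?thesis using x s by (simp add: field_simps)
    qed
    finally show ?thesis .
  qed
  finally show ?thesis by simp
qed

text \<open>Each term carries two errors of relative size m^(-1/2): p is replaced by F, and the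
  difference of F by a/9 of the grid difference. The weights keep about m^(1/4) terms alive, whence
  m^(-1/4) in total. The range j <= sqrt m / 4 keeps all arguments above m/2, where the decay
  estimate holds.\<close>

lemma alt_sum_head:
  assumes a: "odd a" "1 \<le> a" "a \<le> 9" and C0: "C0 > 0"
    and asy: "\<And>m. m > 0 \<Longrightarrow> \<bar>real (overpartitions m) - overpart_main m\<bar> \<le> C0 / sqrt m * overpart_main m"
    and m: "36 \<le> sqrt (real m)" and J: "real J \<le> sqrt m / 4"
  shows "\<bar>(\<Sum>j = 1..J. alt_term a m j) -
      of_int a / 9 * (overpart_main m - overpart_main (m - grid (Suc J)))\<bar>
    \<le> (8 * C0 + 2000) * exp (9 / 4) * overpart_main m / sqrt (sqrt m)"
proof -
  define s where "s = sqrt (sqrt m)"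
  have m0: "m > 0" using m by (cases m) auto
  have s2: "s\<^sup>2 = sqrt m" by (simp add: s_def)
  have s1: "s \<ge> 1" using m0 unfolding s_def by (intro real_sqrt_ge_one) simp
  have mm: "sqrt m * sqrt m = m" by simp
  let ?F = "overpart_main" and ?R = "real_of_int a"
  have Fm: "?F m > 0" using m0 by (intro overpart_main_pos) auto
  let ?e = "\<lambda>j. exp (- (grid j / sqrt m))"
  have decay: "?F (real m - x) \<le> 2 * ?F m * ?e j" if "grid j \<le> x" "0 \<le> x" "2 * x \<le> m" for x :: real and j
  proof -
    have "?F (real m - x) \<le> 2 * ?F m * exp (- (x / sqrt m))" by (rule overpart_main_decay) (use that m0 in auto)
    also have "\<dots> \<le> 2 * ?F m * ?e j" using that Fm by (intro mult_left_mono) (auto intro: divide_right_mono)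
    finally show ?thesis .
  qed
  have bound: "\<bar>alt_term a m j -
      ?R / 9 * (?F (m - grid j) - ?F (m - grid (Suc j)))\<bar> \<le>
      (8 * C0 + 2000) * ?F m / sqrt m * ((1 + (real j)\<^sup>2 / s\<^sup>2) * exp (- (grid j / s\<^sup>2)))"
    if j: "j \<in> {1..J}" for j
  proof -
    have j1: "1 \<le> real j" and jJ: "real j \<le> sqrt m / 4" using j J by auto
    have eA: "2 * real_of_int (expo (- a) j) = real j * (9 * real j - ?R)"
      and eB: "2 * real_of_int (expo a j) = real j * (9 * real j + ?R)"
      using two_expo_real[of "- a" j] two_expo_real[of a j] a(1) by auto
    define A B where "A = real_of_int (expo (- a) j)" and "B = real_of_int (expo a j)"
    have aj: "1 * real j \<le> ?R * real j" "?R * real j \<le> 9 * real j" using a j1 by (auto intro!: mult_right_mono)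
    have g2: "2 * grid j = 9 * (real j * real j) - 9 * real j" "2 * grid (Suc j) = 9 * (real j * real j) + 9 * real j"
    proof -
      have "2 * grid j = real j * (9 * (real j - 1))" "2 * grid (Suc j) = 9 * (1 + real j) * real j"
        by (simp_all add: grid_def)
      then show "2 * grid j = 9 * (real j * real j) - 9 * real j" "2 * grid (Suc j) = 9 * (real j * real j) + 9 * real j"
        by (simp_all only: algebra_simps mult_1_right mult_1_left)
    qed
    have A2: "2 * A = 9 * (real j * real j) - ?R * real j" and B2: "2 * B = 9 * (real j * real j) + ?R * real j"
      unfolding A_def B_def eA eB by (simp_all add: algebra_simps)
    have ord: "grid j \<le> A" "A < B" "B \<le> grid (Suc j)" "grid j \<ge> 0"
    proof -
      show "grid j \<le> A" "A < B" "B \<le> grid (Suc j)" using aj g2 A2 B2 j1 by linarith+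
      show "grid j \<ge> 0" using j1 by (simp add: grid_def)
    qed
    \<comment> \<open>Here 9 j^2 + 9 j is at most 9m/16 + 9/4 sqrt m, and 36 <= sqrt m makes the
      second summand at most m/16.\<close>
    have half: "2 * grid (Suc j) \<le> m"
    proof -
      have "real j * real j \<le> (sqrt m / 4) * (sqrt m / 4)" using jJ by (intro mult_mono) auto
      then have "real j * real j \<le> m / 16" using mm by simp
      moreover have "36 * sqrt m \<le> m" using mult_right_mono[OF m, of "sqrt m"] mm by simp
      ultimately show ?thesis using g2 jJ by linarith
    qed
    have op: "\<bar>opart (int m - k) - ?F (real m - real_of_int k)\<bar> \<le> 4 * C0 * ?F m / sqrt m * ?e j"
      if k: "grid j \<le> of_int k" "real_of_int k \<le> grid (Suc j)" for k
    proof -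
      have k2: "2 * real_of_int k \<le> m" "0 \<le> real_of_int k" using k half ord by linarith+
      have "real_of_int k < real m" using k2 m0 by linarith
      then have km: "k < int m" by linarith
      define n where "n = nat (int m - k)"
      have n: "n > 0" "real n = real m - real_of_int k" using km by (auto simp: n_def)
      have "opart (int m - k) = real (overpartitions n)" using km by (simp add: opart_def n_def)
      then have "\<bar>opart (int m - k) - ?F (real m - real_of_int k)\<bar> \<le> C0 / sqrt (real m - real_of_int k) * ?F (real m - real_of_int k)"
        using asy[OF n(1)] by (simp add: n(2))
      also have "\<dots> \<le> (2 * C0 / sqrt m) * (2 * ?F m * ?e j)"
      proof (rule mult_mono)
        have "sqrt m / 2 = sqrt (m / 4)" by (simp add: real_sqrt_divide)
        also have "\<dots> \<le> sqrt (real m - real_of_int k)" using k2 by simp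
        finally have "C0 / sqrt (real m - real_of_int k) \<le> C0 / (sqrt m / 2)" using C0 m0 by (intro divide_left_mono mult_pos_pos) (use km in auto)
        then show "C0 / sqrt (real m - real_of_int k) \<le> 2 * C0 / sqrt m" by (simp add: mult.commute)
        show "?F (real m - real_of_int k) \<le> 2 * ?F m * ?e j" by (rule decay) (use k k2 in auto)
        show "0 \<le> ?F (real m - real_of_int k)" using n by (intro less_imp_le overpart_main_pos) linarith
      qed (use C0 in auto)
      finally show ?thesis by simp
    qed
    have main: "\<bar>(?F (m - A) - ?F (m - B)) - ?R / 9 * (?F (m - grid j) - ?F (m - grid (Suc j)))\<bar> \<le>
        1944 * ?F m / sqrt m * ((real j)\<^sup>2 / sqrt m) * ?e j"
    proof -
      \<comment> \<open>The second derivative is at most 6/y F(y), with y >= m/2 and the decay bound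
        for F(y). The lengths, at most 9 j each, then give 1944 = 9 * 9 * 24.\<close>
      let ?M = "24 / m * ?F m * ?e j"
      have "\<bar>(?F (m - A) - ?F (m - B)) - ((m - A) - (m - B)) / ((m - grid j) - (m - grid (Suc j))) * (?F (m - grid j) - ?F (m - grid (Suc j)))\<bar> \<le>
         ((m - A) - (m - B)) * (((m - grid j) - (m - grid (Suc j))) * ?M)"
      proof (rule sub_interval_difference[where f' = overpart_main' and f'' = overpart_main''])
        show "m - grid (Suc j) \<le> m - B" "m - B < m - A" "m - A \<le> m - grid j" using ord by auto
        fix y assume y: "m - grid (Suc j) \<le> y" "y \<le> m - grid j"
        have m2: "m / 2 \<le> y" using y half by linarith
        have "36 * 36 \<le> sqrt m * sqrt m" using m by (intro mult_mono) auto
        then have "1296 \<le> real m" by (simp only: mm)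
        then have y1: "y \<ge> 1" using m2 by linarith
        then show "(overpart_main has_real_derivative overpart_main' y) (at y)"
          "(overpart_main' has_real_derivative overpart_main'' y) (at y)"
          by (auto intro: overpart_main_deriv overpart_main'_deriv)
        have "?F (m - (m - y)) \<le> 2 * ?F m * ?e j" by (rule decay) (use y half ord in auto)
        then have Fy: "?F y \<le> 2 * ?F m * ?e j" by simp
        have "\<bar>overpart_main'' y\<bar> \<le> 6 / y * ?F y" by (rule overpart_main''_bound[OF y1])
        also have "\<dots> \<le> (12 / m) * (2 * ?F m * ?e j)"
        proof (rule mult_mono[OF _ Fy])
          have "6 / y \<le> 6 / (m / 2)" using m2 m0 y1 by (intro divide_left_mono mult_pos_pos) auto
          then show "6 / y \<le> 12 / m" by simp
          show "0 \<le> ?F y" using y1 by (intro less_imp_le overpart_main_pos) auto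
        qed auto
        finally show "\<bar>overpart_main'' y\<bar> \<le> ?M" by simp
      qed
      moreover have "(m - A) - (m - B) = ?R * real j" using A2 B2 by linarith
      moreover have "(m - grid j) - (m - grid (Suc j)) = 9 * real j" using g2 by linarith
      ultimately have "\<bar>(?F (m - A) - ?F (m - B)) - (?R * real j) / (9 * real j) * (?F (m - grid j) - ?F (m - grid (Suc j)))\<bar> \<le>
         (?R * real j) * ((9 * real j) * ?M)" by (simp only:)
      also have "(?R * real j) * ((9 * real j) * ?M) \<le> (9 * real j) * ((9 * real j) * ?M)"
        using Fm by (intro mult_right_mono[OF aj(2)]) auto
      also have "\<dots> = 1944 * ?F m / (sqrt m * sqrt m) * (real j)\<^sup>2 * ?e j"
        unfolding mm by (simp add: power2_eq_square)
      also have "\<dots> = 1944 * ?F m / sqrt m * ((real j)\<^sup>2 / sqrt m) * ?e j"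
        by simp
      finally show ?thesis using j1 by simp
    qed
    have "\<bar>opart (int m - expo (- a) j) - ?F (m - A)\<bar> \<le> 4 * C0 * ?F m / sqrt m * ?e j"
      unfolding A_def by (rule op) (use ord in \<open>auto simp: A_def\<close>)
    moreover have "\<bar>opart (int m - expo a j) - ?F (m - B)\<bar> \<le> 4 * C0 * ?F m / sqrt m * ?e j"
      unfolding B_def by (rule op) (use ord in \<open>auto simp: B_def\<close>)
    ultimately have "\<bar>alt_term a m j -
      ?R / 9 * (?F (m - grid j) - ?F (m - grid (Suc j)))\<bar> \<le>
      4 * C0 * ?F m / sqrt m * ?e j + 4 * C0 * ?F m / sqrt m * ?e j + 1944 * ?F m / sqrt m * ((real j)\<^sup>2 / sqrt m) * ?e j"
      using main unfolding alt_term_def by linarith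
    also have "\<dots> = ?F m / sqrt m * ?e j * (8 * C0 * 1 + 1944 * ((real j)\<^sup>2 / sqrt m))"
      by (simp add: algebra_simps)
    also have "\<dots> \<le> ?F m / sqrt m * ?e j * ((8 * C0 + 2000) * 1 + (8 * C0 + 2000) * ((real j)\<^sup>2 / sqrt m))"
      using Fm C0 by (intro mult_left_mono add_mono mult_right_mono) auto
    also have "X / q * e * (K * 1 + K * Y) = K * X / q * ((1 + Y) * e)" for X q e K Y :: real
      by (simp add: algebra_simps add_divide_distrib)
    finally have "\<bar>alt_term a m j -
      ?R / 9 * (?F (m - grid j) - ?F (m - grid (Suc j)))\<bar> \<le>
      (8 * C0 + 2000) * ?F m / sqrt m * ((1 + (real j)\<^sup>2 / sqrt m) * ?e j)" .
    then show ?thesis unfolding s2 .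
  qed
  have tele: "(\<Sum>j = 1..J. ?F (m - grid j) - ?F (m - grid (Suc j))) = ?F m - ?F (m - grid (Suc J))"
    by (induction J) (simp_all add: grid_def)
  have "\<bar>(\<Sum>j = 1..J. alt_term a m j) -
      ?R / 9 * (?F m - ?F (m - grid (Suc J)))\<bar> =
    \<bar>\<Sum>j = 1..J. alt_term a m j -
      ?R / 9 * (?F (m - grid j) - ?F (m - grid (Suc j)))\<bar>"
    unfolding tele[symmetric] by (simp only: sum_subtractf sum_distrib_left[symmetric])
  also have "\<dots> \<le> (\<Sum>j = 1..J. (8 * C0 + 2000) * ?F m / sqrt m * ((1 + (real j)\<^sup>2 / s\<^sup>2) * exp (- (grid j / s\<^sup>2))))"
    by (rule order_trans[OF sum_abs sum_mono]) (rule bound)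
  also have "\<dots> = (8 * C0 + 2000) * ?F m / sqrt m * (\<Sum>j = 1..J. (1 + (real j)\<^sup>2 / s\<^sup>2) * exp (- (grid j / s\<^sup>2)))"
    by (simp only: sum_distrib_left)
  also have "\<dots> \<le> (8 * C0 + 2000) * ?F m / sqrt m * (exp (9 / 4) * s)"
    using C0 Fm by (intro mult_left_mono grid_exp_sum s1) auto
  also have "\<dots> = (8 * C0 + 2000) * exp (9 / 4) * ?F m / s"
    unfolding s2[symmetric] using s1 by (simp add: power2_eq_square)
  finally show ?thesis by (simp add: s_def)
qed

text \<open>The arguments are at most 3m/4 here and sqrt (3/4) < 7/8, so at most m + 1 such terms
  cannot compete with exp(pi sqrt m).\<close>

lemma alt_sum_tail:
  assumes a: "odd a" "1 \<le> a" "a \<le> 9" and C0: "C0 > 0"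
    and asy: "\<And>m. m > 0 \<Longrightarrow> \<bar>real (overpartitions m) - overpart_main m\<bar> \<le> C0 / sqrt m * overpart_main m"
    and g: "real m / 4 \<le> grid (Suc J)"
  shows "\<bar>\<Sum>j = Suc J..m + 1. alt_term a m j\<bar>
    \<le> (1 + C0 + real (overpartitions 0)) * (real m + 1) * exp (pi * (7 / 8 * sqrt m))"
proof -
  let ?F = "overpart_main" and ?X = "exp (pi * (7 / 8 * sqrt m))"
  let ?C = "1 + C0 + real (overpartitions 0)"
  have op: "0 \<le> opart (int m - k) \<and> opart (int m - k) \<le> ?C * ?X" if k: "real m / 4 \<le> of_int k" for k
  proof (cases "int m - k > 0")
    case True
    define n where "n = nat (int m - k)"
    have n: "n > 0" "real n = real m - real_of_int k" using True by (auto simp: n_def)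
    have on: "opart (int m - k) = real (overpartitions n)" using True by (simp add: opart_def n_def)
    have "real (overpartitions n) \<le> ?F n + C0 / sqrt n * ?F n" using asy[OF n(1)] by linarith
    also have "C0 / sqrt n * ?F n \<le> C0 * ?F n"
    proof (rule mult_right_mono)
      have "C0 / sqrt n \<le> C0 / 1" using n C0 by (intro divide_left_mono) auto
      then show "C0 / sqrt n \<le> C0" by simp
    qed (use n overpart_main_pos[of n] in auto)
    also have "?F n + C0 * ?F n = (1 + C0) * ?F n" by (simp add: algebra_simps)
    also have "\<dots> \<le> (1 + C0) * ?X"
    proof (rule mult_left_mono)
      have "?F n \<le> exp (pi * sqrt n) / 1" unfolding overpart_main_def using n by (intro divide_left_mono) auto
      also have "\<dots> \<le> ?X"
      proof -
        have "sqrt n \<le> 7 / 8 * sqrt m"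
        proof (rule real_le_lsqrt)
          have "real n \<le> 3 / 4 * real m" using n k by linarith
          then show "real n \<le> (7 / 8 * sqrt m)\<^sup>2" by (simp add: power_mult_distrib power_divide)
        qed auto
        then show ?thesis by simp
      qed
      finally show "?F n \<le> ?X" .
    qed (use C0 in auto)
    also have "\<dots> \<le> ?C * ?X" by (intro mult_right_mono) auto
    finally show ?thesis by (simp add: on)
  next
    \<comment> \<open>The argument 0 is outside the range of the asymptotic bound, hence the summand
      \<open>overpartitions 0\<close> in the constant.\<close>
    case False
    have X1: "?X \<ge> 1" by simp
    have "1 * real (overpartitions 0) \<le> ?C * ?X" 
      using mult_mono[of "real (overpartitions 0)" ?C 1 ?X] X1 C0 by simp
    moreover have "0 \<le> ?C * ?X" using C0 by simp
    ultimately show ?thesis using False by (auto simp: opart_def)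
  qed
  have "\<bar>alt_term a m j\<bar> \<le> ?C * ?X" if j: "j \<in> {Suc J..m + 1}" for j
  proof -
    have "grid (Suc J) \<le> grid j" unfolding grid_def using j by (intro divide_right_mono mult_mono) auto
    with g have gj: "real m / 4 \<le> grid j" by linarith
    have eA: "2 * real_of_int (expo (- a) j) = real j * (9 * real j - of_int a)"
      and eB: "2 * real_of_int (expo a j) = real j * (9 * real j + of_int a)"
      using two_expo_real[of "- a" j] two_expo_real[of a j] a(1) by auto
    have "real j * (9 * real j - 9) \<le> real j * (9 * real j - of_int a)" "real j * (9 * real j - 9) \<le> real j * (9 * real j + of_int a)"
      using a by (auto intro!: mult_left_mono)
    moreover have "2 * grid j = real j * (9 * (real j - 1))" by (simp add: grid_def)
    then have "2 * grid j = real j * (9 * real j - 9)" by (simp only: right_diff_distrib mult_1_right)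
    ultimately have "real m / 4 \<le> of_int (expo (- a) j)" "real m / 4 \<le> of_int (expo a j)"
      using eA eB gj by linarith+
    from op[OF this(1)] op[OF this(2)] show ?thesis unfolding alt_term_def by linarith
  qed
  then have "\<bar>\<Sum>j = Suc J..m + 1. alt_term a m j\<bar> \<le> (\<Sum>j = Suc J..m + 1. ?C * ?X)"
    by (intro order_trans[OF sum_abs sum_mono])
  also have "\<dots> = real (m + 1 - J) * (?C * ?X)" by simp
  also have "\<dots> \<le> (real m + 1) * (?C * ?X)" using C0 by (intro mult_right_mono) auto
  finally show ?thesis by (simp add: mult_ac)
qed

text \<open>The cut near sqrt m / 4 puts \<open>grid (Suc J)\<close> between m/4 and m/2: far enough
  for the tail and the end point of the telescoping sum to be negligible, near enough for the decay
  estimate to apply.\<close>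

lemma alt_sum_asymptotics:
  assumes a: "odd a" "1 \<le> a" "a \<le> 9"
  obtains C where "\<forall>\<^sub>F m in sequentially.
    \<bar>alt_sum a m - of_int a / 9 * overpart_main m\<bar> \<le> C * overpart_main m * real m powr (- 1 / 4)"
proof -
  obtain C0 where C0: "C0 > 0"
    and asy: "\<And>m. m > 0 \<Longrightarrow> \<bar>real (overpartitions m) - overpart_main m\<bar> \<le> C0 / sqrt m * overpart_main m"
    using overpartitions_asymptotics unfolding overpart_main_def by blast
  let ?F = "overpart_main"
  define C1 where "C1 = (8 * C0 + 2000) * exp (9 / 4)"
  define C2 where "C2 = 1 + C0 + real (overpartitions 0)"
  have C2: "C2 \<ge> 0" using C0 by (simp add: C2_def)
  have lim: "\<forall>\<^sub>F m in sequentially. (real m + 1) * exp (pi * (7 / 8 * sqrt m)) \<le> ?F m * real m powr (- 1 / 4)"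
  proof -
    have "((\<lambda>m::nat. (real m + 1) * exp (pi * (7 / 8 * sqrt m)) / (exp (pi * sqrt m) / (8 * real m) * real m powr (- 1 / 4))) \<longlongrightarrow> 0) sequentially"
      by real_asymp
    then have "\<forall>\<^sub>F m::nat in sequentially. (real m + 1) * exp (pi * (7 / 8 * sqrt m)) / (exp (pi * sqrt m) / (8 * real m) * real m powr (- 1 / 4)) < 1"
      by (rule order_tendstoD) simp
    then show ?thesis using eventually_gt_at_top[of 0]
    proof eventually_elim
      case (elim m)
      have "overpart_main m * real m powr (- 1 / 4) > 0"
        using elim(2) overpart_main_pos[of m] by simp
      with elim(1) show ?case unfolding overpart_main_def[symmetric] by (simp only: divide_less_eq_1_pos)
    qed
  qed
  have lim2: "\<forall>\<^sub>F m in sequentially. 2 * exp (- (real m / 4 / sqrt m)) \<le> real m powr (- 1 / 4)"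
    by real_asymp
  have ev36: "\<forall>\<^sub>F m in sequentially. 36 \<le> sqrt (real m)" by real_asymp
  have "\<forall>\<^sub>F m in sequentially.
    \<bar>alt_sum a m - of_int a / 9 * ?F m\<bar> \<le> (C1 + 1 + C2) * ?F m * real m powr (- 1 / 4)"
    using lim lim2 ev36
  proof eventually_elim
    case (elim m)
    have m0: "m > 0" using elim(3) by (cases m) auto
    have mm: "sqrt m * sqrt m = m" by simp
    have Fm: "?F m > 0" using m0 by (intro overpart_main_pos) auto
    have ss: "1 / sqrt (sqrt m) = real m powr (- 1 / 4)"
    proof -
      have "sqrt (sqrt m) = (real m powr (1/2)) powr (1/2)" using m0 by (simp add: powr_half_sqrt)
      also have "\<dots> = real m powr (1/4)" by (simp add: powr_powr)
      finally show ?thesis by (simp add: powr_minus_divide)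
    qed
    define J where "J = nat \<lfloor>sqrt m / 4\<rfloor>"
    have J: "real J \<le> sqrt m / 4" "sqrt m / 4 < real J + 1"
      using of_nat_floor[of "sqrt m / 4"] by (auto simp: J_def)
    have gJ: "2 * grid (Suc J) = 9 * ((real J + 1) * real J)" by (simp add: grid_def algebra_simps)
    have "(sqrt m / 4) * (sqrt m / 4 - 1) \<le> (real J + 1) * real J"
      using J elim(3) by (intro mult_mono) auto
    then have "9 / 16 * real m - 9 / 4 * sqrt m \<le> 2 * grid (Suc J)" using mm unfolding gJ by (simp add: algebra_simps)
    moreover have "36 * sqrt m \<le> m" using mult_right_mono[OF elim(3), of "sqrt m"] mm by simp
    ultimately have glow: "real m / 4 \<le> grid (Suc J)" by linarith
    have "(real J + 1) * real J \<le> (sqrt m / 4 + 1) * (sqrt m / 4)" using J by (intro mult_mono) auto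
    then have "2 * grid (Suc J) \<le> 9 / 16 * real m + 9 / 4 * sqrt m" using mm unfolding gJ by (simp add: algebra_simps)
    with \<open>36 * sqrt m \<le> m\<close> have ghigh: "2 * grid (Suc J) \<le> m" by linarith
    have JK: "J \<le> m + 1"
    proof -
      have "sqrt m \<le> m" using \<open>36 * sqrt m \<le> m\<close> real_sqrt_ge_zero[of m] by linarith
      then have "real J \<le> real m" using J by linarith
      then show ?thesis by simp
    qed
    let ?t = "alt_term a m"
    have split: "alt_sum a m = (\<Sum>j = 1..J. ?t j) + (\<Sum>j = Suc J..m + 1. ?t j)"
    proof -
      have "{1..m + 1} = {1..J} \<union> {Suc J..m + 1}" using JK by auto
      moreover have "{1..J} \<inter> {Suc J..m + 1} = {}" by auto
      ultimately show ?thesis unfolding alt_sum_def by (simp add: sum.union_disjoint)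
    qed
    have h: "\<bar>(\<Sum>j = 1..J. ?t j) - of_int a / 9 * (?F m - ?F (m - grid (Suc J)))\<bar> \<le> C1 * ?F m * real m powr (- 1 / 4)"
      using alt_sum_head[OF a C0 asy elim(3) J(1)] unfolding ss[symmetric] C1_def by simp
    have t: "\<bar>\<Sum>j = Suc J..m + 1. ?t j\<bar> \<le> C2 * ?F m * real m powr (- 1 / 4)"
    proof -
      have "\<bar>\<Sum>j = Suc J..m + 1. ?t j\<bar> \<le> C2 * ((real m + 1) * exp (pi * (7 / 8 * sqrt m)))"
        using alt_sum_tail[OF a C0 asy glow] unfolding C2_def by (simp only: mult.assoc)
      also have "\<dots> \<le> C2 * (?F m * real m powr (- 1 / 4))" using elim(1) C2 by (rule mult_left_mono)
      finally show ?thesis by (simp only: mult.assoc)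
    qed
    have e: "\<bar>of_int a / 9 * ?F (m - grid (Suc J))\<bar> \<le> 1 * ?F m * real m powr (- 1 / 4)"
    proof -
      have g0: "0 \<le> grid (Suc J)" using glow by linarith
      have pos: "m - grid (Suc J) > 0" using ghigh m0 by simp
      have "\<bar>of_int a / 9 * ?F (m - grid (Suc J))\<bar> = of_int a / 9 * ?F (m - grid (Suc J))"
        using overpart_main_pos[OF pos] a by simp
      also have "\<dots> \<le> 1 * ?F (m - grid (Suc J))"
        using overpart_main_pos[OF pos] a by (intro mult_right_mono) auto
      also have "?F (m - grid (Suc J)) \<le> 2 * ?F m * exp (- (grid (Suc J) / sqrt m))"
        by (rule overpart_main_decay) (use m0 g0 ghigh in auto)
      also have "\<dots> \<le> 2 * ?F m * exp (- (real m / 4 / sqrt m))"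
      proof (rule mult_left_mono)
        have "real m / 4 / sqrt m \<le> grid (Suc J) / sqrt m" using glow by (rule divide_right_mono) simp
        then show "exp (- (grid (Suc J) / sqrt m)) \<le> exp (- (real m / 4 / sqrt m))" by simp
      qed (use Fm in simp)
      also have "\<dots> \<le> ?F m * real m powr (- 1 / 4)" using mult_left_mono[OF elim(2), of "?F m"] Fm by simp
      finally show ?thesis by simp
    qed
    have "alt_sum a m - of_int a / 9 * ?F m = ((\<Sum>j = 1..J. ?t j) - of_int a / 9 * (?F m - ?F (m - grid (Suc J))))
       + (\<Sum>j = Suc J..m + 1. ?t j) - of_int a / 9 * ?F (m - grid (Suc J))"
      unfolding split by (simp add: algebra_simps)
    then have "\<bar>alt_sum a m - of_int a / 9 * ?F m\<bar> \<le> C1 * ?F m * real m powr (- 1 / 4) + C2 * ?F m * real m powr (- 1 / 4)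
        + 1 * ?F m * real m powr (- 1 / 4)"
      using h t e by linarith
    then show ?case by (simp add: algebra_simps)
  qed
  then show ?thesis using that by blast
qed

lemma opart_asymptotics:
  obtains C where "\<forall>\<^sub>F m in sequentially.
    \<bar>opart (int m) - overpart_main m\<bar> \<le> C * overpart_main m * real m powr (- 1 / 4)"
proof -
  obtain C0 where C0: "C0 > 0"
    and asy: "\<And>m. m > 0 \<Longrightarrow> \<bar>real (overpartitions m) - overpart_main m\<bar> \<le> C0 / sqrt m * overpart_main m"
    using overpartitions_asymptotics unfolding overpart_main_def by blast
  have "\<forall>\<^sub>F m in sequentially. 1 / sqrt (real m) \<le> real m powr (- 1 / 4)" by real_asymp
  then have "\<forall>\<^sub>F m in sequentially.
    \<bar>opart (int m) - overpart_main m\<bar> \<le> C0 * overpart_main m * real m powr (- 1 / 4)"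
    using eventually_gt_at_top[of 0]
  proof eventually_elim
    case (elim m)
    have "\<bar>opart (int m) - overpart_main m\<bar> \<le> C0 * overpart_main m * (1 / sqrt m)"
      using asy[OF elim(2)] by (simp add: opart_def mult_ac)
    also have "\<dots> \<le> C0 * overpart_main m * real m powr (- 1 / 4)"
      using C0 overpart_main_pos[of m] elim by (intro mult_left_mono) auto
    finally show ?case .
  qed
  then show ?thesis using that by blast
qed

section \<open>From m to n = 3m + r\<close>

text \<open>The ratio of F(m) to exp(pi sqrt(n/3))/n at n = 3m + r tends to 3/8 with error
  O(m^(-1/2)), because sqrt(m + r/3) - sqrt m is of that order; the factor 8/3 in the hypothesis
  compensates for 3/8.\<close>

lemma residue_class_error:
  fixes d :: "nat \<Rightarrow> real" and r :: nat
  assumes r: "r < 3"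
    and d: "\<forall>\<^sub>F m in sequentially. \<bar>d (3 * m + r) - 8 / 3 * \<tau> * overpart_main m\<bar> \<le> C * overpart_main m * real m powr (- 1 / 4)"
  defines "g \<equiv> \<lambda>n::nat. exp (pi * sqrt (real n / 3)) / real n"
  obtains E where "E \<in> O(\<lambda>n. real n powr (-1/4))"
    "\<And>n. n > 0 \<Longrightarrow> n mod 3 = r \<Longrightarrow> d n = g n * (\<tau> + E n)"
proof -
  let ?K = "8 / 3 * \<bar>\<tau>\<bar> + 2 * \<bar>C\<bar>"
  \<comment> \<open>Zero off the residue class, so that the O-bound can hold along all n.\<close>
  define E where "E n = (if n mod 3 = r then d n / g n - \<tau> else 0)" for n
  have rho: "\<forall>\<^sub>F m in sequentially. \<bar>overpart_main m / g (3 * m + r) - 3 / 8\<bar> \<le> real m powr (- 1 / 4)"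
  proof -
    let ?h = "\<lambda>c. (\<lambda>m::nat. exp (pi * sqrt (real m)) / (8 * real m) / (exp (pi * sqrt ((3 * real m + c) / 3)) / (3 * real m + c)) - 3 / 8)"
    \<comment> \<open>For remainder 0 the expression vanishes identically once m >= 1.\<close>
    have "?h 0 \<in> o(\<lambda>m. real m powr (- 1 / 4))"
    proof (rule landau_o.smallI)
      fix c :: real assume "c > 0"
      then show "\<forall>\<^sub>F m in sequentially. norm (?h 0 m) \<le> c * norm (real m powr (- 1 / 4))"
        by (intro eventually_sequentiallyI[of 1]) simp
    qed
    moreover have "?h 1 \<in> o(\<lambda>m. real m powr (- 1 / 4))" by real_asymp
    moreover have "?h 2 \<in> o(\<lambda>m. real m powr (- 1 / 4))" by real_asymp
    moreover have "r = 0 \<or> r = 1 \<or> r = 2" using r by auto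
    ultimately have "?h (real r) \<in> o(\<lambda>m. real m powr (- 1 / 4))"
      by (elim disjE) (simp_all only: of_nat_0 of_nat_1 of_nat_numeral)
    from landau_o.smallD[OF this, of 1] show ?thesis by (simp add: g_def overpart_main_def)
  qed
  have np: "\<forall>\<^sub>F m in sequentially. real m powr (- 1 / 4) \<le> 2 * real (3 * m + r) powr (- 1 / 4)"
    using eventually_gt_at_top[of 1]
  proof eventually_elim
    case (elim m)
    \<comment> \<open>The generous 16 is a fourth power, so its power -1/4 is exactly 1/2.\<close>
    have "real (3 * m + r) \<le> 16 * real m" using elim r by simp
    then have "real (16 * m) powr (- 1 / 4) \<le> real (3 * m + r) powr (- 1 / 4)"
      using elim by (intro powr_mono2') auto
    moreover have "real (16 * m) powr (- 1 / 4) = real m powr (- 1 / 4) / 2"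
    proof -
      have "(16::real) powr (- 1 / 4) = (2 powr 4) powr (- 1 / 4)" by simp
      also have "\<dots> = 1 / 2" unfolding powr_powr by (simp add: powr_minus_divide)
      finally show ?thesis by (simp add: powr_mult)
    qed
    ultimately show ?case by simp
  qed
  have "\<forall>\<^sub>F m in sequentially. \<bar>E (3 * m + r)\<bar> \<le> ?K * 2 * real (3 * m + r) powr (- 1 / 4)"
    using d rho np eventually_gt_at_top[of 1]
  proof eventually_elim
    case (elim m)
    let ?n = "3 * m + r" and ?p = "real m powr (- 1 / 4)"
    have g0: "g ?n > 0" using elim by (simp add: g_def)
    have F0: "overpart_main m > 0" using elim by (intro overpart_main_pos) auto
    have p1: "?p \<le> 1" using elim powr_mono2'[of "-1/4" 1 "real m"] by simp
    define \<rho> where "\<rho> = overpart_main m / g ?n"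
    have \<rho>: "\<rho> > 0" "\<bar>\<rho> - 3 / 8\<bar> \<le> ?p" using g0 F0 elim(2) by (auto simp: \<rho>_def)
    then have \<rho>2: "\<rho> \<le> 2" using p1 by linarith
    have "E ?n = (d ?n - 8 / 3 * \<tau> * overpart_main m) / g ?n + 8 / 3 * \<tau> * (\<rho> - 3 / 8)"
      using r g0 by (simp add: E_def \<rho>_def field_simps)
    also have "\<bar>\<dots>\<bar> \<le> \<bar>(d ?n - 8 / 3 * \<tau> * overpart_main m) / g ?n\<bar> + \<bar>8 / 3 * \<tau> * (\<rho> - 3 / 8)\<bar>" by (rule abs_triangle_ineq)
    also have "\<bar>(d ?n - 8 / 3 * \<tau> * overpart_main m) / g ?n\<bar> \<le> (C * overpart_main m * ?p) / g ?n"
      unfolding abs_divide using g0 elim(1) by (simp add: divide_right_mono)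
    also have "\<dots> = C * (\<rho> * ?p)" by (simp add: \<rho>_def)
    also have "\<dots> \<le> \<bar>C\<bar> * (2 * ?p)" using \<rho> \<rho>2 by (intro mult_mono) auto
    also have "\<bar>8 / 3 * \<tau> * (\<rho> - 3 / 8)\<bar> \<le> 8 / 3 * \<bar>\<tau>\<bar> * ?p"
      unfolding abs_mult using \<rho> by (intro mult_mono) auto
    finally have "\<bar>E ?n\<bar> \<le> ?K * ?p" by (simp add: algebra_simps)
    also have "\<dots> \<le> ?K * (2 * real ?n powr (- 1 / 4))"
      using elim(3) by (intro mult_left_mono) auto
    finally show ?case by (simp only: mult.assoc)
  qed
  then obtain M where M: "\<And>m. m \<ge> M \<Longrightarrow> \<bar>E (3 * m + r)\<bar> \<le> ?K * 2 * real (3 * m + r) powr (- 1 / 4)"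
    unfolding eventually_sequentially by blast
  have "E \<in> O(\<lambda>n. real n powr (-1/4))"
  proof (rule bigoI)
    show "\<forall>\<^sub>F n in sequentially. norm (E n) \<le> ?K * 2 * norm (real n powr (-1/4))"
    proof (rule eventually_sequentiallyI)
      fix n assume n: "3 * M + 3 \<le> n"
      show "norm (E n) \<le> ?K * 2 * norm (real n powr (-1/4))"
      proof (cases "n mod 3 = r")
        case True
        then have "n = 3 * (n div 3) + r" by (metis mult_div_mod_eq)
        moreover have "n div 3 \<ge> M" using n by simp
        ultimately show ?thesis using M[of "n div 3"] by simp
      qed (auto simp: E_def)
    qed
  qed
  moreover have "d n = g n * (\<tau> + E n)" if "n > 0" "n mod 3 = r" for n
    using that by (simp add: E_def g_def)
  ultimately show ?thesis using that by blast
qed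

theorem corollary1p4:
  shows "\<exists>E0 E1 E2 :: nat \<Rightarrow> real.
    E0 \<in> O(\<lambda>n. real n powr (-1/4)) \<and>
    E1 \<in> O(\<lambda>n. real n powr (-1/4)) \<and>
    E2 \<in> O(\<lambda>n. real n powr (-1/4)) \<and>
    (\<forall>n>0. real (d0 1 2 3 n) - real (d0 2 1 3 n) =
      (if [n = 0] (mod 3) then exp (pi * sqrt (real n / 3)) / real n * (1/24 + E0 n)
       else if [n = 1] (mod 3) then exp (pi * sqrt (real n / 3)) / real n * (1/6 + E1 n)
       else exp (pi * sqrt (real n / 3)) / real n * (-1/12 + E2 n)))"
proof -
  let ?d = "\<lambda>n. real (d0 1 2 3 n) - real (d0 2 1 3 n)"
  let ?g = "\<lambda>n::nat. exp (pi * sqrt (real n / 3)) / real n"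
  let ?F = "\<lambda>m::nat. overpart_main m" and ?p = "\<lambda>m::nat. real m powr (- 1 / 4)"
  obtain C1 where C1: "\<forall>\<^sub>F m in sequentially. \<bar>alt_sum 1 m - of_int 1 / 9 * ?F m\<bar> \<le> C1 * ?F m * ?p m"
    using alt_sum_asymptotics[of 1] by auto
  obtain C5 where C5: "\<forall>\<^sub>F m in sequentially. \<bar>alt_sum 5 m - of_int 5 / 9 * ?F m\<bar> \<le> C5 * ?F m * ?p m"
    using alt_sum_asymptotics[of 5] by auto
  obtain C7 where C7: "\<forall>\<^sub>F m in sequentially. \<bar>alt_sum 7 m - of_int 7 / 9 * ?F m\<bar> \<le> C7 * ?F m * ?p m"
    using alt_sum_asymptotics[of 7] by auto
  obtain C where C: "\<forall>\<^sub>F m in sequentially. \<bar>opart (int m) - ?F m\<bar> \<le> C * ?F m * ?p m"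
    using opart_asymptotics by blast
  \<comment> \<open>8/3 * 1/24 = 1/9, the coefficient a/9 for a = 1.\<close>
  have "\<forall>\<^sub>F m in sequentially. \<bar>?d (3 * m + 0) - 8 / 3 * (1 / 24) * ?F m\<bar> \<le> C1 * ?F m * ?p m"
    using C1 by eventually_elim (use d0_difference_mod_0 in simp)
  from residue_class_error[OF _ this] obtain E0 where E0: "E0 \<in> O(\<lambda>n. real n powr (-1/4))"
    "\<And>n. n > 0 \<Longrightarrow> n mod 3 = 0 \<Longrightarrow> ?d n = ?g n * (1 / 24 + E0 n)" by auto
  \<comment> \<open>8/3 * 1/6 = 4/9 = 1 - 5/9, the unpaired p(m) minus the alternating sum for a =
    5.\<close>
  have "\<forall>\<^sub>F m in sequentially. \<bar>?d (3 * m + 1) - 8 / 3 * (1 / 6) * ?F m\<bar> \<le> (C + C5) * ?F m * ?p m"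
    using C C5
  proof eventually_elim
    case (elim m)
    have "(C + C5) * ?F m * ?p m = C * ?F m * ?p m + C5 * ?F m * ?p m" by (simp add: algebra_simps)
    with elim show ?case unfolding d0_difference_mod_1 by (simp add: abs_le_iff)
  qed
  from residue_class_error[OF _ this] obtain E1 where E1: "E1 \<in> O(\<lambda>n. real n powr (-1/4))"
    "\<And>n. n > 0 \<Longrightarrow> n mod 3 = 1 \<Longrightarrow> ?d n = ?g n * (1 / 6 + E1 n)" by auto
  \<comment> \<open>8/3 * (- 1/12) = -2/9 = 7/9 - 1, the alternating sum for a = 7 minus the
    unpaired p(m).\<close>
  have "\<forall>\<^sub>F m in sequentially. \<bar>?d (3 * m + 2) - 8 / 3 * (- 1 / 12) * ?F m\<bar> \<le> (C + C7) * ?F m * ?p m"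
    using C C7
  proof eventually_elim
    case (elim m)
    have "(C + C7) * ?F m * ?p m = C * ?F m * ?p m + C7 * ?F m * ?p m" by (simp add: algebra_simps)
    with elim show ?case unfolding d0_difference_mod_2 by (simp add: abs_le_iff)
  qed
  from residue_class_error[OF _ this] obtain E2 where E2: "E2 \<in> O(\<lambda>n. real n powr (-1/4))"
    "\<And>n. n > 0 \<Longrightarrow> n mod 3 = 2 \<Longrightarrow> ?d n = ?g n * (- 1 / 12 + E2 n)" by auto
  have "?d n = (if [n = 0] (mod 3) then ?g n * (1/24 + E0 n)
       else if [n = 1] (mod 3) then ?g n * (1/6 + E1 n) else ?g n * (-1/12 + E2 n))" if "n > 0" for n
  proof -
    have c: "[n = 0] (mod 3) \<longleftrightarrow> n mod 3 = 0" "[n = 1] (mod 3) \<longleftrightarrow> n mod 3 = 1"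
      by (auto simp: Cong.cong_def)
    have "n mod 3 = 0 \<or> n mod 3 = 1 \<or> n mod 3 = 2" by auto
    then show ?thesis unfolding c using E0(2) E1(2) E2(2) that by auto
  qed
  with E0(1) E1(1) E2(1) show ?thesis by blast
qed

end
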